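(* Let $d\in\mathbb N$, let $A\in\mathscr R$ be fixed, let $r\ge 0$, and consider the discounted aggregate claims $$\mathbf D_r(t)=\sum_{i=1}^{N(t)}\mathbf X^{(i)}e^{-r\tau_i}+\sum_{i=1}^{N(t)}\sum_{j=1}^{M_i}\mathbf Y^{(i,j)}e^{-r(\tau_i+D_{ij})}\mathbf 1_{\{\tau_i+D_{ij}\le t\}},\qquad t\ge 0,$$ in the model described in the context, with Assumptions 1 and 2 satisfied. Suppose there exists $\delta>0$ with $\mathbf E[e^{\delta M}]<\infty$, where $M$ has the common distribution $K$ of the $M_i$. Fix $T\in\Lambda$ and put $\Lambda_T=[0,T]\cap\Lambda$. (i) If $F,G\in\mathcal S_A$ and $G(xA)\asymp F(xA)$, then $$\mathbf P(\mathbf D_r(t)\in xA)\sim\int_0^t\mathbf P(\mathbf X\in xe^{rs}A)\,\lambda(ds)+\mathbf E[M]\int_0^t\int_0^{t-s}\mathbf P(\mathbf Y\in xe^{r(s+y)}A)\,H(dy)\,\lambda(ds)$$ as $x\to\infty$, uniformly for $t\in\Lambda_T$. (ii) If $F\in\mathcal S_A$ and $G(xA)=o[F(xA)]$, then $$\mathbf P(\mathbf D_r(t)\in xA)\sim\int_0^t\mathbf P(\mathbf X\in xe^{rs}A)\,\lambda(ds)$$ as $x\to\infty$, uniformly for $t\in\Lambda_T$.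
   Context: Model: main claim vectors $\{\mathbf X^{(i)},i\in\mathbb N\}$ are $[0,\infty)^d$-valued random vectors (each not identically the zero vector), arriving at times $0=\tau_0<\tau_1\le\tau_2\le\cdots$; $N(t)=\sup\{i\in\mathbb N:\tau_i\le t\}$ (with $\sup\emptyset=0$) is the counting process, with finite renewal function $\lambda(t)=\mathbf E[N(t)]=\sum_{i\ge1}\mathbf P(\tau_i\le t)$; $\Lambda=\{t:\lambda(t)>0\}$. Each main claim $\mathbf X^{(i)}$ generates $M_i$ ($\mathbb N_0$-valued) delayed claim vectors $\mathbf Y^{(i,j)}$, $1\le j\le M_i$, $[0,\infty)^d$-valued, arriving at times $\tau_i+D_{ij}$ with $D_{ij}\ge0$. Assumption 1: the sequences $\{\mathbf X^{(i)}\}$, $\{\mathbf Y^{(i,j)}\}$, $\{M_i\}$, $\{D_{ij}\}$ and the process $\{N(t)\}$ are mutually independent. Assumption 2: the inter-arrival times $\theta_i=\tau_i-\tau_{i-1}$ are i.i.d.; $\{\mathbf X^{(i)}\}$ are i.i.d. with distribution $F$ (generic copy $\mathbf X$), $\{\mathbf Y^{(i,j)}\}$ are i.i.d. with distribution $G$ (generic copy $\mathbf Y$), $\{M_i\}$ i.i.d. with distribution $K$, $\{D_{ij}\}$ i.i.d. with distribution $H$. Sets: $\mathscr R$ is the family of sets $A\subsetneq\mathbb R^d$ that are open, increasing (if $\mathbf z\in A$ and $\mathbf y\in[0,\infty)^d$ then $\mathbf z+\mathbf y\in A$), have convex complement, and satisfy $\mathbf 0\notin\overline A$. For a distribution $V$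 on $[0,\infty)^d$ with $\mathbf Z\sim V$, write $V(xA)=\mathbf P(\mathbf Z\in xA)$; $Z_A=\sup\{u:\mathbf Z\in uA\}$ has a proper distribution $V_A$ with $\overline{V_A}(x)=\mathbf P(\mathbf Z\in xA)$, $x>0$. $V\in\mathcal S_A$ means $V_A$ is subexponential: $\overline{V_A^{n*}}(x)/\overline{V_A}(x)\to n$ as $x\to\infty$ for all $n\ge2$. For positive functions, $f\asymp g$ means $f=O(g)$ and $g=O(f)$ as $x\to\infty$. "$f(x;t)\sim g(x;t)$ uniformly for $t\in\Delta$" means $\lim_{x\to\infty}\sup_{t\in\Delta}|f(x;t)/g(x;t)-1|=0$. *)

theory Defs
  imports "HOL-Probability.Probability" "HOL-Library.Landau_Symbols"
begin

datatype ridx = IX nat | IY nat nat | IM nat | ID nat nat | IT nat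

definition valid_idx :: "ridx set" where
  "valid_idx = {IX i | i. i \<ge> 1} \<union> {IY i j | i j. i \<ge> 1 \<and> j \<ge> 1} \<union> {IM i | i. i \<ge> 1}
     \<union> {ID i j | i j. i \<ge> 1 \<and> j \<ge> 1} \<union> {IT i | i. i \<ge> 1}"

definition gen_sets :: "'w measure \<Rightarrow> 'b measure \<Rightarrow> ('w \<Rightarrow> 'b) \<Rightarrow> 'w set set" where
  "gen_sets M N f = {f -` B \<inter> space M | B. B \<in> sets N}"

definition model_indep ::
  "'w measure \<Rightarrow> (nat \<Rightarrow> 'w \<Rightarrow> real^'d) \<Rightarrow> (nat \<Rightarrow> nat \<Rightarrow> 'w \<Rightarrow> real^'d)
   \<Rightarrow> (nat \<Rightarrow> 'w \<Rightarrow> nat) \<Rightarrow> (nat \<Rightarrow> nat \<Rightarrow> 'w \<Rightarrow> real) \<Rightarrow> (nat \<Rightarrow> 'w \<Rightarrow> real) \<Rightarrow> bool" where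
  "model_indep M X Y Mc Dl th = prob_space.indep_sets M
     (\<lambda>k. case k of
         IX i \<Rightarrow> gen_sets M borel (X i)
       | IY i j \<Rightarrow> gen_sets M borel (Y i j)
       | IM i \<Rightarrow> gen_sets M (count_space UNIV) (Mc i)
       | ID i j \<Rightarrow> gen_sets M borel (Dl i j)
       | IT i \<Rightarrow> gen_sets M borel (th i)) valid_idx"

definition tau :: "(nat \<Rightarrow> 'w \<Rightarrow> real) \<Rightarrow> nat \<Rightarrow> 'w \<Rightarrow> real" where
  "tau th i \<omega> = (\<Sum>k=1..i. th k \<omega>)"

(* counting process N(t) = sup {i : tau_i \<le> t}, sup {} = 0 *)
definition Ncount :: "(nat \<Rightarrow> 'w \<Rightarrow> real) \<Rightarrow> real \<Rightarrow> 'w \<Rightarrow> nat" where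
  "Ncount th t \<omega> = Sup {i. i \<ge> 1 \<and> tau th i \<omega> \<le> t}"

definition renewal_fun :: "'w measure \<Rightarrow> (nat \<Rightarrow> 'w \<Rightarrow> real) \<Rightarrow> real \<Rightarrow> real" where
  "renewal_fun M th t = (\<Sum>i. measure M {\<omega> \<in> space M. tau th (Suc i) \<omega> \<le> t})"

definition renewal_measure :: "'w measure \<Rightarrow> (nat \<Rightarrow> 'w \<Rightarrow> real) \<Rightarrow> real measure" where
  "renewal_measure M th = measure_of UNIV (sets borel)
     (\<lambda>B. \<Sum>i. emeasure M {\<omega> \<in> space M. tau th (Suc i) \<omega> \<in> B})"

definition Dr ::
  "(nat \<Rightarrow> 'w \<Rightarrow> real^'d) \<Rightarrow> (nat \<Rightarrow> nat \<Rightarrow> 'w \<Rightarrow> real^'d) \<Rightarrow> (nat \<Rightarrow> 'w \<Rightarrow> nat)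
   \<Rightarrow> (nat \<Rightarrow> nat \<Rightarrow> 'w \<Rightarrow> real) \<Rightarrow> (nat \<Rightarrow> 'w \<Rightarrow> real) \<Rightarrow> real \<Rightarrow> real \<Rightarrow> 'w \<Rightarrow> real^'d" where
  "Dr X Y Mc Dl th r t \<omega> =
     (\<Sum>i=1..Ncount th t \<omega>. exp (- r * tau th i \<omega>) *\<^sub>R X i \<omega>) +
     (\<Sum>i=1..Ncount th t \<omega>. \<Sum>j=1..Mc i \<omega>.
        (if tau th i \<omega> + Dl i j \<omega> \<le> t
         then exp (- r * (tau th i \<omega> + Dl i j \<omega>)) *\<^sub>R Y i j \<omega> else 0))"

definition nonneg_orthant :: "(real^'d) set" where
  "nonneg_orthant = {v. \<forall>k. 0 \<le> v $ k}"

definition class_R :: "(real^'d) set set" where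
  "class_R = {A. A \<noteq> UNIV \<and> open A \<and>
     (\<forall>z\<in>A. \<forall>y\<in>nonneg_orthant. z + y \<in> A) \<and> convex (- A) \<and> 0 \<notin> closure A}"

definition scale_set :: "real \<Rightarrow> (real^'d) set \<Rightarrow> (real^'d) set" where
  "scale_set x A = (\<lambda>v. x *\<^sub>R v) ` A"

(* Z_A = sup {u : Z \<in> uA}, with u > 0 and sup of the empty set read as 0 *)
definition Z_A :: "(real^'d) set \<Rightarrow> real^'d \<Rightarrow> real" where
  "Z_A A z = Sup ({0} \<union> {u. u > 0 \<and> z \<in> scale_set u A})"

definition dist_A :: "(real^'d) measure \<Rightarrow> (real^'d) set \<Rightarrow> real measure" where
  "dist_A V A = distr V borel (Z_A A)"

fun conv_pow :: "real measure \<Rightarrow> nat \<Rightarrow> real measure" where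
  "conv_pow V 0 = return borel 0"
| "conv_pow V (Suc n) = convolution V (conv_pow V n)"

definition subexponential :: "real measure \<Rightarrow> bool" where
  "subexponential V \<longleftrightarrow> (\<forall>n\<ge>2.
     ((\<lambda>x. measure (conv_pow V n) {x<..} / measure V {x<..}) \<longlongrightarrow> real n) at_top)"

definition subexp_A :: "(real^'d) set \<Rightarrow> (real^'d) measure \<Rightarrow> bool" where
  "subexp_A A V \<longleftrightarrow> subexponential (dist_A V A)"

definition asymp_unif :: "(real \<Rightarrow> real \<Rightarrow> real) \<Rightarrow> (real \<Rightarrow> real \<Rightarrow> real) \<Rightarrow> real set \<Rightarrow> bool" where
  "asymp_unif f g S \<longleftrightarrow>
     (\<forall>e>0. \<forall>\<^sub>F x in at_top. \<forall>t\<in>S. \<bar>f x t / g x t - 1\<bar> \<le> e)"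

end

theory Submission imports Defs begin

text \<open>
  The gauge \<open>Z_A\<close> of the set \<open>A\<close> is subadditive, positively homogeneous and monotone, and
  \<open>z \<in> xA\<close> iff \<open>Z_A z > x\<close>. Hence the event \<open>D_r(t) \<in> xA\<close> lies between the events that the maximum,
  respectively the sum, of the discounted real variables \<open>Z_A\<close> of the individual claims exceeds \<open>x\<close>.

  Given the arrival times, the offspring numbers and the delays, these are maxima and sums of \<open>n\<close>
  independent variables with deterministic weights. After division by the largest weight \<open>exp (- r \<tau>_1)\<close>
  the weights lie in \<open>[exp (- r T), 1]\<close>, and the tail of maximum and sum differs from the
  sum of the tails by at most \<open>\<epsilon> exp (s n)\<close> times the tail of \<open>F_A\<close> at \<open>x exp (r \<tau>_1)\<close>, for all
  \<open>n\<close> simultaneously: for bounded \<open>n\<close> because two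
  large summands are negligible, for large \<open>n\<close> by a Kesten type bound.

  The number of claims after \<open>\<tau>_1\<close> is dominated by a variable independent of \<open>\<tau>_1\<close> with a finite
  exponential moment, so after integration the error is at most \<open>\<epsilon>\<close> times the contribution of
  the first main claim, which is a summand of the asymptotic expression. This gives uniformity in \<open>t\<close>.
\<close>

section \<open>The gauge of an increasing set\<close>

text \<open>On \<Lambda>_T the probability P(\<tau>_1 \<le> t) may be arbitrarily small, so an error
  o(F(xA)), even if uniform in t, is too coarse: the error has to carry the event \<tau>_1 \<le> t
  itself. This is why every estimate is normalised at \<tau>_1 and compared with
  \<open>first\<close>, which is positive as soon as \<lambda>(t) > 0. The number of claims depends
  on \<tau>_1. It is bounded by a series of terms \<open>growth\<close> in which \<theta>_1 does not
  occur: if \<tau>_(n+1) \<le> T, then exp (T - \<theta>_2 - ... - \<theta>_(n+1)) \<ge> 1. The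
  series has finite mean because E exp (-\<theta>) < 1, while E exp (s (1 + M)) is close to 1 for
  small s. Both parts of the theorem share one argument. Of G it asks that its tail is at most C
  times that of F, and that a shift by h raises it by at most e times the tail of F. The shift
  condition comes from the long tail of G in (i) and from that of F in (ii).\<close>

lemma scale_set_iff:
  assumes "u \<noteq> 0"
  shows "z \<in> scale_set u A \<longleftrightarrow> (1 / u) *\<^sub>R z \<in> A"
proof
  assume "z \<in> scale_set u A"
  then show "(1 / u) *\<^sub>R z \<in> A" using assms by (auto simp: scale_set_def)
next
  assume "(1 / u) *\<^sub>R z \<in> A"
  moreover have "z = u *\<^sub>R ((1 / u) *\<^sub>R z)" using assms by simp
  ultimately show "z \<in> scale_set u A" unfolding scale_set_def by blast
qed

lemma nonneg_orthant_sum: "(\<And>k. k \<in> B \<Longrightarrow> f k \<in> nonneg_orthant) \<Longrightarrow> (\<Sum>k\<in>B. f k) \<in> nonneg_orthant"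
  by (auto simp: nonneg_orthant_def intro!: sum_nonneg)

locale increasing_set =
  fixes A :: "(real^'d) set"
  assumes AR: "A \<in> class_R"
begin

lemma A_open: "open A" and A_convex: "convex (- A)" and A_closure: "0 \<notin> closure A"
  and A_incr: "z \<in> A \<Longrightarrow> y \<in> nonneg_orthant \<Longrightarrow> z + y \<in> A"
  using AR by (auto simp: class_R_def)

lemma zero_notin_A: "0 \<notin> A"
  using A_closure closure_subset by blast

text \<open>The complement of A is convex and contains 0, hence it is star-shaped about 0: shrinking
  a point outside A keeps it outside.\<close>

lemma scale_set_antimono:
  assumes "0 < u" "u \<le> v" "z \<in> scale_set v A"
  shows "z \<in> scale_set u A"
proof (rule ccontr)
  assume "z \<notin> scale_set u A"
  then have "(1 / u) *\<^sub>R z \<in> - A" using assms by (simp add: scale_set_iff)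
  moreover have "0 \<in> - A" using zero_notin_A by simp
  ultimately have "(u / v) *\<^sub>R ((1 / u) *\<^sub>R z) + (1 - u / v) *\<^sub>R 0 \<in> - A"
    using assms by (intro convexD[OF A_convex]) (auto simp: field_simps)
  then show False using assms by (simp add: scale_set_iff)
qed

text \<open>A ball of radius e about 0 misses A, so z in uA forces u e \<le> |z|. This makes the
  \<open>Sup\<close> in \<open>Z_A\<close> a genuine supremum.\<close>

lemma bounded_scales: "bdd_above ({0} \<union> {u. u > 0 \<and> z \<in> scale_set u A})"
proof -
  have "open (- closure A)" "0 \<in> - closure A" using A_closure by auto
  then obtain e where e: "e > 0" "ball 0 e \<subseteq> - closure A"
    unfolding open_contains_ball by blast
  have "u \<le> norm z / e" if "u > 0" "z \<in> scale_set u A" for u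
  proof (rule ccontr)
    assume "\<not> u \<le> norm z / e"
    then have "norm ((1 / u) *\<^sub>R z) < e"
      using that e by (simp add: field_simps)
    then have "(1 / u) *\<^sub>R z \<in> ball 0 e" by simp
    then have "(1 / u) *\<^sub>R z \<in> - closure A" using e by blast
    then show False using that closure_subset[of A] by (auto simp: scale_set_iff)
  qed
  then show ?thesis using e by (intro bdd_aboveI[where M = "norm z / e"]) auto
qed

lemma Z_A_nonneg: "0 \<le> Z_A A z"
  unfolding Z_A_def by (rule cSup_upper[OF _ bounded_scales]) simp

text \<open>Openness of A gives the strict inequality: a point of xA still lies in uA for some u
  slightly above x.\<close>

lemma Z_A_gt_iff:
  assumes x: "0 < x"
  shows "x < Z_A A z \<longleftrightarrow> z \<in> scale_set x A"
proof
  assume "x < Z_A A z"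
  then obtain u where "u \<in> {0} \<union> {u. u > 0 \<and> z \<in> scale_set u A}" "x < u"
    unfolding Z_A_def using less_cSup_iff[OF _ bounded_scales[of z]] by auto
  then show "z \<in> scale_set x A" using x scale_set_antimono[of x u z] by auto
next
  assume "z \<in> scale_set x A"
  then have xz: "(1 / x) *\<^sub>R z \<in> A" using x by (simp add: scale_set_iff)
  have "((\<lambda>u. (1 / u) *\<^sub>R z) \<longlongrightarrow> (1 / x) *\<^sub>R z) (at_right x)"
    using x by (intro tendsto_intros) auto
  then have "\<forall>\<^sub>F u in at_right x. (1 / u) *\<^sub>R z \<in> A"
    using A_open xz topological_tendstoD by fastforce
  moreover have "\<forall>\<^sub>F u in at_right x. u > x" by (simp add: eventually_at_right_less)
  ultimately have "\<exists>u>x. (1 / u) *\<^sub>R z \<in> A"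
    using eventually_happens[OF eventually_conj, of _ "at_right x"] by fastforce
  then obtain u where u: "u > x" "(1 / u) *\<^sub>R z \<in> A" by blast
  then have "u \<le> Z_A A z" unfolding Z_A_def using x
    by (intro cSup_upper[OF _ bounded_scales]) (auto simp: scale_set_iff)
  then show "x < Z_A A z" using u by simp
qed

lemma Z_A_zero: "Z_A A 0 = 0"
proof -
  have "{0} \<union> {u. u > 0 \<and> (0::real^'d) \<in> scale_set u A} = {0}"
    using zero_notin_A by (auto simp: scale_set_iff)
  then show ?thesis unfolding Z_A_def by (metis cSup_singleton)
qed

lemma Z_A_scale:
  assumes "0 < c"
  shows "Z_A A (c *\<^sub>R z) = c * Z_A A z"
proof -
  have *: "x < Z_A A (c *\<^sub>R z) \<longleftrightarrow> x < c * Z_A A z" if "0 < x" for x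
  proof -
    have "x < Z_A A (c *\<^sub>R z) \<longleftrightarrow> x / c < Z_A A z"
      using that assms by (simp add: Z_A_gt_iff scale_set_iff mult.commute)
    also have "\<dots> \<longleftrightarrow> x < c * Z_A A z" using assms by (simp add: field_simps)
    finally show ?thesis .
  qed
  have "0 \<le> c * Z_A A z" "0 \<le> Z_A A (c *\<^sub>R z)"
    using assms Z_A_nonneg by auto
  \<comment> \<open>If the two sides differed, their midpoint would be a positive level separating
    them.\<close>
  then show ?thesis
    using *[of "(Z_A A (c *\<^sub>R z) + c * Z_A A z) / 2"]
    by (cases "Z_A A (c *\<^sub>R z)" "c * Z_A A z" rule: linorder_cases) auto
qed

text \<open>With y outside uA and z outside vA, the point (y + z) / (u + v) is a convex combination
  of y / u and z / v, so it lies in the convex complement. The slack e / 2 keeps u and v positive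
  when a gauge vanishes.\<close>

lemma Z_A_add: "Z_A A (y + z) \<le> Z_A A y + Z_A A z"
proof (rule field_le_epsilon)
  fix e :: real assume "0 < e"
  define u v where "u = Z_A A y + e / 2" and "v = Z_A A z + e / 2"
  have uv: "0 < u" "0 < v" using Z_A_nonneg[of y] Z_A_nonneg[of z] \<open>0 < e\<close> by (auto simp: u_def v_def)
  have "y \<notin> scale_set u A" "z \<notin> scale_set v A"
    using Z_A_gt_iff[OF uv(1), of y] Z_A_gt_iff[OF uv(2), of z] \<open>0 < e\<close> by (auto simp: u_def v_def)
  then have "(1 / u) *\<^sub>R y \<in> - A" "(1 / v) *\<^sub>R z \<in> - A" using uv by (auto simp: scale_set_iff)
  then have "(u / (u + v)) *\<^sub>R ((1 / u) *\<^sub>R y) + (v / (u + v)) *\<^sub>R ((1 / v) *\<^sub>R z) \<in> - A"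
    using uv by (intro convexD[OF A_convex]) (auto simp: add_divide_distrib[symmetric])
  then have "(1 / (u + v)) *\<^sub>R (y + z) \<notin> A" using uv by (simp add: scaleR_add_right)
  then have "\<not> u + v < Z_A A (y + z)" using uv by (simp add: Z_A_gt_iff scale_set_iff)
  then show "Z_A A (y + z) \<le> Z_A A y + Z_A A z + e" by (simp add: u_def v_def)
qed

lemma Z_A_sum: "finite B \<Longrightarrow> Z_A A (\<Sum>k\<in>B. f k) \<le> (\<Sum>k\<in>B. Z_A A (f k))"
proof (induction B rule: finite_induct)
  case (insert k B)
  then show ?case using Z_A_add[of "f k" "\<Sum>k\<in>B. f k"] by simp
qed (simp add: Z_A_zero)

lemma Z_A_mono:
  assumes "y \<in> nonneg_orthant"
  shows "Z_A A z \<le> Z_A A (z + y)"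
proof (rule ccontr)
  assume "\<not> ?thesis"
  then have less: "Z_A A (z + y) < Z_A A z" by simp
  define u where "u = (Z_A A (z + y) + Z_A A z) / 2"
  have u: "0 < u" "u < Z_A A z" "Z_A A (z + y) < u"
    using less Z_A_nonneg[of "z + y"] by (auto simp: u_def)
  have "(1 / u) *\<^sub>R z \<in> A" using u by (simp add: Z_A_gt_iff scale_set_iff)
  moreover have "(1 / u) *\<^sub>R y \<in> nonneg_orthant" using assms u by (auto simp: nonneg_orthant_def)
  ultimately have "(1 / u) *\<^sub>R (z + y) \<in> A" using A_incr by (simp add: scaleR_add_right)
  then show False using u by (simp add: Z_A_gt_iff[symmetric] scale_set_iff[symmetric])
qed

lemma Z_A_member_le_sum:
  assumes "finite B" "k \<in> B" "\<And>k. k \<in> B \<Longrightarrow> f k \<in> nonneg_orthant"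
  shows "Z_A A (f k) \<le> Z_A A (\<Sum>k\<in>B. f k)"
proof -
  have "(\<Sum>k\<in>B. f k) = f k + (\<Sum>j\<in>B - {k}. f j)"
    using assms by (simp add: sum.remove)
  then show ?thesis using Z_A_mono nonneg_orthant_sum[of "B - {k}" f] assms by simp
qed

lemma open_scale_set: "x \<noteq> 0 \<Longrightarrow> open (scale_set x A)"
  unfolding scale_set_def using open_scaling A_open by blast

lemma Z_A_measurable [measurable]: "Z_A A \<in> borel_measurable borel"
proof (rule borel_measurableI_greater)
  fix x :: real
  \<comment> \<open>Passing to rational levels q > x covers x = 0, about which
    \<open>Z_A_gt_iff\<close> says nothing.\<close>
  have eq: "{z. x < Z_A A z} = (if x < 0 then UNIV else
      (\<Union>q\<in>{q\<in>\<rat>. x < q}. scale_set q A))"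
  proof (cases "x < 0")
    case True
    then show ?thesis using Z_A_nonneg less_le_trans by auto
  next
    case False
    have "x < Z_A A z \<longleftrightarrow> (\<exists>q\<in>\<rat>. x < q \<and> q < Z_A A z)" for z
      using Rats_dense_in_real[of x "Z_A A z"] by auto
    then show ?thesis using False by (auto simp: Z_A_gt_iff)
  qed
  have "open {z. x < Z_A A z}"
    unfolding eq by (auto intro!: open_scale_set)
  then show "{w \<in> space borel. x < Z_A A w} \<in> sets borel"
    by simp
qed

lemma measure_dist_A:
  assumes "sets V = sets borel" "0 < x"
  shows "measure (dist_A V A) {x<..} = measure V (scale_set x A)"
proof -
  have m: "Z_A A \<in> borel_measurable V" using assms Z_A_measurable measurable_cong_sets by blast
  have "space V = UNIV" using assms sets_eq_imp_space_eq[of V borel] by simp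
  then have "Z_A A -` {x<..} \<inter> space V = scale_set x A" using assms by (auto simp: Z_A_gt_iff)
  then show ?thesis unfolding dist_A_def using m by (simp add: measure_distr)
qed

end

section \<open>Sums of independent variables with subexponential tails\<close>

text \<open>The recursion of \<open>conv_pow\<close> starts from the point mass at 0; this
  identifies \<open>conv_pow V 2\<close> with the convolution of V with itself.\<close>

lemma convolution_return_0:
  fixes V :: "'a :: ordered_euclidean_space measure"
  assumes "prob_space V" and [simp]: "sets V = sets borel"
  shows "convolution V (return borel 0) = V"
proof (rule measure_eqI)
  interpret prob_space V by fact
  interpret R: prob_space "return borel (0::'a)" by (rule prob_space_return) simp
  fix B assume "B \<in> sets (convolution V (return borel 0))"
  then have [measurable]: "B \<in> sets borel" by simp
  have "emeasure (convolution V (return borel 0)) B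
      = (\<integral>\<^sup>+ x. \<integral>\<^sup>+ y. indicator B (x + y) \<partial>return borel 0 \<partial>V)"
    by (intro convolution_emeasure') (auto intro: finite_measure_axioms R.finite_measure_axioms)
  also have "\<dots> = (\<integral>\<^sup>+ x. indicator B x \<partial>V)"
    by (intro nn_integral_cong) (simp add: nn_integral_return)
  also have "\<dots> = emeasure V B" by simp
  finally show "emeasure (convolution V (return borel 0)) B = emeasure V B" .
qed simp

abbreviation both_exceed :: "real \<Rightarrow> real \<Rightarrow> (real \<times> real) set" where
  "both_exceed h x \<equiv> {p. h < fst p \<and> h < snd p \<and> x < fst p + snd p}"

lemma both_exceed_sets [measurable]: "both_exceed h x \<in> sets (borel \<Otimes>\<^sub>M borel)"
proof -
  have "{p \<in> space (borel \<Otimes>\<^sub>M borel). h < fst p \<and> h < snd p \<and> x < fst p + snd p} \<in> sets (borel \<Otimes>\<^sub>M borel)"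
    by measurable
  then show ?thesis by (simp add: space_pair_measure)
qed

text \<open>All sections of the region, in either direction, are half-lines or empty, so the tail
  bounds apply after Fubini, first in one coordinate and then in the other. This carries estimates
  for the product of V with itself over to any independent pair with dominated tails.\<close>

lemma both_exceed_comparison:
  fixes \<mu> \<nu> \<mu>' \<nu>' :: "real measure"
  assumes "prob_space \<mu>" "prob_space \<nu>" "prob_space \<mu>'" "prob_space \<nu>'"
    and [measurable_cong]: "sets \<mu> = sets borel" "sets \<nu> = sets borel" "sets \<mu>' = sets borel" "sets \<nu>' = sets borel"
    and C: "0 \<le> C" "0 \<le> D"
    and \<mu>: "\<And>y. measure \<mu> {y<..} \<le> C * measure \<mu>' {y<..}"
    and \<nu>: "\<And>y. measure \<nu> {y<..} \<le> D * measure \<nu>' {y<..}"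
  shows "measure (\<mu> \<Otimes>\<^sub>M \<nu>) (both_exceed h x) \<le> C * D * measure (\<mu>' \<Otimes>\<^sub>M \<nu>') (both_exceed h x)"
proof -
  interpret \<mu>: prob_space \<mu> by fact
  interpret \<nu>: prob_space \<nu> by fact
  interpret \<mu>': prob_space \<mu>' by fact
  interpret \<nu>': prob_space \<nu>' by fact
  interpret P: pair_prob_space \<mu> \<nu> ..
  interpret Q: pair_prob_space \<mu> \<nu>' ..
  interpret R: pair_prob_space \<mu>' \<nu>' ..
  let ?E = "both_exceed h x"
  have \<mu>e: "emeasure \<mu> {y<..} \<le> ennreal C * emeasure \<mu>' {y<..}" for y
    using \<mu>[of y] C by (simp add: \<mu>.emeasure_eq_measure \<mu>'.emeasure_eq_measure ennreal_mult''[symmetric] ennreal_leI)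
  have \<nu>e: "emeasure \<nu> {y<..} \<le> ennreal D * emeasure \<nu>' {y<..}" for y
    using \<nu>[of y] C by (simp add: \<nu>.emeasure_eq_measure \<nu>'.emeasure_eq_measure ennreal_mult''[symmetric] ennreal_leI)
  have sec1: "Pair u -` ?E = (if h < u then {max h (x - u)<..} else {})" for u by auto
  have sec2: "(\<lambda>u. (u, v)) -` ?E = (if h < v then {max h (x - v)<..} else {})" for v by auto
  have E1: "?E \<in> sets (\<mu> \<Otimes>\<^sub>M \<nu>)" "?E \<in> sets (\<mu> \<Otimes>\<^sub>M \<nu>')" "?E \<in> sets (\<mu>' \<Otimes>\<^sub>M \<nu>')"
    using both_exceed_sets[of h x] by (simp_all cong: sets_pair_measure_cong)
  have "emeasure (\<mu> \<Otimes>\<^sub>M \<nu>) ?E = (\<integral>\<^sup>+u. emeasure \<nu> (Pair u -` ?E) \<partial>\<mu>)"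
    using E1 by (simp add: \<nu>.emeasure_pair_measure_alt)
  also have "\<dots> \<le> (\<integral>\<^sup>+u. ennreal D * emeasure \<nu>' (Pair u -` ?E) \<partial>\<mu>)"
    by (intro nn_integral_mono) (simp only: sec1, simp add: \<nu>e)
  also have "\<dots> = ennreal D * (\<integral>\<^sup>+u. emeasure \<nu>' (Pair u -` ?E) \<partial>\<mu>)"
    using E1 by (intro nn_integral_cmult \<nu>'.measurable_emeasure_Pair) auto
  also have "\<dots> = ennreal D * emeasure (\<mu> \<Otimes>\<^sub>M \<nu>') ?E"
    using E1 by (simp add: \<nu>'.emeasure_pair_measure_alt)
  also have "emeasure (\<mu> \<Otimes>\<^sub>M \<nu>') ?E = (\<integral>\<^sup>+v. emeasure \<mu> ((\<lambda>u. (u, v)) -` ?E) \<partial>\<nu>')"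
    using E1 by (simp add: Q.emeasure_pair_measure_alt2)
  also have "\<dots> \<le> (\<integral>\<^sup>+v. ennreal C * emeasure \<mu>' ((\<lambda>u. (u, v)) -` ?E) \<partial>\<nu>')"
    by (intro nn_integral_mono) (simp only: sec2, simp add: \<mu>e)
  also have "\<dots> = ennreal C * (\<integral>\<^sup>+v. emeasure \<mu>' ((\<lambda>u. (u, v)) -` ?E) \<partial>\<nu>')"
    using E1 by (intro nn_integral_cmult R.measurable_emeasure_Pair2) auto
  also have "\<dots> = ennreal C * emeasure (\<mu>' \<Otimes>\<^sub>M \<nu>') ?E"
    using E1 by (simp add: R.emeasure_pair_measure_alt2)
  finally have "emeasure (\<mu> \<Otimes>\<^sub>M \<nu>) ?E \<le> ennreal D * (ennreal C * emeasure (\<mu>' \<Otimes>\<^sub>M \<nu>') ?E)"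
    by (simp add: mult_left_mono)
  then show ?thesis using C
    by (simp add: P.emeasure_eq_measure R.emeasure_eq_measure ennreal_mult''[symmetric] mult_ac)
qed

section \<open>Long tails and the single large summand\<close>

locale subexp_dist = prob_space V for V :: "real measure" +
  assumes sets_V [measurable_cong, simp]: "sets V = sets borel"
    and nonneg_V: "measure V {0..} = 1"
    and subexp_V: "subexponential V"
begin

abbreviation tbar :: "real \<Rightarrow> real" where "tbar x \<equiv> measure V {x<..}"

sublocale VV: pair_prob_space V V ..

lemma space_V [simp]: "space V = UNIV"
  using sets_eq_imp_space_eq[OF sets_V] by simp

lemma tbar_antimono: "x \<le> y \<Longrightarrow> tbar y \<le> tbar x"
  by (intro finite_measure_mono) auto

lemma tbar_neg: "x < 0 \<Longrightarrow> tbar x = 1"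
  using finite_measure_mono[of "{0..}" "{x<..}"] nonneg_V prob_le_1[of "{x<..}"] by (force simp: )

lemma measure_atLeast0_atMost:
  assumes "0 \<le> h" shows "measure V {0..h} = 1 - tbar h"
proof -
  have *: "{0..} = {0..h} \<union> {h<..}" using assms by auto
  have "measure V {0..} = measure V {0..h} + tbar h"
    unfolding * by (rule finite_measure_Union) auto
  then show ?thesis using nonneg_V by simp
qed

lemma measure_Times: "B \<in> sets borel \<Longrightarrow> C \<in> sets borel \<Longrightarrow>
    measure (V \<Otimes>\<^sub>M V) (B \<times> C) = measure V B * measure V C"
  by (simp add: measure_def emeasure_pair_measure_Times enn2real_mult)

abbreviation two_sum :: "real \<Rightarrow> (real \<times> real) set" where
  "two_sum x \<equiv> {p. x < fst p + snd p}"

lemma two_sum_sets [measurable]: "two_sum x \<in> sets (V \<Otimes>\<^sub>M V)"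
proof -
  have "{p \<in> space (V \<Otimes>\<^sub>M V). x < fst p + snd p} \<in> sets (V \<Otimes>\<^sub>M V)" by measurable
  then show ?thesis by (simp add: space_pair_measure)
qed

lemma both_exceed_sets_V [measurable]: "both_exceed h x \<in> sets (V \<Otimes>\<^sub>M V)"
  using both_exceed_sets[of h x] by (simp cong: sets_pair_measure_cong)

abbreviation both :: "real \<Rightarrow> real \<Rightarrow> real" where
  "both h x \<equiv> measure (V \<Otimes>\<^sub>M V) (both_exceed h x)"

lemma two_sum_asymp: "((\<lambda>x. measure (V \<Otimes>\<^sub>M V) (two_sum x) / tbar x) \<longlongrightarrow> 2) at_top"
proof -
  have "measure (conv_pow V 2) {x<..} = measure (V \<Otimes>\<^sub>M V) (two_sum x)" for x
  proof -
    have "conv_pow V 2 = convolution V V"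
      by (simp add: numeral_2_eq_2 convolution_return_0 prob_space_axioms)
    also have "measure \<dots> {x<..} = measure (V \<Otimes>\<^sub>M V) (two_sum x)"
      unfolding convolution_def
      by (subst measure_distr) (auto simp: space_pair_measure split_beta intro!: arg_cong[where f="measure _"])
    finally show ?thesis .
  qed
  moreover have "((\<lambda>x. measure (conv_pow V 2) {x<..} / tbar x) \<longlongrightarrow> real 2) at_top"
    using subexp_V unfolding subexponential_def by blast
  ultimately show ?thesis by simp
qed

lemma tbar_pos: "0 < tbar x"
proof -
  have "\<forall>\<^sub>F y in at_top. 1 < measure (V \<Otimes>\<^sub>M V) (two_sum y) / tbar y"
    using order_tendstoD(1)[OF two_sum_asymp, of 1] by simp
  then have "\<forall>\<^sub>F y in at_top. 1 < measure (V \<Otimes>\<^sub>M V) (two_sum y) / tbar y \<and> x \<le> y"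
    using eventually_ge_at_top[of x] by (rule eventually_conj)
  then obtain y where y: "1 < measure (V \<Otimes>\<^sub>M V) (two_sum y) / tbar y" "x \<le> y"
    using eventually_happens[of _ "at_top::real filter"] by auto
  \<comment> \<open>Division by zero gives 0, so a quotient above 1 rules out a vanishing
    tail.\<close>
  then have "tbar y \<noteq> 0" by auto
  then have "0 < tbar y" using measure_nonneg[of V "{y<..}"] by linarith
  then show ?thesis using tbar_antimono[OF y(2)] by simp
qed

lemma tbar_tendsto_0: "(tbar \<longlongrightarrow> 0) at_top"
proof -
  interpret real_distribution V by unfold_locales simp
  have "(\<lambda>x. 1 - cdf V x) = tbar"
  proof
    fix x
    have "prob (space V - {..x}) = 1 - prob {..x}" by (intro prob_compl) simp
    moreover have "space V - {..x} = {x<..}" by auto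
    ultimately show "1 - cdf V x = tbar x" by (simp add: cdf_def)
  qed
  moreover have "((\<lambda>x. 1 - cdf V x) \<longlongrightarrow> 1 - 1) at_top"
    by (intro tendsto_intros cdf_lim_at_top_prob)
  ultimately show ?thesis by simp
qed

lemma two_sum_le: "0 < e \<Longrightarrow> \<forall>\<^sub>F x in at_top. measure (V \<Otimes>\<^sub>M V) (two_sum x) \<le> (2 + e) * tbar x"
  using order_tendstoD(2)[OF two_sum_asymp, of "2 + e"] tbar_pos
  by (auto elim!: eventually_mono simp: divide_less_eq intro: less_imp_le)

text \<open>Three disjoint rectangles inside \<open>two_sum x\<close> have total mass tbar x (2 -
  tbar h) + tbar (x - h) (tbar h - tbar x). Subexponentiality caps this near 2 tbar x, which leaves
  about tbar h tbar x for the last product; dividing by tbar h gives the claim.\<close>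

lemma long_tailed:
  assumes "0 \<le> h" "0 < e"
  shows "\<forall>\<^sub>F x in at_top. tbar (x - h) \<le> (1 + e) * tbar x"
proof -
  \<comment> \<open>Chosen so that (1 + q) / (1 - q) = 1 + e. For large x, \<open>q * tbar h\<close>
    bounds both tbar x and the excess of the ratio over 2.\<close>
  define q where "q = e / (2 + e)"
  have q: "0 < q" "q < 1" "1 + q = (1 + e) * (1 - q)" using assms by (auto simp: q_def field_simps)
  have "0 < q * tbar h" using q tbar_pos by simp
  then have "\<forall>\<^sub>F x in at_top. tbar x < q * tbar h"
    using order_tendstoD(2)[OF tbar_tendsto_0] by blast
  moreover have "\<forall>\<^sub>F x in at_top. measure (V \<Otimes>\<^sub>M V) (two_sum x) \<le> (2 + q * tbar h) * tbar x"
    using two_sum_le \<open>0 < q * tbar h\<close> by blast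
  moreover have "\<forall>\<^sub>F x in at_top. h \<le> x" by (rule eventually_ge_at_top)
  ultimately show ?thesis
  proof eventually_elim
    case (elim x)
    let ?A = "{0..} \<times> {x<..}" and ?B = "{x<..} \<times> {0..h}" and ?C = "{x - h<..} \<times> {h<..x}"
    have hx: "{h<..} = {h<..x} \<union> {x<..}" using elim by auto
    have "tbar h = measure V {h<..x} + tbar x"
      unfolding hx by (rule finite_measure_Union) auto
    then have C: "measure V {h<..x} = tbar h - tbar x" by simp
    have "measure (V \<Otimes>\<^sub>M V) ?A + measure (V \<Otimes>\<^sub>M V) ?B + measure (V \<Otimes>\<^sub>M V) ?C
        = measure (V \<Otimes>\<^sub>M V) ((?A \<union> ?B) \<union> ?C)"
      using elim by (subst VV.finite_measure_Union, auto)+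
    also have "\<dots> \<le> measure (V \<Otimes>\<^sub>M V) (two_sum x)"
      using assms by (intro VV.finite_measure_mono two_sum_sets) auto
    also have "\<dots> \<le> (2 + q * tbar h) * tbar x" by (rule elim)
    finally have "tbar x + tbar x * (1 - tbar h) + tbar (x - h) * (tbar h - tbar x) \<le> (2 + q * tbar h) * tbar x"
      using assms by (simp add: measure_Times nonneg_V measure_atLeast0_atMost C)
    then have 1: "tbar (x - h) * (tbar h - tbar x) \<le> (1 + q) * tbar h * tbar x" by (simp add: algebra_simps)
    have "tbar (x - h) * ((1 - q) * tbar h) \<le> tbar (x - h) * (tbar h - tbar x)"
      using elim by (intro mult_left_mono) (auto simp: algebra_simps)
    also note 1
    also have "(1 + q) * tbar h * tbar x = ((1 + e) * tbar x) * ((1 - q) * tbar h)" using q by (simp add: mult_ac)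
    finally show ?case using q tbar_pos[of h] by (simp add: mult_le_cancel_right)
  qed
qed

text \<open>The two strips where one coordinate stays in [0, h] already take 2 (1 - tbar h) tbar x
  of the asymptotic total 2 tbar x, so only 2 tbar h + e is left for the region where both
  coordinates exceed h.\<close>

lemma both_exceed_small:
  assumes "0 \<le> h" "0 < e"
  shows "\<forall>\<^sub>F x in at_top. both h x \<le> (2 * tbar h + e) * tbar x"
proof -
  have "\<forall>\<^sub>F x in at_top. h \<le> x" by (rule eventually_ge_at_top)
  with two_sum_le[OF assms(2)] show ?thesis
  proof eventually_elim
    case (elim x)
    let ?A = "{0..h} \<times> {x<..}" and ?B = "{x<..} \<times> {0..h}" and ?C = "both_exceed h x"
    have "measure (V \<Otimes>\<^sub>M V) ?A + measure (V \<Otimes>\<^sub>M V) ?B + measure (V \<Otimes>\<^sub>M V) ?C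
        = measure (V \<Otimes>\<^sub>M V) ((?A \<union> ?B) \<union> ?C)"
      using elim by (subst VV.finite_measure_Union, auto)+
    also have "\<dots> \<le> measure (V \<Otimes>\<^sub>M V) (two_sum x)"
      using assms by (intro VV.finite_measure_mono two_sum_sets) auto
    also have "\<dots> \<le> (2 + e) * tbar x" by (rule elim)
    finally have "2 * (tbar x * (1 - tbar h)) + measure (V \<Otimes>\<^sub>M V) ?C \<le> (2 + e) * tbar x"
      using assms by (simp add: measure_Times measure_atLeast0_atMost)
    then show ?case by (simp add: algebra_simps)
  qed
qed

text \<open>If the sum exceeds x and one summand is at most h, the other exceeds x - h; otherwise
  both exceed h. The last event is compared with two independent copies from V, at the price of the
  domination constants.\<close>

lemma indep_sum_tail_le:
  assumes "prob_space M" and indep: "prob_space.indep_var M borel Z borel S"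
    and C: "0 \<le> C" "0 \<le> D"
    and S: "\<And>y. \<P>(\<omega> in M. y < S \<omega>) \<le> C * tbar y"
    and Z: "\<And>y. \<P>(\<omega> in M. y < Z \<omega>) \<le> D * tbar y"
  shows "\<P>(\<omega> in M. x < Z \<omega> + S \<omega>) \<le>
    \<P>(\<omega> in M. x - h < S \<omega>) + \<P>(\<omega> in M. x - h < Z \<omega>)
    + C * D * both h x"
proof -
  interpret M: prob_space M by fact
  have [measurable]: "S \<in> borel_measurable M" "Z \<in> borel_measurable M"
    and joint: "distr M borel Z \<Otimes>\<^sub>M distr M borel S = distr M (borel \<Otimes>\<^sub>M borel) (\<lambda>\<omega>. (Z \<omega>, S \<omega>))"
    using indep unfolding M.indep_var_distribution_eq by auto
  have pS: "measure (distr M borel S) {y<..} = \<P>(\<omega> in M. y < S \<omega>)" for y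
    by (subst measure_distr) (auto intro!: arg_cong[where f="measure M"])
  have pZ: "measure (distr M borel Z) {y<..} = \<P>(\<omega> in M. y < Z \<omega>)" for y
    by (subst measure_distr) (auto intro!: arg_cong[where f="measure M"])
  have "\<P>(\<omega> in M. h < S \<omega> \<and> h < Z \<omega> \<and> x < S \<omega> + Z \<omega>)
      = measure (distr M (borel \<Otimes>\<^sub>M borel) (\<lambda>\<omega>. (Z \<omega>, S \<omega>))) (both_exceed h x)"
    by (subst measure_distr) (auto intro!: arg_cong[where f="measure M"] both_exceed_sets)
  also have "\<dots> = measure (distr M borel Z \<Otimes>\<^sub>M distr M borel S) (both_exceed h x)"
    by (simp add: joint)
  also have "\<dots> \<le> D * C * both h x"
    using C S Z by (intro both_exceed_comparison)
      (auto simp: M.prob_space_distr pS pZ prob_space_axioms)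
  finally have both: "\<P>(\<omega> in M. h < S \<omega> \<and> h < Z \<omega> \<and> x < S \<omega> + Z \<omega>)
      \<le> C * D * both h x" by (simp add: mult.commute)
  have "\<P>(\<omega> in M. x < Z \<omega> + S \<omega>) \<le> measure M (({\<omega>\<in>space M. x - h < S \<omega>}
      \<union> {\<omega>\<in>space M. x - h < Z \<omega>}) \<union> {\<omega>\<in>space M. h < S \<omega> \<and> h < Z \<omega> \<and> x < S \<omega> + Z \<omega>})"
    by (intro M.finite_measure_mono) auto
  also have "\<dots> \<le> measure M ({\<omega>\<in>space M. x - h < S \<omega>} \<union> {\<omega>\<in>space M. x - h < Z \<omega>})
      + \<P>(\<omega> in M. h < S \<omega> \<and> h < Z \<omega> \<and> x < S \<omega> + Z \<omega>)"
    by (intro measure_Un_le) measurable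
  also have "measure M ({\<omega>\<in>space M. x - h < S \<omega>} \<union> {\<omega>\<in>space M. x - h < Z \<omega>})
      \<le> \<P>(\<omega> in M. x - h < S \<omega>) + \<P>(\<omega> in M. x - h < Z \<omega>)"
    by (intro measure_Un_le) measurable
  finally show ?thesis using both by linarith
qed

section \<open>Kesten's bound and weighted sums of dominated variables\<close>

lemma small_level:
  assumes "0 < e"
  obtains h where "0 \<le> h" "tbar h \<le> e"
proof -
  have "\<forall>\<^sub>F x in at_top. tbar x < e \<and> 0 \<le> x"
    using order_tendstoD(2)[OF tbar_tendsto_0 assms] eventually_ge_at_top[of 0]
    by (rule eventually_conj)
  then obtain h where "tbar h < e \<and> 0 \<le> h"
    using eventually_happens[of _ "at_top::real filter"] by auto
  then show thesis using that by auto
qed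

lemma empty_sum_tail:
  assumes "prob_space M"
  shows "\<P>(\<omega> in M. x < 0) \<le> tbar x"
proof -
  interpret M: prob_space M by fact
  show ?thesis using tbar_neg by (cases "x < 0") (auto simp: M.prob_space)
qed

text \<open>Kesten's inequality, by induction on the number of summands: one more summand multiplies
  the constant by (1 + \<rho>) / 2 and adds a fixed Q, and the gap (\<rho> - 1) / 2 absorbs Q. The
  summands may have different laws, and K is fixed before the family is.\<close>

lemma Kesten_bound:
  assumes M: "prob_space M" and C: "1 \<le> C" and \<rho>: "1 < \<rho>"
  shows "\<exists>K\<ge>1. \<forall>B (Z :: 'i \<Rightarrow> 'w \<Rightarrow> real) x. finite B \<longrightarrow> prob_space.indep_vars M (\<lambda>_. borel) Z B \<longrightarrow>
     (\<forall>k\<in>B. \<forall>y. \<P>(\<omega> in M. y < Z k \<omega>) \<le> C * tbar y) \<longrightarrow>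
     \<P>(\<omega> in M. x < (\<Sum>k\<in>B. Z k \<omega>)) \<le> K * \<rho> ^ card B * tbar x"
proof -
  interpret M: prob_space M by fact
  \<comment> \<open>Makes the factor 1 + e + 3 C e of the induction step equal to (1 + \<rho>) / 2;
    here 3 e bounds 2 tbar h + e, as tbar h \<le> e.\<close>
  define e where "e = (\<rho> - 1) / 2 / (1 + 3 * C)"
  have e: "0 < e" using C \<rho> by (auto simp: e_def)
  have e_eq: "1 + e + C * (2 * e + e) = (1 + \<rho>) / 2"
  proof -
    have "1 + 3 * C \<noteq> 0" using C by simp
    then have "e * (1 + 3 * C) = (\<rho> - 1) / 2" by (metis e_def nonzero_eq_divide_eq)
    then show ?thesis by (simp add: algebra_simps)
  qed
  obtain h where h: "0 \<le> h" "tbar h \<le> e" using small_level[OF e] .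
  obtain x0 where x0: "\<And>x. x0 \<le> x \<Longrightarrow> tbar (x - h) \<le> (1 + e) * tbar x"
      "\<And>x. x0 \<le> x \<Longrightarrow> both h x \<le> (2 * tbar h + e) * tbar x"
    using eventually_conj[OF long_tailed[OF h(1) e] both_exceed_small[OF h(1) e]]
    unfolding eventually_at_top_linorder by blast
  \<comment> \<open>C (1 + e) is the contribution of the new summand; 1 / tbar x0 turns the trivial
    bound 1 into a multiple of tbar x for x below x0.\<close>
  define Q where "Q = C * (1 + e) + 1 / tbar x0"
  have Q: "0 < Q" using C e tbar_pos[of x0] by (auto simp: Q_def intro!: add_pos_pos)
  define K where "K = max 1 (2 * Q / (\<rho> - 1))"
  have K: "1 \<le> K" "Q \<le> K * ((\<rho> - 1) / 2)"
    using \<rho> by (auto simp: K_def max_def field_simps)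
  have "\<P>(\<omega> in M. x < (\<Sum>k\<in>B. Z k \<omega>)) \<le> K * \<rho> ^ card B * tbar x"
    if "finite B" "M.indep_vars (\<lambda>_. borel) Z B"
      "\<And>k y. k \<in> B \<Longrightarrow> \<P>(\<omega> in M. y < Z k \<omega>) \<le> C * tbar y" for B and Z :: "'i \<Rightarrow> 'w \<Rightarrow> real" and x
    using that
  proof (induction B arbitrary: x rule: finite_induct)
    case empty
    have "\<P>(\<omega> in M. x < 0) \<le> 1 * tbar x" using empty_sum_tail[OF M] by simp
    also have "\<dots> \<le> K * tbar x" using K by (intro mult_right_mono) auto
    finally show ?case by simp
  next
    case (insert k B)
    let ?a = "K * \<rho> ^ card B"
    have \<rho>1: "1 \<le> \<rho> ^ card B" using \<rho> by (simp add: one_le_power)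
    have a: "0 \<le> ?a" "Q \<le> ?a * ((\<rho> - 1) / 2)"
    proof -
      show "0 \<le> ?a" using K \<rho>1 by simp
      have "K * ((\<rho> - 1) / 2) \<le> ?a * ((\<rho> - 1) / 2)"
        using \<rho> K \<rho>1 by (intro mult_right_mono) (auto intro: mult_right_mono[of 1 "\<rho> ^ card B" K, simplified])
      then show "Q \<le> ?a * ((\<rho> - 1) / 2)" using K by linarith
    qed
    have IH: "\<P>(\<omega> in M. y < (\<Sum>k\<in>B. Z k \<omega>)) \<le> ?a * tbar y" for y
      using insert by (intro insert.IH M.indep_vars_subset[OF insert.prems(1)]) auto
    have "\<P>(\<omega> in M. x < (\<Sum>k\<in>insert k B. Z k \<omega>)) \<le> (((1 + \<rho>) / 2) * ?a + Q) * tbar x"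
    proof (cases "x0 \<le> x")
      case True
      have "\<P>(\<omega> in M. x < (\<Sum>k\<in>insert k B. Z k \<omega>))
          \<le> \<P>(\<omega> in M. x - h < (\<Sum>k\<in>B. Z k \<omega>)) + \<P>(\<omega> in M. x - h < Z k \<omega>)
            + ?a * C * both h x"
        unfolding sum.insert[OF insert.hyps]
        using insert.prems(2) a C IH M.indep_vars_sum[OF insert.hyps insert.prems(1)]
        by (intro indep_sum_tail_le M) auto
      also have "\<dots> \<le> ?a * tbar (x - h) + C * tbar (x - h) + ?a * C * ((2 * tbar h + e) * tbar x)"
        using a C IH insert.prems x0(2)[OF True] by (intro add_mono mult_left_mono) auto
      also have "\<dots> \<le> ?a * ((1 + e) * tbar x) + C * ((1 + e) * tbar x) + ?a * C * ((2 * e + e) * tbar x)"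
        using a C h x0(1)[OF True] by (intro add_mono mult_left_mono mult_right_mono) auto
      also have "\<dots> = (?a * (1 + e + C * (2 * e + e)) + C * (1 + e)) * tbar x" by (simp add: algebra_simps)
      also have "\<dots> \<le> (((1 + \<rho>) / 2) * ?a + Q) * tbar x"
        unfolding e_eq using tbar_pos[of x0] by (intro mult_right_mono) (auto simp: Q_def mult.commute)
      finally show ?thesis .
    next
      case False
      have "\<P>(\<omega> in M. x < (\<Sum>k\<in>insert k B. Z k \<omega>)) \<le> 1" by simp
      also have "1 \<le> (1 / tbar x0) * tbar x"
        using False tbar_antimono[of x x0] tbar_pos[of x0] by (simp add: field_simps)
      also have "\<dots> \<le> (((1 + \<rho>) / 2) * ?a + Q) * tbar x"
        using a \<rho> C e by (intro mult_right_mono) (auto simp: Q_def)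
      finally show ?thesis .
    qed
    also have "\<dots> \<le> (((1 + \<rho>) / 2) * ?a + ?a * ((\<rho> - 1) / 2)) * tbar x"
      using a by (intro mult_right_mono) auto
    also have "\<dots> = K * \<rho> ^ card (insert k B) * tbar x"
      using insert.hyps by (simp add: field_simps)
    finally show ?case .
  qed
  note main = this
  show ?thesis
  proof (intro exI[of _ K] conjI allI impI)
    show "1 \<le> K" by fact
    fix B and Z :: "'i \<Rightarrow> 'w \<Rightarrow> real" and x
    assume "finite B" "M.indep_vars (\<lambda>_. borel) Z B"
      "\<forall>k\<in>B. \<forall>y. \<P>(\<omega> in M. y < Z k \<omega>) \<le> C * tbar y"
    then show "\<P>(\<omega> in M. x < (\<Sum>k\<in>B. Z k \<omega>)) \<le> K * \<rho> ^ card B * tbar x"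
      by (intro main) simp_all
  qed
qed

lemma weighted_tail_le:
  fixes Z :: "'w \<Rightarrow> real"
  assumes M: "prob_space M" and C: "1 \<le> C" and [measurable]: "Z \<in> borel_measurable M"
    and Z: "\<And>y. \<P>(\<omega> in M. y < Z \<omega>) \<le> C * tbar y" and w: "0 < w" "w \<le> 1"
  shows "\<P>(\<omega> in M. y < w * Z \<omega>) \<le> C * tbar y"
proof (cases "y < 0")
  \<comment> \<open>For y < 0 dividing by w \<le> 1 lowers the level instead of raising it, but
    there \<open>tbar y\<close> is 1.\<close>
  case True
  interpret M: prob_space M by fact
  have "\<P>(\<omega> in M. y < w * Z \<omega>) \<le> 1" by simp
  then show ?thesis using True C tbar_neg by (auto intro: order_trans)
next
  case False
  have "\<P>(\<omega> in M. y < w * Z \<omega>) = \<P>(\<omega> in M. y / w < Z \<omega>)"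
    using w by (simp add: field_simps)
  also have "\<dots> \<le> C * tbar (y / w)" by (rule Z)
  also have "\<dots> \<le> C * tbar y" using False w C
    by (intro mult_left_mono tbar_antimono) (auto simp: pos_le_divide_eq mult_left_le)
  finally show ?thesis .
qed

text \<open>A shift of w Z by h is a shift of Z by h / w \<le> h / a: the lower bound a on the
  weights lets one x0 serve all of them.\<close>

lemma weighted_long_tailed:
  fixes Z :: "'i \<Rightarrow> 'w \<Rightarrow> real"
  assumes M: "prob_space M" and a: "0 < a"
    and Z: "\<And>k. k \<in> I \<Longrightarrow> Z k \<in> borel_measurable M"
    and lt: "\<And>h e. 0 \<le> h \<Longrightarrow> 0 < e \<Longrightarrow> \<exists>x0. \<forall>k\<in>I. \<forall>y\<ge>x0.
       \<P>(\<omega> in M. y - h < Z k \<omega>) \<le> \<P>(\<omega> in M. y < Z k \<omega>) + e * tbar y"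
    and h: "0 \<le> h" "0 < e"
  shows "\<exists>x0. \<forall>k\<in>I. \<forall>w. a \<le> w \<and> w \<le> 1 \<longrightarrow> (\<forall>x\<ge>x0.
       \<P>(\<omega> in M. x - h < w * Z k \<omega>) \<le> \<P>(\<omega> in M. x < w * Z k \<omega>) + e * tbar x)"
proof -
  interpret M: prob_space M by fact
  obtain x0 where x0: "\<And>k y. k \<in> I \<Longrightarrow> x0 \<le> y \<Longrightarrow>
       \<P>(\<omega> in M. y - h / a < Z k \<omega>) \<le> \<P>(\<omega> in M. y < Z k \<omega>) + e * tbar y"
    using lt[of "h / a" e] a h by auto
  have "\<P>(\<omega> in M. x - h < w * Z k \<omega>) \<le> \<P>(\<omega> in M. x < w * Z k \<omega>) + e * tbar x"
    if k: "k \<in> I" and w: "a \<le> w" "w \<le> 1" and x: "max 0 x0 \<le> x" for k w x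
  proof -
    note [measurable] = Z[OF k]
    have wpos: "0 < w" using a w by simp
    have xw: "x \<le> x / w" using w x wpos by (simp add: pos_le_divide_eq mult_left_le)
    have "h / w \<le> h / a" using a h w by (intro divide_left_mono) auto
    then have "\<P>(\<omega> in M. x - h < w * Z k \<omega>) \<le> \<P>(\<omega> in M. x / w - h / a < Z k \<omega>)"
    proof (intro M.finite_measure_mono subsetI; clarsimp)
      fix \<omega> assume *: "h / w \<le> h / a" "x - h < w * Z k \<omega>"
      have "x / w - h / w < Z k \<omega>" using * wpos by (simp add: diff_divide_distrib[symmetric] pos_divide_less_eq mult.commute)
      then show "x / w - h / a < Z k \<omega>" using * by linarith
    qed
    also have "\<dots> \<le> \<P>(\<omega> in M. x / w < Z k \<omega>) + e * tbar (x / w)"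
      using xw x k by (intro x0) auto
    also have "\<dots> \<le> \<P>(\<omega> in M. x / w < Z k \<omega>) + e * tbar x"
      using xw h by (intro add_left_mono mult_left_mono tbar_antimono) auto
    also have "\<P>(\<omega> in M. x / w < Z k \<omega>) = \<P>(\<omega> in M. x < w * Z k \<omega>)"
      using wpos by (simp add: field_simps)
    finally show ?thesis .
  qed
  note main = this
  show ?thesis
    by (intro exI[of _ "max 0 x0"] ballI allI impI main) auto
qed

text \<open>The threshold x0 is the same for all index sets of at most n elements and all weights in
  [a, 1]. The induction peels off one summand; since the number of the others is bounded, Kesten's
  bound with ratio 2 dominates their sum by a fixed multiple of the tail.\<close>

lemma uniform_weighted_sum_upper:
  fixes Z :: "'i \<Rightarrow> 'w \<Rightarrow> real"
  assumes M: "prob_space M" and C: "1 \<le> C" and a: "0 < a"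
    and indep: "prob_space.indep_vars M (\<lambda>_. borel) Z I"
    and Z: "\<And>k y. k \<in> I \<Longrightarrow> \<P>(\<omega> in M. y < Z k \<omega>) \<le> C * tbar y"
    and lt: "\<And>h e. 0 \<le> h \<Longrightarrow> 0 < e \<Longrightarrow> \<exists>x0. \<forall>k\<in>I. \<forall>y\<ge>x0.
       \<P>(\<omega> in M. y - h < Z k \<omega>) \<le> \<P>(\<omega> in M. y < Z k \<omega>) + e * tbar y"
    and e: "0 < e"
  shows "\<exists>x0. \<forall>x\<ge>x0. \<forall>B w. finite B \<longrightarrow> B \<subseteq> I \<longrightarrow> card B \<le> n \<longrightarrow> (\<forall>k\<in>B. a \<le> w k \<and> w k \<le> 1) \<longrightarrow>
     \<P>(\<omega> in M. x < (\<Sum>k\<in>B. w k * Z k \<omega>))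
       \<le> (\<Sum>k\<in>B. \<P>(\<omega> in M. x < w k * Z k \<omega>)) + e * tbar x"
  using e
proof (induction n arbitrary: e)
  interpret M: prob_space M by fact
  case 0
  show ?case using 0 by (intro exI[of _ 0]) (auto simp: card_eq_0_iff)
next
  interpret M: prob_space M by fact
  case (Suc n)
  have mZ: "k \<in> I \<Longrightarrow> Z k \<in> borel_measurable M" for k
    using indep unfolding M.indep_vars_def by auto
  obtain K where K: "1 \<le> K" "\<And>B (Z :: 'i \<Rightarrow> 'w \<Rightarrow> real) x. finite B \<Longrightarrow> M.indep_vars (\<lambda>_. borel) Z B \<Longrightarrow>
     (\<And>k y. k \<in> B \<Longrightarrow> \<P>(\<omega> in M. y < Z k \<omega>) \<le> C * tbar y) \<Longrightarrow>
     \<P>(\<omega> in M. x < (\<Sum>k\<in>B. Z k \<omega>)) \<le> K * 2 ^ card B * tbar x"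
    using Kesten_bound[OF M C, of 2] by fastforce
  define D where "D = K * 2 ^ n"
  have D: "0 < D" using K by (simp add: D_def)
  \<comment> \<open>Collects n d from the shifts of the remaining summands, 2 d from the induction
    hypothesis at x - h, d from the shift of the peeled summand and 3 D C d from the event that both
    parts are large, with room to spare.\<close>
  define d where "d = e / (5 + n + 3 * D * C)"
  have den: "0 < 5 + n + 3 * D * C" using C D by (simp add: add_pos_pos)
  have d: "0 < d" "d * (5 + n + 3 * D * C) = e" using Suc.prems den by (auto simp: d_def)
  obtain h where h: "0 \<le> h" "tbar h \<le> d" using small_level[OF d(1)] .
  obtain x1 where x1: "\<And>x. x1 \<le> x \<Longrightarrow> tbar (x - h) \<le> (1 + 1) * tbar x"
      "\<And>x. x1 \<le> x \<Longrightarrow> both h x \<le> (2 * tbar h + d) * tbar x"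
    using eventually_conj[OF long_tailed[OF h(1), of 1] both_exceed_small[OF h(1) d(1)]]
    unfolding eventually_at_top_linorder by auto
  obtain x2 where x2: "\<forall>k\<in>I. \<forall>w. a \<le> w \<and> w \<le> 1 \<longrightarrow> (\<forall>x\<ge>x2.
       \<P>(\<omega> in M. x - h < w * Z k \<omega>) \<le> \<P>(\<omega> in M. x < w * Z k \<omega>) + d * tbar x)"
    using weighted_long_tailed[OF M a mZ lt h(1) d(1)] by (rule exE)
  obtain x3 where x3: "\<forall>x\<ge>x3. \<forall>B w. finite B \<longrightarrow> B \<subseteq> I \<longrightarrow> card B \<le> n \<longrightarrow> (\<forall>k\<in>B. a \<le> w k \<and> w k \<le> 1) \<longrightarrow>
     \<P>(\<omega> in M. x < (\<Sum>k\<in>B. w k * Z k \<omega>))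
       \<le> (\<Sum>k\<in>B. \<P>(\<omega> in M. x < w k * Z k \<omega>)) + d * tbar x"
    using Suc.IH[OF d(1)] by (rule exE)
  \<comment> \<open>0 settles the empty sum; x3 + h admits the induction hypothesis at x -
    h.\<close>
  define x0 where "x0 = Max {0, x1, x2, x3 + h}"
  have "\<P>(\<omega> in M. x < (\<Sum>k\<in>B. w k * Z k \<omega>))
       \<le> (\<Sum>k\<in>B. \<P>(\<omega> in M. x < w k * Z k \<omega>)) + e * tbar x"
    if x: "x0 \<le> x" and B: "finite B" "B \<subseteq> I" "card B \<le> Suc n" and w: "\<forall>k\<in>B. a \<le> w k \<and> w k \<le> 1" for x B w
  proof (cases "B = {}")
    case True
    then show ?thesis using x Suc.prems by (auto simp: x0_def)
  next
    case False
    then obtain k B' where kB: "B = insert k B'" "k \<notin> B'" by (metis ex_in_conv mk_disjoint_insert)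
    have B': "finite B'" "B' \<subseteq> I" "card B' \<le> n" "\<forall>k\<in>B'. a \<le> w k \<and> w k \<le> 1" and k: "k \<in> I" "a \<le> w k" "w k \<le> 1"
      using kB B w by auto
    have x': "0 \<le> x" "x1 \<le> x" "x2 \<le> x" "x3 \<le> x - h" using x by (auto simp: x0_def)
    have ind: "M.indep_vars (\<lambda>_. borel) (\<lambda>k \<omega>. w k * Z k \<omega>) B"
      using B by (intro M.indep_vars_compose2[where Y="\<lambda>k z. w k * z", OF M.indep_vars_subset[OF indep]]) auto
    have tl_B: "\<P>(\<omega> in M. y < w k * Z k \<omega>) \<le> C * tbar y" if "k \<in> B" for k y
      using that B w a by (intro weighted_tail_le M C mZ Z) force+
    have sB: "\<P>(\<omega> in M. y < (\<Sum>k\<in>B'. w k * Z k \<omega>)) \<le> D * tbar y" for y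
    proof -
      have "\<P>(\<omega> in M. y < (\<Sum>k\<in>B'. w k * Z k \<omega>)) \<le> K * 2 ^ card B' * tbar y"
        using B' kB by (intro K(2) M.indep_vars_subset[OF ind] tl_B) auto
      also have "\<dots> \<le> D * tbar y" unfolding D_def
        using B' K by (intro mult_right_mono mult_left_mono power_increasing) auto
      finally show ?thesis .
    qed
    have "\<P>(\<omega> in M. x < (\<Sum>k\<in>B. w k * Z k \<omega>))
       = \<P>(\<omega> in M. x < w k * Z k \<omega> + (\<Sum>k\<in>B'. w k * Z k \<omega>))"
      using kB B' by simp
    also have "\<dots> \<le> \<P>(\<omega> in M. x - h < (\<Sum>k\<in>B'. w k * Z k \<omega>)) + \<P>(\<omega> in M. x - h < w k * Z k \<omega>)
            + D * C * both h x"
      using D C sB tl_B kB B' M.indep_vars_sum[OF B'(1) kB(2) ind[unfolded kB]]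
      by (intro indep_sum_tail_le M) auto
    also have "\<P>(\<omega> in M. x - h < (\<Sum>k\<in>B'. w k * Z k \<omega>))
       \<le> (\<Sum>k\<in>B'. \<P>(\<omega> in M. x - h < w k * Z k \<omega>)) + d * tbar (x - h)"
      using x' B' by (intro x3[rule_format]) auto
    also have "d * tbar (x - h) \<le> d * (2 * tbar x)"
      using x' x1(1)[of x] d by (intro mult_left_mono) auto
    also have "(\<Sum>k\<in>B'. \<P>(\<omega> in M. x - h < w k * Z k \<omega>))
        \<le> (\<Sum>k\<in>B'. \<P>(\<omega> in M. x < w k * Z k \<omega>) + d * tbar x)"
      using x' B' by (intro sum_mono x2[rule_format]) auto
    also have "\<dots> = (\<Sum>k\<in>B'. \<P>(\<omega> in M. x < w k * Z k \<omega>)) + card B' * (d * tbar x)"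
      by (simp add: sum.distrib)
    also have "card B' * (d * tbar x) \<le> n * (d * tbar x)"
      using B' d by (intro mult_right_mono) auto
    also have "\<P>(\<omega> in M. x - h < w k * Z k \<omega>) \<le> \<P>(\<omega> in M. x < w k * Z k \<omega>) + d * tbar x"
      using x' k by (intro x2[rule_format]) auto
    also have "both h x \<le> (2 * d + d) * tbar x"
      using x1(2)[of x] x' h mult_right_mono[of "2 * tbar h + d" "2 * d + d" "tbar x"] by force
    finally have "\<P>(\<omega> in M. x < (\<Sum>k\<in>B. w k * Z k \<omega>))
      \<le> (\<Sum>k\<in>B'. \<P>(\<omega> in M. x < w k * Z k \<omega>)) + n * (d * tbar x) + d * (2 * tbar x)
        + (\<P>(\<omega> in M. x < w k * Z k \<omega>) + d * tbar x) + D * C * ((2 * d + d) * tbar x)"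
      using D C by (simp add: mult_left_mono)
    also have "\<dots> = (\<Sum>k\<in>B. \<P>(\<omega> in M. x < w k * Z k \<omega>)) + d * (3 + n + 3 * D * C) * tbar x"
      using kB B' by (simp add: algebra_simps)
    also have "\<dots> \<le> (\<Sum>k\<in>B. \<P>(\<omega> in M. x < w k * Z k \<omega>)) + e * tbar x"
      unfolding d(2)[symmetric] using d(1) by (intro add_left_mono mult_right_mono mult_left_mono) auto
    finally show ?thesis .
  qed
  note main = this
  show ?case
    by (intro exI[of _ x0] allI impI main) auto
qed

text \<open>Bonferroni's inequality: the sum of the tails exceeds the probability of the union by at
  most the pairwise intersections, each at most q^2 by independence, and there are no more pairs
  than the squared cardinality.\<close>

lemma weighted_max_lower:
  fixes Z :: "'i \<Rightarrow> 'w \<Rightarrow> real"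
  assumes M: "prob_space M"
    and indep: "prob_space.indep_vars M (\<lambda>_. borel) Z B" and B: "finite B"
    and Z: "\<And>k. k \<in> B \<Longrightarrow> \<P>(\<omega> in M. x < Z k \<omega>) \<le> q"
  shows "(\<Sum>k\<in>B. \<P>(\<omega> in M. x < Z k \<omega>))
    \<le> \<P>(\<omega> in M. \<exists>k\<in>B. x < Z k \<omega>) + (real (card B))\<^sup>2 * q\<^sup>2"
proof -
  interpret M: prob_space M by fact
  show ?thesis using B indep Z
  proof (induction B rule: finite_induct)
    case empty
    then show ?case by simp
  next
    case (insert k B)
    let ?E = "\<lambda>k. {\<omega>\<in>space M. x < Z k \<omega>}"
    let ?U = "{\<omega>\<in>space M. \<exists>k\<in>B. x < Z k \<omega>}"
    have m [measurable]: "j \<in> insert k B \<Longrightarrow> Z j \<in> borel_measurable M" for j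
      using insert.prems(1) unfolding M.indep_vars_def by auto
    have sE: "j \<in> insert k B \<Longrightarrow> ?E j \<in> sets M" for j
      using m[of j] by measurable
    have U: "?U = (\<Union>j\<in>B. ?E j)" by auto
    have sU: "?U \<in> sets M" unfolding U using sE insert.hyps by (intro sets.finite_UN) auto
    have q: "0 \<le> q" by (rule order_trans[OF measure_nonneg insert.prems(2)[of k]]) simp
    have IH: "(\<Sum>k\<in>B. measure M (?E k)) \<le> measure M ?U + (real (card B))\<^sup>2 * q\<^sup>2"
      using insert by (intro insert.IH M.indep_vars_subset[OF insert.prems(1)]) auto
    have pair: "measure M (?E k \<inter> ?E j) \<le> q\<^sup>2" if j: "j \<in> B" for j
    proof -
      have kj: "k \<noteq> j" using j insert.hyps by auto
      have "measure M (\<Inter>i\<in>{k,j}. Z i -` {x<..} \<inter> space M) = (\<Prod>i\<in>{k,j}. measure M (Z i -` {x<..} \<inter> space M))"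
        using j by (intro M.indep_varsD[OF insert.prems(1)]) auto
      also have "(\<Inter>i\<in>{k,j}. Z i -` {x<..} \<inter> space M) = ?E k \<inter> ?E j" by auto
      also have "(\<Prod>i\<in>{k,j}. measure M (Z i -` {x<..} \<inter> space M)) = measure M (?E k) * measure M (?E j)"
        using kj by (simp add: vimage_def Int_def conj_commute)
      also have "\<dots> \<le> q * q" using insert.prems(2) j q by (intro mult_mono) auto
      finally show ?thesis by (simp add: power2_eq_square)
    qed
    have "measure M (?E k \<inter> ?U) \<le> measure M (\<Union>j\<in>B. ?E k \<inter> ?E j)"
      using sE insert.hyps by (intro M.finite_measure_mono sets.finite_UN) auto
    also have "\<dots> \<le> (\<Sum>j\<in>B. measure M (?E k \<inter> ?E j))"
      using sE insert.hyps by (intro M.finite_measure_subadditive_finite) auto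
    also have "\<dots> \<le> (\<Sum>j\<in>B. q\<^sup>2)" by (intro sum_mono pair)
    finally have inter: "measure M (?E k \<inter> ?U) \<le> card B * q\<^sup>2" by simp
    have "measure M (?E k \<union> ?U) = measure M (?E k) + measure M ?U - measure M (?E k \<inter> ?U)"
      using sE[of k] sU by (subst measure_Un3) (auto simp: fmeasurable_def M.emeasure_eq_measure)
    moreover have "?E k \<union> ?U = {\<omega>\<in>space M. \<exists>k\<in>insert k B. x < Z k \<omega>}" by auto
    ultimately have "measure M (?E k) + measure M ?U \<le> \<P>(\<omega> in M. \<exists>k\<in>insert k B. x < Z k \<omega>) + card B * q\<^sup>2"
      using inter by simp
    moreover have "(real (card B))\<^sup>2 * q\<^sup>2 + card B * q\<^sup>2 \<le> (real (card (insert k B)))\<^sup>2 * q\<^sup>2"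
    proof -
      have "(real (card B))\<^sup>2 + card B \<le> (real (card (insert k B)))\<^sup>2"
        using insert.hyps by (simp add: power2_eq_square algebra_simps)
      from mult_right_mono[OF this, of "q\<^sup>2"] show ?thesis by (simp add: distrib_right)
    qed
    ultimately show ?case using IH insert.hyps by simp
  qed
qed

text \<open>Frees the number n of summands. Up to a fixed L the uniform bound applies; beyond L even
  Kesten's bound for the whole sum, with ratio exp (s / 2), is below e exp (s n) tbar x.\<close>

lemma weighted_sum_upper:
  fixes Z :: "'i \<Rightarrow> 'w \<Rightarrow> real" and e s :: real
  assumes M: "prob_space M" and C: "1 \<le> C" and a: "0 < a"
    and indep: "prob_space.indep_vars M (\<lambda>_. borel) Z I"
    and Z: "\<And>k y. k \<in> I \<Longrightarrow> \<P>(\<omega> in M. y < Z k \<omega>) \<le> C * tbar y"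
    and lt: "\<And>h e. 0 \<le> h \<Longrightarrow> 0 < e \<Longrightarrow> \<exists>x0. \<forall>k\<in>I. \<forall>y\<ge>x0.
       \<P>(\<omega> in M. y - h < Z k \<omega>) \<le> \<P>(\<omega> in M. y < Z k \<omega>) + e * tbar y"
    and e: "0 < e" and s: "0 < s"
  shows "\<exists>x0. \<forall>x\<ge>x0. \<forall>B w. finite B \<longrightarrow> B \<subseteq> I \<longrightarrow> (\<forall>k\<in>B. a \<le> w k \<and> w k \<le> 1) \<longrightarrow>
     \<P>(\<omega> in M. x < (\<Sum>k\<in>B. w k * Z k \<omega>))
       \<le> (\<Sum>k\<in>B. \<P>(\<omega> in M. x < w k * Z k \<omega>)) + e * exp (s * card B) * tbar x"
proof -
  interpret M: prob_space M by fact
  have mZ: "k \<in> I \<Longrightarrow> Z k \<in> borel_measurable M" for k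
    using indep unfolding M.indep_vars_def by auto
  have "1 < exp (s / 2)" using s by simp
  from Kesten_bound[OF M C this] obtain K where K: "1 \<le> K"
    "\<forall>B (Z :: 'i \<Rightarrow> 'w \<Rightarrow> real) x. finite B \<longrightarrow> M.indep_vars (\<lambda>_. borel) Z B \<longrightarrow>
     (\<forall>k\<in>B. \<forall>y. \<P>(\<omega> in M. y < Z k \<omega>) \<le> C * tbar y) \<longrightarrow>
     \<P>(\<omega> in M. x < (\<Sum>k\<in>B. Z k \<omega>)) \<le> K * exp (s / 2) ^ card B * tbar x"
    by blast
  \<comment> \<open>Beyond L one has K \<le> e exp (s n / 2), which is the spare half of exp (s
    n).\<close>
  obtain L :: nat where L: "2 * ln (K / e) / s \<le> L" using real_arch_simple by blast
  obtain x0 where x0: "\<forall>x\<ge>x0. \<forall>B w. finite B \<longrightarrow> B \<subseteq> I \<longrightarrow> card B \<le> L \<longrightarrow> (\<forall>k\<in>B. a \<le> w k \<and> w k \<le> 1) \<longrightarrow>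
     \<P>(\<omega> in M. x < (\<Sum>k\<in>B. w k * Z k \<omega>))
       \<le> (\<Sum>k\<in>B. \<P>(\<omega> in M. x < w k * Z k \<omega>)) + e * tbar x"
    using uniform_weighted_sum_upper[OF M C a indep Z lt e, of L] by (rule exE)
  have "\<P>(\<omega> in M. x < (\<Sum>k\<in>B. w k * Z k \<omega>))
       \<le> (\<Sum>k\<in>B. \<P>(\<omega> in M. x < w k * Z k \<omega>)) + e * exp (s * card B) * tbar x"
    if x: "x0 \<le> x" and B: "finite B" "B \<subseteq> I" and w: "\<forall>k\<in>B. a \<le> w k \<and> w k \<le> 1" for x B w
  proof (cases "card B \<le> L")
    case True
    have "\<P>(\<omega> in M. x < (\<Sum>k\<in>B. w k * Z k \<omega>))
       \<le> (\<Sum>k\<in>B. \<P>(\<omega> in M. x < w k * Z k \<omega>)) + e * tbar x"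
      using x0 x B w True by blast
    also have "e * tbar x \<le> e * exp (s * card B) * tbar x"
      using e s by (intro mult_right_mono) auto
    finally show ?thesis by simp
  next
    case False
    have ind: "M.indep_vars (\<lambda>_. borel) (\<lambda>k \<omega>. w k * Z k \<omega>) B"
      using B by (intro M.indep_vars_compose2[where Y="\<lambda>k z. w k * z", OF M.indep_vars_subset[OF indep]]) auto
    have tl_B: "\<P>(\<omega> in M. y < w k * Z k \<omega>) \<le> C * tbar y" if "k \<in> B" for k y
      using that B w a by (intro weighted_tail_le M C mZ Z) force+
    have "\<P>(\<omega> in M. x < (\<Sum>k\<in>B. w k * Z k \<omega>)) \<le> K * exp (s / 2) ^ card B * tbar x"
      using K(2) B(1) ind tl_B by blast
    also have "K * exp (s / 2) ^ card B \<le> e * exp (s * card B)"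
    proof -
      have "2 * ln (K / e) / s \<le> card B" using False L by simp
      then have "ln (K / e) \<le> s / 2 * card B" using s by (simp add: field_simps)
      then have "exp (ln (K / e)) \<le> exp (s / 2 * card B)" by simp
      moreover have "exp (ln (K / e)) = K / e" using K(1) e by simp
      ultimately have "K / e \<le> exp (s / 2 * card B)" by simp
      then have "K * exp (s / 2 * card B) \<le> e * exp (s / 2 * card B) * exp (s / 2 * card B)"
        using e by (intro mult_right_mono) (auto simp: field_simps)
      also have "\<dots> = e * exp (s * card B)" by (simp add: exp_add[symmetric] mult.assoc)
      also have "exp (s / 2 * card B) = exp (s / 2) ^ card B" by (simp only: exp_of_nat2_mult)
      finally show ?thesis .
    qed
    finally have "\<P>(\<omega> in M. x < (\<Sum>k\<in>B. w k * Z k \<omega>)) \<le> e * exp (s * card B) * tbar x"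
      by (simp add: mult_right_mono)
    moreover have "0 \<le> (\<Sum>k\<in>B. \<P>(\<omega> in M. x < w k * Z k \<omega>))" by (intro sum_nonneg) simp
    ultimately show ?thesis by simp
  qed
  note main = this
  show ?thesis
    by (intro exI[of _ x0] allI impI main) auto
qed

end

section \<open>Conditioning on arrivals, offspring numbers and delays\<close>

text \<open>Conditioning on X is expressed by a second sample point: as the joint law is a product,
  Y may be evaluated at an independent \<omega>' while X stays at \<omega>.\<close>

lemma (in prob_space) indep_var_nn_Fubini:
  assumes indep: "indep_var S X T Y" and f: "f \<in> borel_measurable (S \<Otimes>\<^sub>M T)"
  shows "(\<integral>\<^sup>+\<omega>. f (X \<omega>, Y \<omega>) \<partial>M) = (\<integral>\<^sup>+\<omega>. \<integral>\<^sup>+\<omega>'. f (X \<omega>, Y \<omega>') \<partial>M \<partial>M)"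
proof -
  have [measurable]: "X \<in> measurable M S" "Y \<in> measurable M T"
    and joint: "distr M S X \<Otimes>\<^sub>M distr M T Y = distr M (S \<Otimes>\<^sub>M T) (\<lambda>\<omega>. (X \<omega>, Y \<omega>))"
    using indep unfolding indep_var_distribution_eq by auto
  interpret T: prob_space "distr M T Y" by (rule prob_space_distr) simp
  note [measurable] = f
  have "(\<integral>\<^sup>+\<omega>. f (X \<omega>, Y \<omega>) \<partial>M) = (\<integral>\<^sup>+p. f p \<partial>distr M (S \<Otimes>\<^sub>M T) (\<lambda>\<omega>. (X \<omega>, Y \<omega>)))"
    by (subst nn_integral_distr) auto
  also have "\<dots> = (\<integral>\<^sup>+x. \<integral>\<^sup>+y. f (x, y) \<partial>distr M T Y \<partial>distr M S X)"
    unfolding joint[symmetric] by (rule T.nn_integral_fst[symmetric]) simp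
  also have "\<dots> = (\<integral>\<^sup>+\<omega>. \<integral>\<^sup>+y. f (X \<omega>, y) \<partial>distr M T Y \<partial>M)"
    by (subst nn_integral_distr) measurable
  also have "\<dots> = (\<integral>\<^sup>+\<omega>. \<integral>\<^sup>+\<omega>'. f (X \<omega>, Y \<omega>') \<partial>M \<partial>M)"
    using measurable_space[of X M S] by (intro nn_integral_cong nn_integral_distr) auto
  finally show ?thesis .
qed

lemma (in prob_space) indep_var_Fubini:
  assumes indep: "indep_var S X T Y" and E: "E \<in> sets (S \<Otimes>\<^sub>M T)"
  shows "emeasure M {\<omega>\<in>space M. (X \<omega>, Y \<omega>) \<in> E}
    = (\<integral>\<^sup>+\<omega>. emeasure M {\<omega>'\<in>space M. (X \<omega>, Y \<omega>') \<in> E} \<partial>M)"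
proof -
  have X [measurable]: "X \<in> measurable M S" and [measurable]: "Y \<in> measurable M T"
    using indep unfolding indep_var_distribution_eq by auto
  note [measurable] = E
  have eq: "emeasure M {\<omega>\<in>space M. P \<omega>} = (\<integral>\<^sup>+\<omega>. indicator (Collect P) \<omega> \<partial>M)"
    if "{\<omega>\<in>space M. P \<omega>} \<in> sets M" for P
    unfolding nn_integral_indicator[OF that, symmetric]
    by (intro nn_integral_cong) (auto simp: indicator_def)
  have "emeasure M {\<omega>\<in>space M. (X \<omega>, Y \<omega>) \<in> E} = (\<integral>\<^sup>+\<omega>. indicator E (X \<omega>, Y \<omega>) \<partial>M)"
    by (subst eq) (measurable, auto simp: indicator_def intro!: nn_integral_cong)
  also have "\<dots> = (\<integral>\<^sup>+\<omega>. \<integral>\<^sup>+\<omega>'. indicator E (X \<omega>, Y \<omega>') \<partial>M \<partial>M)"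
    by (rule indep_var_nn_Fubini[OF indep]) measurable
  also have "\<dots> = (\<integral>\<^sup>+\<omega>. emeasure M {\<omega>'\<in>space M. (X \<omega>, Y \<omega>') \<in> E} \<partial>M)"
  proof (intro nn_integral_cong)
    fix \<omega> assume "\<omega> \<in> space M"
    with X have [measurable]: "X \<omega> \<in> space S" by (rule measurable_space)
    show "(\<integral>\<^sup>+\<omega>'. indicator E (X \<omega>, Y \<omega>') \<partial>M) = emeasure M {\<omega>'\<in>space M. (X \<omega>, Y \<omega>') \<in> E}"
      by (subst eq) (measurable, auto simp: indicator_def intro!: nn_integral_cong)
  qed
  finally show ?thesis .
qed

section \<open>Indices of claims and drivers, and the claims active at time t\<close>

instance ridx :: countable by countable_datatype

definition claims :: "ridx set" where
  "claims = {IX i | i. i \<ge> 1} \<union> {IY i j | i j. i \<ge> 1 \<and> j \<ge> 1}"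

definition drivers :: "ridx set" where
  "drivers = {IM i | i. i \<ge> 1} \<union> {ID i j | i j. i \<ge> 1 \<and> j \<ge> 1} \<union> {IT i | i. i \<ge> 1}"

lemma claims_drivers: "claims \<inter> drivers = {}" "claims \<subseteq> valid_idx" "drivers \<subseteq> valid_idx"
  by (auto simp: claims_def drivers_def valid_idx_def)

definition arr :: "(ridx \<Rightarrow> real) \<Rightarrow> nat \<Rightarrow> real" where
  "arr w i = (\<Sum>k=1..i. w (IT k))"

fun due :: "(ridx \<Rightarrow> real) \<Rightarrow> ridx \<Rightarrow> real" where
  "due w (IX i) = arr w i"
| "due w (IY i j) = arr w i + w (ID i j)"
| "due w _ = 0"

text \<open>The offspring number enters as a real coordinate, so that all drivers live in one
  product of real lines.\<close>

fun offspring :: "(ridx \<Rightarrow> real) \<Rightarrow> ridx \<Rightarrow> bool" where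
  "offspring w (IY i j) \<longleftrightarrow> real j \<le> w (IM i)"
| "offspring w _ \<longleftrightarrow> True"

text \<open>The random index set of the summands of D_r(t). A delayed claim carries no separate
  condition on its parent: with nonnegative delays, a claim due by t has a parent that arrived by
  t.\<close>

definition active :: "real \<Rightarrow> (ridx \<Rightarrow> real) \<Rightarrow> ridx set" where
  "active t w = {k\<in>claims. due w k \<le> t \<and> offspring w k}"

lemma active_subset: "active t w \<subseteq> claims"
  by (auto simp: active_def)

lemma arr_cong: "(\<And>k. k \<in> drivers \<Longrightarrow> w k = v k) \<Longrightarrow> arr w i = arr v i"
  unfolding arr_def by (intro sum.cong) (auto simp: drivers_def)

lemma due_cong:
  assumes "\<And>k. k \<in> drivers \<Longrightarrow> w k = v k" "k \<in> claims"
  shows "due w k = due v k"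
  using assms(2) arr_cong[OF assms(1)] assms(1) by (auto simp: claims_def drivers_def)

lemma active_cong:
  assumes "\<And>k. k \<in> drivers \<Longrightarrow> w k = v k"
  shows "active t w = active t v"
proof -
  have "offspring w k = offspring v k" if "k \<in> claims" for k
    using that assms by (auto simp: claims_def drivers_def)
  then show ?thesis unfolding active_def using due_cong[of w v, OF assms] by auto
qed

abbreviation "driver_space \<equiv> PiM drivers (\<lambda>_. borel :: real measure)"
abbreviation "claim_space \<equiv> PiM claims (\<lambda>_. borel :: real measure)"
abbreviation "model_space \<equiv> driver_space \<Otimes>\<^sub>M claim_space"

lemma arr_measurable [measurable]: "(\<lambda>w. arr w i) \<in> borel_measurable driver_space"
  unfolding arr_def by (intro borel_measurable_sum measurable_component_singleton) (auto simp: drivers_def)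

lemma due_measurable [measurable]:
  assumes "k \<in> claims" shows "(\<lambda>w. due w k) \<in> borel_measurable driver_space"
proof -
  have "(\<lambda>w. arr w i + w (ID i j)) \<in> borel_measurable driver_space" if "i \<ge> 1" "j \<ge> 1" for i j
    using that by (intro borel_measurable_add arr_measurable measurable_component_singleton) (auto simp: drivers_def)
  then show ?thesis using assms by (auto simp: claims_def)
qed

lemma offspring_measurable [measurable]:
  assumes "k \<in> claims" shows "Measurable.pred driver_space (\<lambda>w. offspring w k)"
proof -
  have "Measurable.pred driver_space (\<lambda>w. real j \<le> w (IM i))" if "i \<ge> 1" for i j
  proof -
    have [measurable]: "(\<lambda>w. w (IM i)) \<in> borel_measurable driver_space"
      using that by (intro measurable_component_singleton) (auto simp: drivers_def)
    show ?thesis by measurable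
  qed
  then show ?thesis using assms by (auto simp: claims_def)
qed

lemma active_mem_measurable [measurable]: "Measurable.pred driver_space (\<lambda>w. k \<in> active t w)"
proof (cases "k \<in> claims")
  case True
  note [measurable] = due_measurable[OF True] offspring_measurable[OF True]
  have "(\<lambda>w. k \<in> active t w) = (\<lambda>w. due w k \<le> t \<and> offspring w k)" using True by (auto simp: active_def)
  then show ?thesis by simp
qed (auto simp: active_def)

lemma active_eq_measurable [measurable]: "Measurable.pred driver_space (\<lambda>w. active t w = B)"
proof -
  have "(\<lambda>w. active t w = B) = (\<lambda>w. \<forall>k. k \<in> active t w \<longleftrightarrow> k \<in> B)" by auto
  then show ?thesis by simp
qed

text \<open>Q receives the index set as an argument of its own, so that measurability can be checked
  for each fixed finite set.\<close>

definition claim_event :: "real \<Rightarrow> (ridx set \<Rightarrow> (ridx \<Rightarrow> real) \<Rightarrow> (ridx \<Rightarrow> real) \<Rightarrow> bool) \<Rightarrow>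
    ((ridx \<Rightarrow> real) \<times> (ridx \<Rightarrow> real)) set" where
  "claim_event t Q = {(w, v) \<in> space model_space. finite (active t w) \<and> Q (active t w) w v}"

abbreviation sum_exceeds :: "real \<Rightarrow> real \<Rightarrow> ridx set \<Rightarrow> (ridx \<Rightarrow> real) \<Rightarrow> (ridx \<Rightarrow> real) \<Rightarrow> bool" where
  "sum_exceeds r x B w v \<equiv> x < (\<Sum>k\<in>B. exp (- r * due w k) * v k)"

abbreviation max_exceeds :: "real \<Rightarrow> real \<Rightarrow> ridx set \<Rightarrow> (ridx \<Rightarrow> real) \<Rightarrow> (ridx \<Rightarrow> real) \<Rightarrow> bool" where
  "max_exceeds r x B w v \<equiv> \<exists>k\<in>B. x < exp (- r * due w k) * v k"

text \<open>There are only countably many finite sets of indices, so the event is a countable union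
  over the possible values of \<open>active\<close>.\<close>

lemma claim_event_sets:
  assumes Q: "\<And>B. finite B \<Longrightarrow> B \<subseteq> claims \<Longrightarrow> Measurable.pred model_space (\<lambda>(w, v). Q B w v)"
  shows "claim_event t Q \<in> sets model_space"
proof -
  let ?S = "model_space"
  have eq: "claim_event t Q = (\<Union>B\<in>{B. finite B \<and> B \<subseteq> claims}. {p \<in> space ?S. active t (fst p) = B \<and> Q B (fst p) (snd p)})"
    unfolding claim_event_def using active_subset by auto
  have "countable {B::ridx set. finite B \<and> B \<subseteq> claims}"
    by (rule countable_subset[OF _ countable_Collect_finite]) auto
  moreover have "{p \<in> space ?S. active t (fst p) = B \<and> Q B (fst p) (snd p)} \<in> sets ?S"
    if "finite B" "B \<subseteq> claims" for B
  proof -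
    have [measurable]: "Measurable.pred ?S (\<lambda>p. Q B (fst p) (snd p))"
      using Q[OF that] by (simp add: case_prod_beta)
    show ?thesis by measurable
  qed
  ultimately show ?thesis unfolding eq by (intro sets.countable_UN') auto
qed

lemma claim_term_measurable:
  assumes "k \<in> claims"
  shows "(\<lambda>p. exp (- r * due (fst p) k) * snd p k) \<in> borel_measurable model_space"
proof -
  note [measurable] = due_measurable[OF assms] measurable_component_singleton[OF assms, of "\<lambda>_. borel :: real measure"]
  show ?thesis by measurable
qed

lemma sum_event_sets: "claim_event t (sum_exceeds r x) \<in> sets model_space"
proof (rule claim_event_sets)
  fix B assume B: "finite B" "B \<subseteq> claims"
  have "(\<lambda>p. \<Sum>k\<in>B. exp (- r * due (fst p) k) * snd p k) \<in> borel_measurable model_space"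
    using B by (intro borel_measurable_sum claim_term_measurable) auto
  then show "Measurable.pred model_space (\<lambda>(w, v). sum_exceeds r x B w v)"
    unfolding case_prod_beta by measurable
qed

lemma max_event_sets: "claim_event t (max_exceeds r x) \<in> sets model_space"
proof (rule claim_event_sets)
  fix B assume B: "finite B" "B \<subseteq> claims"
  have "Measurable.pred model_space (\<lambda>p. x < exp (- r * due (fst p) k) * snd p k)" if "k \<in> B" for k
  proof -
    have [measurable]: "(\<lambda>p. exp (- r * due (fst p) k) * snd p k) \<in> borel_measurable model_space"
      using that B by (intro claim_term_measurable) auto
    show ?thesis by measurable
  qed
  then show "Measurable.pred model_space (\<lambda>(w, v). max_exceeds r x B w v)"
    unfolding case_prod_beta using B by (intro pred_intros_finite) auto
qed

section \<open>Exponential bounds for the number of active claims\<close>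

lemma card_active_le:
  assumes nn: "\<And>k. k \<in> valid_idx \<Longrightarrow> 0 \<le> w k" and fin: "finite {i. arr w i \<le> T}" and t: "t \<le> T"
    and ne: "active t w \<noteq> {}"
  shows "\<exists>n\<ge>1. arr w n \<le> T \<and> finite (active t w) \<and> real (card (active t w)) \<le> (\<Sum>i=1..n. 1 + w (IM i))"
proof -
  let ?I = "{i. 1 \<le> i \<and> arr w i \<le> t}"
  have finI: "finite ?I" by (rule finite_subset[OF _ fin]) (use t in auto)
  have mem: "i \<in> ?I" if "IX i \<in> active t w \<or> IY i j \<in> active t w" for i j
    using that nn[of "ID i j"] by (auto simp: active_def claims_def valid_idx_def)
  have "\<exists>i. i \<in> ?I"
  proof -
    obtain k where k: "k \<in> active t w" using ne by blast
    then have "k \<in> claims" using active_subset by blast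
    then show ?thesis using k mem unfolding claims_def by blast
  qed
  then have "Max ?I \<in> ?I" using finI by (intro Max_in) auto
  \<comment> \<open>The last arrival by t: each of the first n arrivals brings one main claim and at
    most as many delayed claims as its offspring coordinate allows.\<close>
  define n where "n = Max ?I"
  have n: "1 \<le> n" "arr w n \<le> T" using \<open>Max ?I \<in> ?I\<close> t by (auto simp: n_def)
  have le_n: "i \<le> n" if "i \<in> ?I" for i using finI that by (auto simp: n_def)
  \<comment> \<open>The floor appears because \<open>w (IM i)\<close> is any nonnegative real in
    this deterministic statement.\<close>
  let ?Y = "\<lambda>i. IY i ` {1..nat \<lfloor>w (IM i)\<rfloor>}"
  have sub: "active t w \<subseteq> IX ` {1..n} \<union> (\<Union>i\<in>{1..n}. ?Y i)"
  proof
    fix k assume k: "k \<in> active t w"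
    then have "k \<in> claims" using active_subset by blast
    then consider i where "k = IX i" "1 \<le> i" | i j where "k = IY i j" "1 \<le> i" "1 \<le> j" by (auto simp: claims_def)
    then show "k \<in> IX ` {1..n} \<union> (\<Union>i\<in>{1..n}. ?Y i)"
    proof cases
      case 1
      then show ?thesis using le_n mem k by auto
    next
      case 2
      then have "i \<in> {1..n}" using le_n mem k by auto
      moreover have "real j \<le> w (IM i)" using k 2 by (auto simp: active_def)
      then have "j \<le> nat \<lfloor>w (IM i)\<rfloor>" by linarith
      then have "k \<in> ?Y i" using 2 by auto
      ultimately show ?thesis by blast
    qed
  qed
  have finU: "finite (IX ` {1..n} \<union> (\<Union>i\<in>{1..n}. ?Y i))" by auto
  have "card (active t w) \<le> card (IX ` {1..n} \<union> (\<Union>i\<in>{1..n}. ?Y i))" by (rule card_mono[OF finU sub])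
  also have "\<dots> \<le> card (IX ` {1..n}) + card (\<Union>i\<in>{1..n}. ?Y i)" by (rule card_Un_le)
  also have "card (IX ` {1..n}) \<le> n" using card_image_le[of "{1..n}" IX] by simp
  also have "card (\<Union>i\<in>{1..n}. ?Y i) \<le> (\<Sum>i=1..n. card (?Y i))" by (rule card_UN_le) simp
  also have "\<dots> \<le> (\<Sum>i=1..n. nat \<lfloor>w (IM i)\<rfloor>)"
    by (intro sum_mono) (use card_image_le[of "{1..nat \<lfloor>w (IM i)\<rfloor>}" "IY i" for i] in simp)
  finally have "card (active t w) \<le> n + (\<Sum>i=1..n. nat \<lfloor>w (IM i)\<rfloor>)" by simp
  then have "real (card (active t w)) \<le> real (n + (\<Sum>i=1..n. nat \<lfloor>w (IM i)\<rfloor>))" by (simp only: of_nat_le_iff)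
  also have "\<dots> = n + (\<Sum>i=1..n. real (nat \<lfloor>w (IM i)\<rfloor>))" by simp
  also have "\<dots> \<le> n + (\<Sum>i=1..n. w (IM i))"
    using nn by (intro add_left_mono sum_mono) (auto simp: valid_idx_def)
  also have "\<dots> = (\<Sum>i=1..n. 1 + w (IM i))" by (simp add: sum.distrib)
  finally show ?thesis using n finite_subset[OF sub finU] by blast
qed

text \<open>A Chernoff-type majorant on the event \<tau>_(n+1) \<le> T, where exp (T - \<theta>_2 -
  ... - \<theta>_(n+1)) \<ge> 1 takes the place of the indicator. The second product starts at k = 2
  to keep \<theta>_1 out.\<close>

definition growth :: "real \<Rightarrow> real \<Rightarrow> (ridx \<Rightarrow> real) \<Rightarrow> nat \<Rightarrow> real" where
  "growth s T w n = exp T * (\<Prod>i=1..Suc n. exp (s * (1 + w (IM i)))) * (\<Prod>k=2..Suc n. exp (- w (IT k)))"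

text \<open>The index of the last arrival depends on the configuration, so its term is enlarged to
  the sum over all n. What remains reads only \<theta>_2, \<theta>_3, ... and the offspring
  numbers.\<close>

lemma exp_card_active_le:
  fixes s :: real
  assumes nn: "\<And>k. k \<in> valid_idx \<Longrightarrow> 0 \<le> w k" and fin: "finite {i. arr w i \<le> T}" and t: "t \<le> T"
    and ne: "active t w \<noteq> {}" and s: "0 \<le> s"
  shows "ennreal (exp (s * card (active t w))) \<le> (\<Sum>n. ennreal (growth s T w n))"
proof -
  obtain n where n: "1 \<le> n" "arr w n \<le> T" and card: "real (card (active t w)) \<le> (\<Sum>i=1..n. 1 + w (IM i))"
    using card_active_le[OF nn fin t ne] by auto
  obtain m where m: "n = Suc m" using n by (cases n) auto
  have "arr w n = w (IT 1) + (\<Sum>k=2..Suc m. w (IT k))"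
    unfolding arr_def m by (subst sum.atLeast_Suc_atMost) (auto simp: numeral_2_eq_2)
  then have le: "0 \<le> T - (\<Sum>k=2..Suc m. w (IT k))" using n nn[of "IT 1"] by (auto simp: valid_idx_def)
  have "exp (s * card (active t w)) \<le> exp (s * (\<Sum>i=1..n. 1 + w (IM i)) + (T - (\<Sum>k=2..Suc m. w (IT k))))"
    using mult_left_mono[OF card s] le by simp
  also have "\<dots> = growth s T w m"
  proof -
    have "(\<Prod>i=1..Suc m. exp (s * (1 + w (IM i)))) = exp (s * (\<Sum>i=1..Suc m. 1 + w (IM i)))"
      by (subst exp_sum[symmetric]) (simp_all only: finite_atLeastAtMost sum_distrib_left)
    moreover have "(\<Prod>k=2..Suc m. exp (- w (IT k))) = exp (- (\<Sum>k=2..Suc m. w (IT k)))"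
      by (subst exp_sum[symmetric]) (simp_all only: finite_atLeastAtMost sum_negf)
    ultimately show ?thesis unfolding growth_def m by (simp only: exp_add[symmetric] add_ac diff_conv_add_uminus)
  qed
  finally have "ennreal (exp (s * card (active t w))) \<le> ennreal (growth s T w m)" by (rule ennreal_leI)
  also have "\<dots> \<le> (\<Sum>n. ennreal (growth s T w n))"
    using sum_le_suminf[of "\<lambda>n. ennreal (growth s T w n)" "{m}"] by simp
  finally show ?thesis .
qed

text \<open>The real-valued model after passing to gauges: V is the law of the gauge of a main
  claim, \<open>Gb\<close> the tail of the gauge of a delayed one. \<open>Gb_long\<close> measures
  the effect of a shift on \<open>Gb\<close> by the tail of the main claims instead of
  \<open>Gb\<close> itself; in this form it holds under the hypotheses of either part of the
  theorem.\<close>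

locale claim_model = subexp_dist V for V :: "real measure" +
  fixes M :: "'w measure" and Z :: "ridx \<Rightarrow> 'w \<Rightarrow> real" and Gb :: "real \<Rightarrow> real"
    and C r T \<delta> :: real
  assumes M: "prob_space M"
    and indep: "prob_space.indep_vars M (\<lambda>_. borel) Z valid_idx"
    and nonneg: "\<And>k \<omega>. k \<in> valid_idx \<Longrightarrow> 0 \<le> Z k \<omega>"
    and tailX: "\<And>i y. 1 \<le> i \<Longrightarrow> \<P>(\<omega> in M. y < Z (IX i) \<omega>) = tbar y"
    and tailY: "\<And>i j y. 1 \<le> i \<Longrightarrow> 1 \<le> j \<Longrightarrow> \<P>(\<omega> in M. y < Z (IY i j) \<omega>) = Gb y"
    and C: "1 \<le> C" and Gb_le: "\<And>y. Gb y \<le> C * tbar y"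
    and Gb_long: "\<And>h e. 0 \<le> h \<Longrightarrow> 0 < e \<Longrightarrow> \<exists>x0. \<forall>y\<ge>x0. Gb (y - h) \<le> Gb y + e * tbar y"
    and r: "0 \<le> r"
    and th_distr: "\<And>i. 1 \<le> i \<Longrightarrow> distr M borel (Z (IT i)) = distr M borel (Z (IT 1))"
    and th_pos: "AE \<omega> in M. 0 < Z (IT 1) \<omega>"
    and th_fin: "AE \<omega> in M. finite {i. arr (\<lambda>k. Z k \<omega>) i \<le> T}"
    and M_distr: "\<And>i. 1 \<le> i \<Longrightarrow> distr M borel (Z (IM i)) = distr M borel (Z (IM 1))"
    and \<delta>: "0 < \<delta>" and M_mom: "integrable M (\<lambda>\<omega>. exp (\<delta> * Z (IM 1) \<omega>))"
begin

sublocale M: prob_space M by (rule M)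

abbreviation W :: "'w \<Rightarrow> ridx \<Rightarrow> real" where "W \<omega> \<equiv> \<lambda>k. Z k \<omega>"

lemma Z_measurable: "k \<in> valid_idx \<Longrightarrow> Z k \<in> borel_measurable M"
  using indep unfolding M.indep_vars_def by auto

lemma T_valid: "1 \<le> i \<Longrightarrow> IT i \<in> valid_idx" and M_valid: "1 \<le> i \<Longrightarrow> IM i \<in> valid_idx"
  by (auto simp: valid_idx_def)

lemma Z_1_measurable [measurable]:
  "Z (IT 1) \<in> borel_measurable M" "Z (IT (Suc 0)) \<in> borel_measurable M"
  "Z (IM 1) \<in> borel_measurable M" "Z (IM (Suc 0)) \<in> borel_measurable M"
  by (auto intro!: Z_measurable T_valid M_valid)

fun ptail :: "ridx \<Rightarrow> real \<Rightarrow> real" where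
  "ptail (IX i) y = tbar y"
| "ptail _ y = Gb y"

lemma ptail: "k \<in> claims \<Longrightarrow> \<P>(\<omega> in M. y < Z k \<omega>) = ptail k y"
  using tailX tailY by (auto simp: claims_def)

lemma ptail_nonneg: "k \<in> claims \<Longrightarrow> 0 \<le> ptail k y"
  using ptail[of k y] measure_nonneg[of M] by metis

lemma ptail_le: "k \<in> claims \<Longrightarrow> ptail k y \<le> C * tbar y"
  using Gb_le mult_right_mono[OF C, of "tbar y"] by (auto simp: claims_def)

lemma ptail_antimono: "k \<in> claims \<Longrightarrow> x \<le> y \<Longrightarrow> ptail k y \<le> ptail k x"
  using Z_measurable[of k] claims_drivers
  by (subst (1 2) ptail[symmetric]) (auto intro!: M.finite_measure_mono)

abbreviation offspring_mgf :: "real \<Rightarrow> ennreal" where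
  "offspring_mgf s \<equiv> \<integral>\<^sup>+\<omega>. ennreal (exp (s * (1 + Z (IM 1) \<omega>))) \<partial>M"

abbreviation arrival_laplace :: ennreal where
  "arrival_laplace \<equiv> \<integral>\<^sup>+\<omega>. ennreal (exp (- Z (IT 1) \<omega>)) \<partial>M"

text \<open>As s tends to 0, the bound b of the offspring factor tends to 1, while \<beta> = E exp
  (-\<theta>_1) < 1 because \<theta>_1 > 0 almost surely. Hence \<beta> b < 1 for some s >
  0.\<close>

lemma moment_parameter:
  "\<exists>s>0. \<exists>\<beta> b. 0 \<le> \<beta> \<and> 0 \<le> b \<and> \<beta> * b < 1 \<and>
     arrival_laplace = ennreal \<beta> \<and>
     offspring_mgf s \<le> ennreal b"
proof -
  define \<beta> where "\<beta> = (\<integral>\<omega>. exp (- Z (IT 1) \<omega>) \<partial>M)"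
  have int\<beta>: "integrable M (\<lambda>\<omega>. exp (- Z (IT 1) \<omega>))"
    using nonneg[OF T_valid[of 1]] by (intro M.integrable_const_bound[where B=1]) auto
  have \<beta>0: "0 \<le> \<beta>" unfolding \<beta>_def by (intro integral_nonneg_AE) auto
  have "\<beta> < (\<integral>\<omega>. 1 \<partial>M)" unfolding \<beta>_def
    using th_pos by (intro M.integral_less_AE_space int\<beta>) (auto simp: M.emeasure_space_1)
  then have \<beta>1: "\<beta> < 1" by (simp add: M.prob_space)
  define E where "E = (\<integral>\<omega>. exp (\<delta> * Z (IM 1) \<omega>) \<partial>M)"
  have "((\<lambda>s. \<beta> * (exp s * (1 + s / \<delta> * (E - 1)))) \<longlongrightarrow> \<beta> * (exp 0 * (1 + 0 / \<delta> * (E - 1)))) (at_right 0)"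
    by (intro tendsto_intros)
      (auto intro!: tendsto_intros simp: \<delta>[THEN less_imp_neq, symmetric])
  then have "\<forall>\<^sub>F s in at_right 0. \<beta> * (exp s * (1 + s / \<delta> * (E - 1))) < 1"
    using \<beta>1 by (auto dest!: order_tendstoD(2)[where a=1])
  moreover have "\<forall>\<^sub>F s in at_right 0. 0 < s \<and> s < \<delta>"
    using \<delta> by (simp add: eventually_at_right_less eventually_conj_iff) (metis eventually_at_right_real greaterThanLessThan_iff eventually_mono)
  ultimately have "\<forall>\<^sub>F s in at_right 0. \<beta> * (exp s * (1 + s / \<delta> * (E - 1))) < 1 \<and> 0 < s \<and> s < \<delta>"
    by (rule eventually_conj)
  then obtain s where s: "\<beta> * (exp s * (1 + s / \<delta> * (E - 1))) < 1" "0 < s" "s < \<delta>"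
    using eventually_happens[of _ "at_right (0::real)"] by auto
  \<comment> \<open>An explicit majorant of the moment generating function at s in terms of the
    moment E at \<delta>; it makes the limit as s tends to 0 elementary.\<close>
  define b where "b = exp s * (1 + s / \<delta> * (E - 1))"
  \<comment> \<open>convexity of the exponential between \<open>0\<close> and \<open>\<delta> z\<close>\<close>
  have conv: "exp (s * z) \<le> 1 + s / \<delta> * (exp (\<delta> * z) - 1)" for z :: real
  proof -
    have "exp ((1 - s / \<delta>) *\<^sub>R 0 + (s / \<delta>) *\<^sub>R (\<delta> * z)) \<le> (1 - s / \<delta>) * exp 0 + (s / \<delta>) * exp (\<delta> * z)"
      using s \<delta> by (intro convex_onD[OF exp_convex]) auto
    then show ?thesis using \<delta> by (simp add: algebra_simps)
  qed
  have int1: "integrable M (\<lambda>\<omega>. exp s * (1 + s / \<delta> * (exp (\<delta> * Z (IM 1) \<omega>) - 1)))"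
    using M_mom by auto
  have le: "exp (s * (1 + Z (IM 1) \<omega>)) \<le> exp s * (1 + s / \<delta> * (exp (\<delta> * Z (IM 1) \<omega>) - 1))" for \<omega>
    using mult_left_mono[OF conv[of "Z (IM 1) \<omega>"], of "exp s"] by (simp add: distrib_left exp_add)
  have nn: "0 \<le> exp s * (1 + s / \<delta> * (exp (\<delta> * Z (IM 1) \<omega>) - 1))" for \<omega>
    using le[of \<omega>] by (rule order_trans[rotated]) simp
  have eqb: "(\<integral>\<omega>. exp s * (1 + s / \<delta> * (exp (\<delta> * Z (IM 1) \<omega>) - 1)) \<partial>M) = b"
    using M_mom by (simp add: b_def E_def M.prob_space)
  have b0: "0 \<le> b" unfolding eqb[symmetric] using nn by (intro integral_nonneg_AE) auto
  have "offspring_mgf s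
      \<le> (\<integral>\<^sup>+\<omega>. ennreal (exp s * (1 + s / \<delta> * (exp (\<delta> * Z (IM 1) \<omega>) - 1))) \<partial>M)"
    by (intro nn_integral_mono ennreal_leI le)
  also have "\<dots> = ennreal b"
    unfolding eqb[symmetric] using nn by (intro nn_integral_eq_integral int1) auto
  finally have "offspring_mgf s \<le> ennreal b" .
  moreover have "arrival_laplace = ennreal \<beta>"
    unfolding \<beta>_def by (intro nn_integral_eq_integral int\<beta>) auto
  ultimately show ?thesis using s b0 \<beta>0 by (auto simp: b_def)
qed

lemma nn_integral_identical:
  assumes [measurable]: "f \<in> borel_measurable borel" "X \<in> borel_measurable M" "Y \<in> borel_measurable M"
    and "distr M borel X = distr M borel Y"
  shows "(\<integral>\<^sup>+\<omega>. f (X \<omega>) \<partial>M) = (\<integral>\<^sup>+\<omega>. f (Y \<omega>) \<partial>M)"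
  using nn_integral_distr[of X M borel f] nn_integral_distr[of Y M borel f] assms by simp

lemma growth_measurable: "(\<lambda>\<omega>. growth s T (W \<omega>) n) \<in> borel_measurable M"
  unfolding growth_def
  by (intro borel_measurable_times borel_measurable_prod borel_measurable_const
      borel_measurable_exp borel_measurable_uminus borel_measurable_add Z_measurable T_valid M_valid
      measurable_compose[OF _ borel_measurable_exp]) auto

text \<open>The integrand is a product over the distinct indices of n + 1 gaps and n + 1 offspring
  numbers, hence its mean factorises. The first gap carries the factor g alone, which leaves n
  Laplace factors against n + 1 offspring factors.\<close>

lemma growth_expectation:
  assumes [measurable]: "g \<in> borel_measurable borel"
  shows "(\<integral>\<^sup>+\<omega>. g (Z (IT 1) \<omega>) * ennreal (growth s T (W \<omega>) n) \<partial>M)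
    = ennreal (exp T) * (\<integral>\<^sup>+\<omega>. g (Z (IT 1) \<omega>) \<partial>M) *
      offspring_mgf s ^ Suc n *
      arrival_laplace ^ n"
proof -
  define f :: "ridx \<Rightarrow> real \<Rightarrow> ennreal" where "f k z = (case k of IT i \<Rightarrow> if i = 1 then g z else ennreal (exp (- z))
     | _ \<Rightarrow> ennreal (exp (s * (1 + z))))" for k z
  let ?T = "IT ` {1..Suc n}" and ?M = "IM ` {1..Suc n}"
  have f_meas [measurable]: "f k \<in> borel_measurable borel" for k
    unfolding f_def[abs_def] by (cases k) auto
  have sub: "?T \<union> ?M \<subseteq> valid_idx" using T_valid M_valid by auto
  have ind: "M.indep_vars (\<lambda>_. borel) (\<lambda>k \<omega>. f k (Z k \<omega>)) (?T \<union> ?M)"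
    by (rule M.indep_vars_compose2[OF M.indep_vars_subset[OF indep sub]]) simp
  have split: "(\<Prod>k\<in>?T \<union> ?M. h k) = h (IT 1) * (\<Prod>k=2..Suc n. h (IT k)) * (\<Prod>i=1..Suc n. h (IM i))" for h :: "ridx \<Rightarrow> ennreal"
  proof -
    have "(\<Prod>k\<in>?T \<union> ?M. h k) = (\<Prod>k\<in>?T. h k) * (\<Prod>k\<in>?M. h k)" by (rule prod.union_disjoint) auto
    also have "(\<Prod>k\<in>?T. h k) = (\<Prod>k=1..Suc n. h (IT k))" by (subst prod.reindex) (auto simp: inj_on_def)
    also have "\<dots> = h (IT 1) * (\<Prod>k=2..Suc n. h (IT k))"
      by (subst prod.atLeast_Suc_atMost) (auto simp: numeral_2_eq_2)
    also have "(\<Prod>k\<in>?M. h k) = (\<Prod>i=1..Suc n. h (IM i))" by (subst prod.reindex) (auto simp: inj_on_def)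
    finally show ?thesis .
  qed
  have g_eq: "g (Z (IT 1) \<omega>) * ennreal (growth s T (W \<omega>) n) = ennreal (exp T) * (\<Prod>k\<in>?T \<union> ?M. f k (Z k \<omega>))" for \<omega>
  proof -
    have "(\<Prod>k=2..Suc n. f (IT k) (Z (IT k) \<omega>)) = (\<Prod>k=2..Suc n. ennreal (exp (- Z (IT k) \<omega>)))"
      by (intro prod.cong) (auto simp: f_def)
    also have "\<dots> = ennreal (\<Prod>k=2..Suc n. exp (- Z (IT k) \<omega>))" by (intro prod_ennreal) auto
    finally have 1: "(\<Prod>k=2..Suc n. f (IT k) (Z (IT k) \<omega>)) = ennreal (\<Prod>k=2..Suc n. exp (- Z (IT k) \<omega>))" .
    have 2: "(\<Prod>i=1..Suc n. f (IM i) (Z (IM i) \<omega>)) = ennreal (\<Prod>i=1..Suc n. exp (s * (1 + Z (IM i) \<omega>)))"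
      unfolding f_def by (subst prod_ennreal[symmetric]) auto
    show ?thesis unfolding split 1 2 growth_def
      by (simp add: f_def ennreal_mult' ennreal_mult'' prod_nonneg mult_ac del: prod.cl_ivl_Suc)
  qed
  have fT: "(\<integral>\<^sup>+\<omega>. f (IT k) (Z (IT k) \<omega>) \<partial>M) = arrival_laplace" if "2 \<le> k" for k
  proof -
    have "(\<integral>\<^sup>+\<omega>. f (IT k) (Z (IT k) \<omega>) \<partial>M) = (\<integral>\<^sup>+\<omega>. (\<lambda>z. ennreal (exp (- z))) (Z (IT k) \<omega>) \<partial>M)"
      using that by (simp add: f_def)
    also have "\<dots> = (\<integral>\<^sup>+\<omega>. (\<lambda>z. ennreal (exp (- z))) (Z (IT 1) \<omega>) \<partial>M)"
      using that by (intro nn_integral_identical th_distr Z_measurable T_valid) auto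
    finally show ?thesis by simp
  qed
  have fM: "(\<integral>\<^sup>+\<omega>. f (IM i) (Z (IM i) \<omega>) \<partial>M) = offspring_mgf s" if "1 \<le> i" for i
  proof -
    have "(\<integral>\<^sup>+\<omega>. f (IM i) (Z (IM i) \<omega>) \<partial>M) = (\<integral>\<^sup>+\<omega>. (\<lambda>z. ennreal (exp (s * (1 + z)))) (Z (IM i) \<omega>) \<partial>M)"
      by (simp add: f_def)
    also have "\<dots> = (\<integral>\<^sup>+\<omega>. (\<lambda>z. ennreal (exp (s * (1 + z)))) (Z (IM 1) \<omega>) \<partial>M)"
      using that by (intro nn_integral_identical M_distr Z_measurable M_valid) auto
    finally show ?thesis by simp
  qed
  have "(\<integral>\<^sup>+\<omega>. g (Z (IT 1) \<omega>) * ennreal (growth s T (W \<omega>) n) \<partial>M)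
      = (\<integral>\<^sup>+\<omega>. ennreal (exp T) * (\<Prod>k\<in>?T \<union> ?M. f k (Z k \<omega>)) \<partial>M)"
    by (intro nn_integral_cong g_eq)
  also have "\<dots> = ennreal (exp T) * (\<integral>\<^sup>+\<omega>. (\<Prod>k\<in>?T \<union> ?M. f k (Z k \<omega>)) \<partial>M)"
    using sub by (intro nn_integral_cmult borel_measurable_prod_ennreal measurable_compose[OF Z_measurable f_meas]) auto
  also have "(\<integral>\<^sup>+\<omega>. (\<Prod>k\<in>?T \<union> ?M. f k (Z k \<omega>)) \<partial>M) = (\<Prod>k\<in>?T \<union> ?M. \<integral>\<^sup>+\<omega>. f k (Z k \<omega>) \<partial>M)"
    by (rule M.indep_vars_nn_integral[OF _ ind]) auto
  also have "\<dots> = (\<integral>\<^sup>+\<omega>. g (Z (IT 1) \<omega>) \<partial>M) *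
      (\<Prod>k=2..Suc n. arrival_laplace) *
      (\<Prod>i=1..Suc n. offspring_mgf s)"
    unfolding split
    by (intro arg_cong2[where f="(*)"] prod.cong fT fM refl) (auto simp: f_def)
  also have "\<dots> = (\<integral>\<^sup>+\<omega>. g (Z (IT 1) \<omega>) \<partial>M) *
      arrival_laplace ^ n *
      offspring_mgf s ^ Suc n"
    by (simp only: prod_constant card_atLeastAtMost) simp
  finally show ?thesis by (simp only: mult_ac)
qed

abbreviation total_growth :: "real \<Rightarrow> 'w \<Rightarrow> ennreal" where
  "total_growth s \<omega> \<equiv> \<Sum>n. ennreal (growth s T (W \<omega>) n)"

text \<open>Usable form of the fact that the total growth is independent of \<theta>_1 and has mean
  at most \<Gamma>. With g vanishing beyond t, the bound scales with the chance of an arrival by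
  t.\<close>

definition dominated :: "real \<Rightarrow> real \<Rightarrow> bool" where
  "dominated s \<Gamma> \<longleftrightarrow> 0 < s \<and> 0 < \<Gamma> \<and> (\<forall>g\<in>borel_measurable borel.
    (\<integral>\<^sup>+\<omega>. g (Z (IT 1) \<omega>) * total_growth s \<omega> \<partial>M) \<le> ennreal \<Gamma> * (\<integral>\<^sup>+\<omega>. g (Z (IT 1) \<omega>) \<partial>M))"

lemma moment_bound: "\<exists>s \<Gamma>. dominated s \<Gamma>"
proof -
  obtain s \<beta> b where s: "0 < s" and \<beta>: "0 \<le> \<beta>" "0 \<le> b" "\<beta> * b < 1"
    and I\<beta>: "arrival_laplace = ennreal \<beta>"
    and Ib: "offspring_mgf s \<le> ennreal b"
    using moment_parameter by blast
  \<comment> \<open>Limit of a geometric series with ratio \<beta> b; the added 1 makes \<Gamma>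
    positive in every case, because e / \<Gamma> is formed later.\<close>
  define \<Gamma> where "\<Gamma> = exp T * b * (1 / (1 - \<beta> * b)) + 1"
  have \<Gamma>0: "0 < \<Gamma>" using \<beta> by (auto simp: \<Gamma>_def intro!: add_nonneg_pos)
  have bound: "(\<integral>\<^sup>+\<omega>. g (Z (IT 1) \<omega>) * total_growth s \<omega> \<partial>M)
        \<le> ennreal \<Gamma> * (\<integral>\<^sup>+\<omega>. g (Z (IT 1) \<omega>) \<partial>M)" if [measurable]: "g \<in> borel_measurable borel" for g
  proof -
    note [measurable] = growth_measurable
    let ?I = "\<integral>\<^sup>+\<omega>. g (Z (IT 1) \<omega>) \<partial>M"
    have "(\<integral>\<^sup>+\<omega>. g (Z (IT 1) \<omega>) * total_growth s \<omega> \<partial>M)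
      = (\<integral>\<^sup>+\<omega>. (\<Sum>n. g (Z (IT 1) \<omega>) * ennreal (growth s T (W \<omega>) n)) \<partial>M)"
      by (simp add: ennreal_suminf_cmult)
    also have "\<dots> = (\<Sum>n. \<integral>\<^sup>+\<omega>. g (Z (IT 1) \<omega>) * ennreal (growth s T (W \<omega>) n) \<partial>M)"
      by (intro nn_integral_suminf) measurable
    also have "\<dots> \<le> (\<Sum>n. ?I * ennreal (exp T * b * (\<beta> * b) ^ n))"
    proof (intro suminf_le)
      fix n
      have "(\<integral>\<^sup>+\<omega>. g (Z (IT 1) \<omega>) * ennreal (growth s T (W \<omega>) n) \<partial>M)
          \<le> ennreal (exp T) * ?I * ennreal b ^ Suc n * ennreal \<beta> ^ n"
        unfolding growth_expectation[OF that] I\<beta>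
        using Ib by (intro mult_left_mono mult_right_mono power_mono) auto
      also have "\<dots> = ?I * (ennreal (exp T) * ennreal b ^ Suc n * ennreal \<beta> ^ n)" by (simp only: mult_ac)
      also have "ennreal (exp T) * ennreal b ^ Suc n * ennreal \<beta> ^ n = ennreal (exp T * b * (\<beta> * b) ^ n)"
        using \<beta> by (simp add: ennreal_power ennreal_mult''[symmetric] ennreal_mult'[symmetric] power_mult_distrib mult_ac)
      finally show "(\<integral>\<^sup>+\<omega>. g (Z (IT 1) \<omega>) * ennreal (growth s T (W \<omega>) n) \<partial>M) \<le> ?I * ennreal (exp T * b * (\<beta> * b) ^ n)" .
    qed auto
    also have "\<dots> = ?I * (\<Sum>n. ennreal (exp T * b * (\<beta> * b) ^ n))" by (rule ennreal_suminf_cmult)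
    also have "(\<Sum>n. ennreal (exp T * b * (\<beta> * b) ^ n)) = ennreal (\<Sum>n. exp T * b * (\<beta> * b) ^ n)"
      using \<beta> by (intro suminf_ennreal2) (auto intro!: summable_mult summable_geometric)
    also have "(\<Sum>n. exp T * b * (\<beta> * b) ^ n) = exp T * b * (1 / (1 - \<beta> * b))"
      using \<beta> by (subst suminf_mult) (auto simp: suminf_geometric intro!: summable_geometric)
    also have "?I * ennreal \<dots> \<le> ?I * ennreal \<Gamma>"
      by (intro mult_left_mono ennreal_leI) (auto simp: \<Gamma>_def)
    finally show ?thesis by (simp add: mult.commute)
  qed
  show ?thesis using s \<Gamma>0 bound unfolding dominated_def by blast
qed

end

lemma antimono_measurable:
  fixes f :: "real \<Rightarrow> real"
  assumes "\<And>x y. x \<le> y \<Longrightarrow> f y \<le> f x"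
  shows "f \<in> borel_measurable borel"
proof -
  have "mono (\<lambda>x. - f x)" using assms by (auto intro!: monoI)
  then have "(\<lambda>x. - (- f x)) \<in> borel_measurable borel"
    by (intro borel_measurable_uminus borel_measurable_mono)
  then show ?thesis by simp
qed

text \<open>Series in \<open>ennreal\<close> may be exchanged with expectations term by term,
  without any question of convergence; when only finitely many terms are nonzero this is the
  ordinary sum.\<close>

definition claim_sum :: "(ridx \<Rightarrow> ennreal) \<Rightarrow> ennreal" where
  "claim_sum f = (\<Sum>i. f (IX (Suc i))) + (\<Sum>i. \<Sum>j. f (IY (Suc i) (Suc j)))"

lemma claim_sum_finite:
  assumes B: "finite B" "B \<subseteq> claims" and f: "\<And>k. k \<in> claims \<Longrightarrow> k \<notin> B \<Longrightarrow> f k = 0"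
  shows "claim_sum f = (\<Sum>k\<in>B. f k)"
proof -
  let ?X = "range (\<lambda>i. IX (Suc i))" and ?Y = "range (\<lambda>(i, j). IY (Suc i) (Suc j))"
  have XY: "claims = ?X \<union> ?Y"
  proof -
    have "IX i \<in> ?X" if "1 \<le> i" for i using that by (intro image_eqI[of _ _ "i - 1"]) auto
    moreover have "IY i j \<in> ?Y" if "1 \<le> i" "1 \<le> j" for i j
      using that by (intro image_eqI[of _ _ "(i - 1, j - 1)"]) auto
    ultimately show ?thesis by (auto simp: claims_def)
  qed
  \<comment> \<open>Regrouping goes through the counting measure, under which the two families of
    indices are bijective images of the naturals and of pairs of naturals.\<close>
  have "(\<Sum>k\<in>B. f k) = (\<integral>\<^sup>+k. f k \<partial>count_space claims)"
    using B f by (intro nn_integral_count_space'[symmetric]) auto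
  also have "\<dots> = (\<integral>\<^sup>+k. f k * indicator claims k \<partial>count_space UNIV)"
    by (simp add: nn_integral_count_space_indicator)
  also have "\<dots> = (\<integral>\<^sup>+k. f k * indicator ?X k + f k * indicator ?Y k \<partial>count_space UNIV)"
    by (intro nn_integral_cong) (auto simp: XY split: split_indicator)
  also have "\<dots> = (\<integral>\<^sup>+k. f k \<partial>count_space ?X) + (\<integral>\<^sup>+k. f k \<partial>count_space ?Y)"
    by (subst nn_integral_add) (simp_all add: nn_integral_count_space_indicator)
  also have "(\<integral>\<^sup>+k. f k \<partial>count_space ?X) = (\<integral>\<^sup>+i. f (IX (Suc i)) \<partial>count_space UNIV)"
    by (rule nn_integral_bij_count_space[symmetric]) (auto simp: bij_betw_def inj_on_def)
  also have "\<dots> = (\<Sum>i. f (IX (Suc i)))" by (rule nn_integral_count_space_nat)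
  also have "(\<integral>\<^sup>+k. f k \<partial>count_space ?Y) = (\<integral>\<^sup>+p. f ((\<lambda>(i, j). IY (Suc i) (Suc j)) p) \<partial>count_space UNIV)"
    by (rule nn_integral_bij_count_space[symmetric]) (auto simp: bij_betw_def inj_on_def)
  also have "\<dots> = (\<integral>\<^sup>+i. \<integral>\<^sup>+j. f (IY (Suc i) (Suc j)) \<partial>count_space UNIV \<partial>count_space UNIV)"
    by (subst nn_integral_fst_count_space[symmetric]) simp
  also have "\<dots> = (\<Sum>i. \<Sum>j. f (IY (Suc i) (Suc j)))" by (simp add: nn_integral_count_space_nat)
  finally show ?thesis by (simp add: claim_sum_def)
qed

lemma first_le_due:
  assumes nn: "\<And>k. k \<in> valid_idx \<Longrightarrow> 0 \<le> w k" and k: "k \<in> claims"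
  shows "w (IT 1) \<le> due w k"
proof -
  have "w (IT 1) \<le> arr w i" if "1 \<le> i" for i
    unfolding arr_def using that nn by (intro member_le_sum) (auto simp: valid_idx_def)
  moreover have "0 \<le> w (ID i j)" if "1 \<le> i" "1 \<le> j" for i j
    using that by (intro nn) (auto simp: valid_idx_def)
  ultimately show ?thesis using k by (fastforce simp: claims_def)
qed

section \<open>Tail estimates for fixed arrivals, offspring numbers and delays\<close>

context claim_model
begin

lemma ptail_long:
  assumes "0 \<le> h" "0 < e"
  shows "\<exists>x0. \<forall>k\<in>claims. \<forall>y\<ge>x0.
    \<P>(\<omega> in M. y - h < Z k \<omega>) \<le> \<P>(\<omega> in M. y < Z k \<omega>) + e * tbar y"
proof -
  obtain x1 where x1: "\<And>y. x1 \<le> y \<Longrightarrow> tbar (y - h) \<le> (1 + e) * tbar y"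
    using long_tailed[OF assms] by (auto simp: eventually_at_top_linorder)
  obtain x2 where x2: "\<And>y. x2 \<le> y \<Longrightarrow> Gb (y - h) \<le> Gb y + e * tbar y"
    using Gb_long[OF assms] by auto
  have "ptail k (y - h) \<le> ptail k y + e * tbar y" if "k \<in> claims" "max x1 x2 \<le> y" for k y
    using that x1[of y] x2[of y] by (auto simp: claims_def algebra_simps)
  then show ?thesis by (intro exI[of _ "max x1 x2"]) (simp add: ptail)
qed

lemma weights:
  assumes nn: "\<And>k. k \<in> valid_idx \<Longrightarrow> 0 \<le> w k" and t: "t \<le> T" and k: "k \<in> active t w"
  shows "exp (- r * T) \<le> exp (- r * (due w k - w (IT 1)))" "exp (- r * (due w k - w (IT 1))) \<le> 1"
proof -
  have kc: "k \<in> claims" and "due w k \<le> T" using k t by (auto simp: active_def)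
  moreover have "0 \<le> w (IT 1)" using nn[OF T_valid] by simp
  ultimately have "0 \<le> due w k - w (IT 1)" "due w k - w (IT 1) \<le> T" using first_le_due[OF nn kc] by auto
  then show "exp (- r * T) \<le> exp (- r * (due w k - w (IT 1)))" "exp (- r * (due w k - w (IT 1))) \<le> 1"
    using r by (auto intro: mult_left_mono)
qed

text \<open>The threshold for x precedes the configuration w, so the estimate can be integrated over
  w. Factoring out exp (- r \<tau>_1) moves the level from x to x exp (r \<tau>_1) \<ge> x, where
  the same threshold still applies.\<close>

lemma conditional_upper:
  fixes e s :: real
  assumes e: "0 < e" and s: "0 < s"
  shows "\<forall>\<^sub>F x in at_top. \<forall>t w. t \<le> T \<longrightarrow> (\<forall>k\<in>valid_idx. 0 \<le> w k) \<longrightarrow> finite (active t w) \<longrightarrow>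
    \<P>(\<omega> in M. x < (\<Sum>k\<in>active t w. exp (- r * due w k) * Z k \<omega>))
     \<le> (\<Sum>k\<in>active t w. ptail k (x * exp (r * due w k)))
       + e * exp (s * card (active t w)) * tbar (x * exp (r * w (IT 1)))"
proof -
  have indc: "M.indep_vars (\<lambda>_. borel) Z claims" by (rule M.indep_vars_subset[OF indep claims_drivers(2)])
  have tl: "\<P>(\<omega> in M. y < Z k \<omega>) \<le> C * tbar y" if "k \<in> claims" for k y
    using that by (simp add: ptail ptail_le)
  obtain x0 where x0: "\<forall>x\<ge>x0. \<forall>B u. finite B \<longrightarrow> B \<subseteq> claims \<longrightarrow> (\<forall>k\<in>B. exp (- r * T) \<le> u k \<and> u k \<le> 1) \<longrightarrow>
     \<P>(\<omega> in M. x < (\<Sum>k\<in>B. u k * Z k \<omega>))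
       \<le> (\<Sum>k\<in>B. \<P>(\<omega> in M. x < u k * Z k \<omega>)) + e * exp (s * card B) * tbar x"
    using weighted_sum_upper[OF M C _ indc tl ptail_long e s, of "exp (- r * T)"] by auto
  show ?thesis
    unfolding eventually_at_top_linorder
  proof (intro exI[of _ "max 0 x0"] allI impI)
    fix x t w assume x: "max 0 x0 \<le> x" and t: "t \<le> T" and nn': "\<forall>k\<in>valid_idx. 0 \<le> w k" and fin: "finite (active t w)"
    let ?B = "active t w" and ?u = "\<lambda>k. exp (- r * (due w k - w (IT 1)))" and ?y = "x * exp (r * w (IT 1))"
    have nn: "0 \<le> w k" if "k \<in> valid_idx" for k using nn' that by blast
    have y: "x0 \<le> ?y"
    proof -
      have "1 \<le> exp (r * w (IT 1))" using r nn[OF T_valid[of 1]] by simp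
      then have "x \<le> ?y" using x mult_left_mono[of 1 "exp (r * w (IT 1))" x] by simp
      then show ?thesis using x by simp
    qed
    have u: "?u k = exp (r * w (IT 1)) * exp (- r * due w k)" for k
      by (simp add: exp_add[symmetric] algebra_simps)
    have "{\<omega>\<in>space M. x < (\<Sum>k\<in>?B. exp (- r * due w k) * Z k \<omega>)} = {\<omega>\<in>space M. ?y < (\<Sum>k\<in>?B. ?u k * Z k \<omega>)}"
      unfolding u by (simp add: sum_distrib_left[symmetric] mult.assoc mult.commute[of x])
    moreover have "\<P>(\<omega> in M. ?y < (\<Sum>k\<in>?B. ?u k * Z k \<omega>))
       \<le> (\<Sum>k\<in>?B. \<P>(\<omega> in M. ?y < ?u k * Z k \<omega>)) + e * exp (s * card ?B) * tbar ?y"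
      by (rule x0[rule_format, OF y fin active_subset]) (use weights[OF nn t] in auto)
    moreover have "\<P>(\<omega> in M. ?y < ?u k * Z k \<omega>) = ptail k (x * exp (r * due w k))" if k: "k \<in> ?B" for k
    proof -
      have "?y < ?u k * z \<longleftrightarrow> x * exp (r * due w k) < z" for z
        unfolding u by (simp add: exp_minus field_simps)
      moreover have "k \<in> claims" using k active_subset by blast
      ultimately show ?thesis by (simp only: ptail)
    qed
    ultimately show "\<P>(\<omega> in M. x < (\<Sum>k\<in>?B. exp (- r * due w k) * Z k \<omega>))
     \<le> (\<Sum>k\<in>?B. ptail k (x * exp (r * due w k))) + e * exp (s * card ?B) * tbar ?y"
      by simp
  qed
qed

text \<open>Here smallness of the tail suffices: the pairwise intersections are quadratic in it, and
  the squared number of claims is absorbed by the exponential.\<close>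

lemma conditional_lower:
  fixes e s :: real
  assumes e: "0 < e" and s: "0 < s"
  shows "\<forall>\<^sub>F x in at_top. \<forall>t w. t \<le> T \<longrightarrow> (\<forall>k\<in>valid_idx. 0 \<le> w k) \<longrightarrow> finite (active t w) \<longrightarrow>
    (\<Sum>k\<in>active t w. ptail k (x * exp (r * due w k)))
     \<le> \<P>(\<omega> in M. \<exists>k\<in>active t w. x < exp (- r * due w k) * Z k \<omega>)
       + e * exp (s * card (active t w)) * tbar (x * exp (r * w (IT 1)))"
proof -
  \<comment> \<open>From s^2 n^2 \<le> 2 exp (s n): where the tail is at most e', C^2 n^2 times its
    square is at most e exp (s n) times the tail.\<close>
  define e' where "e' = e * s\<^sup>2 / (2 * C\<^sup>2)"
  have e': "0 < e'" using e s C by (auto simp: e'_def)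
  obtain h where h: "0 \<le> h" "tbar h \<le> e'" using small_level[OF e'] .
  show ?thesis
    unfolding eventually_at_top_linorder
  proof (intro exI[of _ h] allI impI)
    fix x t w assume x: "h \<le> x" and t: "t \<le> T" and nn': "\<forall>k\<in>valid_idx. 0 \<le> w k" and fin: "finite (active t w)"
    let ?B = "active t w" and ?u = "\<lambda>k. exp (- r * (due w k - w (IT 1)))" and ?y = "x * exp (r * w (IT 1))"
    have nn: "0 \<le> w k" if "k \<in> valid_idx" for k using nn' that by blast
    have y: "h \<le> ?y"
    proof -
      have "1 \<le> exp (r * w (IT 1))" using r nn[OF T_valid[of 1]] by simp
      then have "x \<le> ?y" using h x mult_left_mono[of 1 "exp (r * w (IT 1))" x] by simp
      then show ?thesis using x by simp
    qed
    have u: "?u k = exp (r * w (IT 1)) * exp (- r * due w k)" for k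
      by (simp add: exp_add[symmetric] algebra_simps)
    have Bv: "?B \<subseteq> valid_idx" using active_subset claims_drivers by blast
    have ind: "M.indep_vars (\<lambda>_. borel) (\<lambda>k \<omega>. ?u k * Z k \<omega>) ?B"
      by (intro M.indep_vars_compose2[where Y="\<lambda>k z. ?u k * z", OF M.indep_vars_subset[OF indep Bv]]) auto
    have eq: "?y < ?u k * z \<longleftrightarrow> x * exp (r * due w k) < z" for k z
      unfolding u by (simp add: exp_minus field_simps)
    have eq2: "?y < ?u k * z \<longleftrightarrow> x < exp (- r * due w k) * z" for k z
      unfolding u by (simp add: exp_minus field_simps)
    have pt: "\<P>(\<omega> in M. ?y < ?u k * Z k \<omega>) = ptail k (x * exp (r * due w k))" if k: "k \<in> ?B" for k
      unfolding eq using k active_subset by (intro ptail) blast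
    have q: "\<P>(\<omega> in M. ?y < ?u k * Z k \<omega>) \<le> C * tbar ?y" if k: "k \<in> ?B" for k
      using k Bv weights(2)[OF nn t k] active_subset
      by (intro weighted_tail_le M C Z_measurable) (auto simp: ptail ptail_le subset_eq)
    have "(\<Sum>k\<in>?B. \<P>(\<omega> in M. ?y < ?u k * Z k \<omega>))
      \<le> \<P>(\<omega> in M. \<exists>k\<in>?B. ?y < ?u k * Z k \<omega>) + (real (card ?B))\<^sup>2 * (C * tbar ?y)\<^sup>2"
      by (rule weighted_max_lower[OF M ind fin q])
    also have "(real (card ?B))\<^sup>2 * (C * tbar ?y)\<^sup>2 \<le> e * exp (s * card ?B) * tbar ?y"
    proof -
      have "(s * card ?B)\<^sup>2 / 2 \<le> exp (s * card ?B)"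
        using exp_lower_Taylor_quadratic[of "s * card ?B"] s by (simp add: field_simps) (smt (verit) mult_nonneg_nonneg of_nat_0_le_iff)
      then have 1: "(real (card ?B))\<^sup>2 * s\<^sup>2 \<le> 2 * exp (s * card ?B)" by (simp add: power_mult_distrib mult.commute)
      have 2: "tbar ?y \<le> e'" using h tbar_antimono[OF y] by simp
      have "(real (card ?B))\<^sup>2 * (C * tbar ?y)\<^sup>2 = ((real (card ?B))\<^sup>2 * C\<^sup>2 * tbar ?y) * tbar ?y"
        by (simp add: power2_eq_square)
      also have "\<dots> \<le> ((real (card ?B))\<^sup>2 * C\<^sup>2 * e') * tbar ?y"
        using 2 by (intro mult_right_mono mult_left_mono) auto
      also have "(real (card ?B))\<^sup>2 * C\<^sup>2 * e' = e * ((real (card ?B))\<^sup>2 * s\<^sup>2) / 2"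
        using C by (simp add: e'_def)
      also have "\<dots> * tbar ?y \<le> (e * exp (s * card ?B)) * tbar ?y"
        using mult_left_mono[OF 1, of e] e by (intro mult_right_mono) auto
      finally show ?thesis .
    qed
    finally show "(\<Sum>k\<in>?B. ptail k (x * exp (r * due w k)))
     \<le> \<P>(\<omega> in M. \<exists>k\<in>?B. x < exp (- r * due w k) * Z k \<omega>)
       + e * exp (s * card ?B) * tbar ?y"
      unfolding eq2 using pt[unfolded eq2] by (simp cong: sum.cong)
  qed
qed

section \<open>Integration over the drivers\<close>

lemma tbar_measurable [measurable]: "tbar \<in> borel_measurable borel"
  by (rule antimono_measurable[OF tbar_antimono])

lemma ptail_measurable: "k \<in> claims \<Longrightarrow> ptail k \<in> borel_measurable borel"
  by (rule antimono_measurable[OF ptail_antimono])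

definition first_fn :: "real \<Rightarrow> real \<Rightarrow> real \<Rightarrow> ennreal" where
  "first_fn x t z = ennreal (indicator {..t} z * tbar (x * exp (r * z)))"

lemma first_fn_measurable [measurable]: "first_fn x t \<in> borel_measurable borel"
  unfolding first_fn_def[abs_def] by measurable

definition first :: "real \<Rightarrow> real \<Rightarrow> ennreal" where
  "first x t = (\<integral>\<^sup>+\<omega>. first_fn x t (Z (IT 1) \<omega>) \<partial>M)"

definition claim_term :: "real \<Rightarrow> real \<Rightarrow> ridx \<Rightarrow> 'w \<Rightarrow> ennreal" where
  "claim_term x t k \<omega> = indicator (active t (W \<omega>)) k * ennreal (ptail k (x * exp (r * due (W \<omega>) k)))"

definition expected :: "real \<Rightarrow> real \<Rightarrow> ennreal" where
  "expected x t = (\<integral>\<^sup>+\<omega>. claim_sum (\<lambda>k. claim_term x t k \<omega>) \<partial>M)"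

text \<open>Restriction yields the extensional functions of which product spaces consist.
  \<open>active\<close>, and \<open>due\<close> on claims, read drivers only and are unaffected by
  it.\<close>

lemma restrict_drivers_measurable [measurable]: "(\<lambda>\<omega>. restrict (W \<omega>) drivers) \<in> measurable M driver_space"
  using claims_drivers by (intro measurable_restrict Z_measurable) auto

lemma restrict_claims_measurable [measurable]: "(\<lambda>\<omega>. restrict (W \<omega>) claims) \<in> measurable M claim_space"
  using claims_drivers by (intro measurable_restrict Z_measurable) auto

lemma active_restrict: "active t (restrict (W \<omega>) drivers) = active t (W \<omega>)"
  by (rule active_cong) simp

lemma due_restrict: "k \<in> claims \<Longrightarrow> due (restrict (W \<omega>) drivers) k = due (W \<omega>) k"
  by (rule due_cong) simp_all

lemma due_W_measurable:
  assumes "k \<in> claims"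
  shows "(\<lambda>\<omega>. due (W \<omega>) k) \<in> borel_measurable M"
  using measurable_compose[OF restrict_drivers_measurable due_measurable[OF assms]]
  by (simp add: due_restrict assms)

lemma active_W_measurable [measurable]: "Measurable.pred M (\<lambda>\<omega>. k \<in> active t (W \<omega>))"
  using measurable_compose[OF restrict_drivers_measurable active_mem_measurable[of k t]]
  by (simp add: active_restrict)

lemma claim_term_W_measurable:
  assumes "k \<in> claims"
  shows "(\<lambda>\<omega>. claim_term x t k \<omega>) \<in> borel_measurable M"
proof -
  note [measurable] = due_W_measurable[OF assms] ptail_measurable[OF assms]
  have "(\<lambda>\<omega>. (if k \<in> active t (W \<omega>) then 1 else 0) * ennreal (ptail k (x * exp (r * due (W \<omega>) k)))) \<in> borel_measurable M"
    by measurable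
  then show ?thesis by (simp add: claim_term_def indicator_def of_bool_def)
qed

lemma claims_Suc [simp]: "IX (Suc i) \<in> claims" "IY (Suc i) (Suc j) \<in> claims"
  by (auto simp: claims_def)

lemma claim_sum_measurable [measurable]: "(\<lambda>\<omega>. claim_sum (\<lambda>k. claim_term x t k \<omega>)) \<in> borel_measurable M"
  unfolding claim_sum_def by (intro borel_measurable_add borel_measurable_suminf_order claim_term_W_measurable claims_Suc)

lemma claim_sum_active:
  assumes "finite (active t (W \<omega>))"
  shows "claim_sum (\<lambda>k. claim_term x t k \<omega>) = ennreal (\<Sum>k\<in>active t (W \<omega>). ptail k (x * exp (r * due (W \<omega>) k)))"
proof -
  have "claim_sum (\<lambda>k. claim_term x t k \<omega>) = (\<Sum>k\<in>active t (W \<omega>). claim_term x t k \<omega>)"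
    by (rule claim_sum_finite[OF assms active_subset]) (simp add: claim_term_def)
  also have "\<dots> = (\<Sum>k\<in>active t (W \<omega>). ennreal (ptail k (x * exp (r * due (W \<omega>) k))))"
    by (intro sum.cong) (auto simp: claim_term_def)
  also have "\<dots> = ennreal (\<Sum>k\<in>active t (W \<omega>). ptail k (x * exp (r * due (W \<omega>) k)))"
    using active_subset ptail_nonneg by (intro sum_ennreal) blast
  finally show ?thesis .
qed

lemma finite_active:
  assumes "finite {i. arr (W \<omega>) i \<le> T}" "t \<le> T"
  shows "finite (active t (W \<omega>))"
  using card_active_le[OF nonneg assms] by (cases "active t (W \<omega>) = {}") auto

text \<open>An active claim forces \<tau>_1 \<le> t, so the indicator inside \<open>first_fn\<close>
  equals 1 and can be inserted for free. This makes the integrated error proportional to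
  \<open>first\<close>.\<close>

lemma error_term_le:
  assumes fin: "finite {i. arr (W \<omega>) i \<le> T}" and t: "t \<le> T" and s: "0 < s" and e: "0 \<le> e"
    and ne: "active t (W \<omega>) \<noteq> {}"
  shows "ennreal (e * exp (s * real (card (active t (W \<omega>)))) * tbar (x * exp (r * Z (IT 1) \<omega>)))
    \<le> ennreal e * (first_fn x t (Z (IT 1) \<omega>) * total_growth s \<omega>)"
proof -
  obtain k where k: "k \<in> active t (W \<omega>)" using ne by blast
  then have kc: "k \<in> claims" and "due (W \<omega>) k \<le> t" by (auto simp: active_def)
  moreover have "Z (IT 1) \<omega> \<le> due (W \<omega>) k" by (rule first_le_due[OF nonneg kc])
  ultimately have "Z (IT 1) \<omega> \<le> t" by linarith
  then have 1: "first_fn x t (Z (IT 1) \<omega>) = ennreal (tbar (x * exp (r * Z (IT 1) \<omega>)))"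
    by (simp add: first_fn_def)
  have "ennreal (e * exp (s * real (card (active t (W \<omega>)))) * tbar (x * exp (r * Z (IT 1) \<omega>)))
     = ennreal e * (first_fn x t (Z (IT 1) \<omega>) * ennreal (exp (s * real (card (active t (W \<omega>))))))"
    unfolding 1 using e by (simp add: ennreal_mult' ennreal_mult'' mult_ac)
  also have "\<dots> \<le> ennreal e * (first_fn x t (Z (IT 1) \<omega>) * total_growth s \<omega>)"
    using exp_card_active_le[OF nonneg fin t ne] s by (intro mult_left_mono) auto
  finally show ?thesis .
qed

lemma error_expectation_le:
  assumes dom: "dominated s \<Gamma>" and e: "0 < e"
  shows "(\<integral>\<^sup>+\<omega>. ennreal (e / \<Gamma>) * (first_fn x t (Z (IT 1) \<omega>) * total_growth s \<omega>) \<partial>M)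
    \<le> ennreal e * first x t"
proof -
  note [measurable] = growth_measurable
  have \<Gamma>: "0 < \<Gamma>" using dom by (simp add: dominated_def)
  have "(\<integral>\<^sup>+\<omega>. ennreal (e / \<Gamma>) * (first_fn x t (Z (IT 1) \<omega>) * total_growth s \<omega>) \<partial>M)
    = ennreal (e / \<Gamma>) * (\<integral>\<^sup>+\<omega>. first_fn x t (Z (IT 1) \<omega>) * total_growth s \<omega> \<partial>M)"
    by (intro nn_integral_cmult) measurable
  also have "\<dots> \<le> ennreal (e / \<Gamma>) * (ennreal \<Gamma> * first x t)"
    unfolding first_def using dom by (intro mult_left_mono) (auto simp: dominated_def)
  also have "\<dots> = ennreal e * first x t"
    using \<Gamma> e by (simp add: mult.assoc[symmetric] ennreal_mult''[symmetric])
  finally show ?thesis .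
qed

lemma indep_drivers_claims:
  "M.indep_var driver_space (\<lambda>\<omega>. restrict (W \<omega>) drivers) claim_space (\<lambda>\<omega>. restrict (W \<omega>) claims)"
  using claims_drivers by (intro M.indep_var_restrict[OF indep]) auto

text \<open>Finiteness is part of the event because measurability is obtained by running through the
  finite index sets; for t \<le> T it holds almost surely.\<close>

definition claim_prob :: "real \<Rightarrow> (ridx set \<Rightarrow> (ridx \<Rightarrow> real) \<Rightarrow> (ridx \<Rightarrow> real) \<Rightarrow> bool) \<Rightarrow> ennreal" where
  "claim_prob t Q = emeasure M {\<omega>\<in>space M. finite (active t (W \<omega>)) \<and> Q (active t (W \<omega>)) (W \<omega>) (W \<omega>)}"

abbreviation "sum_prob x t \<equiv> claim_prob t (sum_exceeds r x)"
abbreviation "max_prob x t \<equiv> claim_prob t (max_exceeds r x)"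

text \<open>Drivers and claims are independent, so the drivers may be frozen at \<omega> while the
  claims are drawn at \<omega>'. The premise \<open>Q\<close> says that the event reads drivers from
  its first vector and claims from its second one, so restriction does not change it.\<close>

lemma conditioning:
  assumes E: "claim_event t Q \<in> sets model_space"
    and Q: "\<And>\<omega> \<omega>'. Q (active t (W \<omega>)) (restrict (W \<omega>) drivers) (restrict (W \<omega>') claims) \<longleftrightarrow> Q (active t (W \<omega>)) (W \<omega>) (W \<omega>')"
  shows "claim_prob t Q = (\<integral>\<^sup>+\<omega>. emeasure M {\<omega>'\<in>space M. finite (active t (W \<omega>)) \<and> Q (active t (W \<omega>)) (W \<omega>) (W \<omega>')} \<partial>M)"
    and "(\<lambda>\<omega>. emeasure M {\<omega>'\<in>space M. finite (active t (W \<omega>)) \<and> Q (active t (W \<omega>)) (W \<omega>) (W \<omega>')}) \<in> borel_measurable M"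
    and "{\<omega>\<in>space M. finite (active t (W \<omega>)) \<and> Q (active t (W \<omega>)) (W \<omega>) (W \<omega>)} \<in> sets M"
proof -
  note [measurable] = E
  have mem: "(restrict (W \<omega>) drivers, restrict (W \<omega>') claims) \<in> claim_event t Q \<longleftrightarrow>
    finite (active t (W \<omega>)) \<and> Q (active t (W \<omega>)) (W \<omega>) (W \<omega>')" for \<omega> \<omega>'
    by (simp add: claim_event_def active_restrict space_pair_measure space_PiM Q)
  show "claim_prob t Q = (\<integral>\<^sup>+\<omega>. emeasure M {\<omega>'\<in>space M. finite (active t (W \<omega>)) \<and> Q (active t (W \<omega>)) (W \<omega>) (W \<omega>')} \<partial>M)"
    using M.indep_var_Fubini[OF indep_drivers_claims E] by (simp only: mem claim_prob_def)
  let ?Q = "{p \<in> space (M \<Otimes>\<^sub>M M). (restrict (W (fst p)) drivers, restrict (W (snd p)) claims) \<in> claim_event t Q}"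
  have "?Q \<in> sets (M \<Otimes>\<^sub>M M)" by measurable
  then have "(\<lambda>\<omega>. emeasure M (Pair \<omega> -` ?Q)) \<in> borel_measurable M" by (rule M.measurable_emeasure_Pair)
  moreover have "Pair \<omega> -` ?Q = {\<omega>'\<in>space M. finite (active t (W \<omega>)) \<and> Q (active t (W \<omega>)) (W \<omega>) (W \<omega>')}" if "\<omega> \<in> space M" for \<omega>
    using that by (auto simp: space_pair_measure mem)
  ultimately show "(\<lambda>\<omega>. emeasure M {\<omega>'\<in>space M. finite (active t (W \<omega>)) \<and> Q (active t (W \<omega>)) (W \<omega>) (W \<omega>')}) \<in> borel_measurable M"
    by (simp cong: measurable_cong)
  have "{\<omega>\<in>space M. (restrict (W \<omega>) drivers, restrict (W \<omega>) claims) \<in> claim_event t Q} \<in> sets M" by measurable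
  then show "{\<omega>\<in>space M. finite (active t (W \<omega>)) \<and> Q (active t (W \<omega>)) (W \<omega>) (W \<omega>)} \<in> sets M" by (simp only: mem)
qed

lemma sum_exceeds_restrict: "sum_exceeds r x (active t (W \<omega>)) (restrict (W \<omega>) drivers) (restrict (W \<omega>') claims) \<longleftrightarrow>
    sum_exceeds r x (active t (W \<omega>)) (W \<omega>) (W \<omega>')"
  by (intro arg_cong[where f="\<lambda>z. x < z"] sum.cong refl) (use active_subset[of t "W \<omega>"] in \<open>auto simp: due_restrict subset_eq\<close>)

lemma max_exceeds_restrict: "max_exceeds r x (active t (W \<omega>)) (restrict (W \<omega>) drivers) (restrict (W \<omega>') claims) \<longleftrightarrow>
    max_exceeds r x (active t (W \<omega>)) (W \<omega>) (W \<omega>')"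
  by (intro bex_cong refl) (use active_subset[of t "W \<omega>"] in \<open>auto simp: due_restrict subset_eq\<close>)

lemmas sum_conditioning = conditioning[where Q = "sum_exceeds r x" for x, OF sum_event_sets sum_exceeds_restrict]
lemmas max_conditioning = conditioning[where Q = "max_exceeds r x" for x, OF max_event_sets max_exceeds_restrict]

theorem sum_prob_upper:
  assumes e: "0 < e"
  shows "\<forall>\<^sub>F x in at_top. \<forall>t\<le>T. sum_prob x t \<le> expected x t + ennreal e * first x t"
proof -
  obtain s \<Gamma> where dom: "dominated s \<Gamma>" using moment_bound by blast
  then have s: "0 < s" and \<Gamma>: "0 < \<Gamma>" by (auto simp: dominated_def)
  \<comment> \<open>Integration multiplies the conditional error by at most \<Gamma>, so e /
    \<Gamma> is requested from the conditional bound.\<close>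
  have e\<Gamma>: "0 < e / \<Gamma>" using e \<Gamma> by simp
  show ?thesis using conditional_upper[OF e\<Gamma> s] eventually_ge_at_top[of 0]
  proof eventually_elim
    case prems: (elim x)
    show ?case
    proof (intro allI impI, goal_cases)
      case hyp: (1 t)
      then have t: "t \<le> T" by simp
      note [measurable] = growth_measurable
      let ?err = "\<lambda>\<omega>. ennreal (e / \<Gamma>) * (first_fn x t (Z (IT 1) \<omega>) * total_growth s \<omega>)"
      have "sum_prob x t \<le> (\<integral>\<^sup>+\<omega>. claim_sum (\<lambda>k. claim_term x t k \<omega>) + ?err \<omega> \<partial>M)"
        unfolding sum_conditioning(1)
      proof (rule nn_integral_mono_AE, use th_fin in eventually_elim)
        case (elim \<omega>)
        have fin: "finite (active t (W \<omega>))" by (rule finite_active[OF elim t])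
        let ?p = "\<Sum>k\<in>active t (W \<omega>). ptail k (x * exp (r * due (W \<omega>) k))"
        show ?case
        proof (cases "active t (W \<omega>) = {}")
          \<comment> \<open>The empty sum is 0 and cannot exceed x \<ge> 0; no arrival by t is
            available here to bound an error term.\<close>
          case True
          then show ?thesis using prems by simp
        next
          case False
          have p: "0 \<le> ?p" using active_subset ptail_nonneg by (intro sum_nonneg) blast
          have "emeasure M {\<omega>'\<in>space M. finite (active t (W \<omega>)) \<and>
             x < (\<Sum>k\<in>active t (W \<omega>). exp (- r * due (W \<omega>) k) * Z k \<omega>')}
            = ennreal (\<P>(\<omega>' in M. x < (\<Sum>k\<in>active t (W \<omega>). exp (- r * due (W \<omega>) k) * Z k \<omega>')))"
            using fin by (simp add: M.emeasure_eq_measure)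
          also have "\<dots> \<le> ennreal (?p + e / \<Gamma> * exp (s * card (active t (W \<omega>))) * tbar (x * exp (r * Z (IT 1) \<omega>)))"
            using prems(1)[rule_format, of t "W \<omega>"] t nonneg fin by (intro ennreal_leI) auto
          also have "\<dots> = ennreal ?p + ennreal (e / \<Gamma> * exp (s * card (active t (W \<omega>))) * tbar (x * exp (r * Z (IT 1) \<omega>)))"
            using p e \<Gamma> by (intro ennreal_plus) auto
          also have "\<dots> \<le> claim_sum (\<lambda>k. claim_term x t k \<omega>) + ?err \<omega>"
            unfolding claim_sum_active[OF fin] using e\<Gamma>
            by (intro add_left_mono error_term_le[OF elim t s _ False]) auto
          finally show ?thesis .
        qed
      qed
      also have "\<dots> = expected x t + (\<integral>\<^sup>+\<omega>. ?err \<omega> \<partial>M)"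
        unfolding expected_def by (rule nn_integral_add) measurable
      also have "\<dots> \<le> expected x t + ennreal e * first x t"
        by (intro add_left_mono error_expectation_le[OF dom e])
      finally show "sum_prob x t \<le> expected x t + ennreal e * first x t" .
    qed
  qed
qed

theorem max_prob_lower:
  assumes e: "0 < e"
  shows "\<forall>\<^sub>F x in at_top. \<forall>t\<le>T. expected x t \<le> max_prob x t + ennreal e * first x t"
proof -
  obtain s \<Gamma> where dom: "dominated s \<Gamma>" using moment_bound by blast
  then have s: "0 < s" and \<Gamma>: "0 < \<Gamma>" by (auto simp: dominated_def)
  have e\<Gamma>: "0 < e / \<Gamma>" using e \<Gamma> by simp
  show ?thesis using conditional_lower[OF e\<Gamma> s]
  proof eventually_elim
    case prems: (elim x)
    show ?case
    proof (intro allI impI, goal_cases)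
      case hyp: (1 t)
      then have t: "t \<le> T" by simp
      note [measurable] = growth_measurable max_conditioning(2)
      let ?err = "\<lambda>\<omega>. ennreal (e / \<Gamma>) * (first_fn x t (Z (IT 1) \<omega>) * total_growth s \<omega>)"
      let ?max = "\<lambda>\<omega>. emeasure M {\<omega>'\<in>space M. finite (active t (W \<omega>)) \<and>
       (\<exists>k\<in>active t (W \<omega>). x < exp (- r * due (W \<omega>) k) * Z k \<omega>')}"
      have "expected x t \<le> (\<integral>\<^sup>+\<omega>. ?max \<omega> + ?err \<omega> \<partial>M)"
        unfolding expected_def
      proof (rule nn_integral_mono_AE, use th_fin in eventually_elim)
        case (elim \<omega>)
        have fin: "finite (active t (W \<omega>))" by (rule finite_active[OF elim t])
        show ?case
        proof (cases "active t (W \<omega>) = {}")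
          case True
          then show ?thesis unfolding claim_sum_active[OF fin] by simp
        next
          case False
          have "claim_sum (\<lambda>k. claim_term x t k \<omega>)
            \<le> ennreal (\<P>(\<omega>' in M. \<exists>k\<in>active t (W \<omega>). x < exp (- r * due (W \<omega>) k) * Z k \<omega>')
               + e / \<Gamma> * exp (s * card (active t (W \<omega>))) * tbar (x * exp (r * Z (IT 1) \<omega>)))"
            unfolding claim_sum_active[OF fin]
            using prems(1)[rule_format, of t "W \<omega>"] t nonneg fin by (intro ennreal_leI) auto
          also have "\<dots> = ennreal (\<P>(\<omega>' in M. \<exists>k\<in>active t (W \<omega>). x < exp (- r * due (W \<omega>) k) * Z k \<omega>'))
               + ennreal (e / \<Gamma> * exp (s * card (active t (W \<omega>))) * tbar (x * exp (r * Z (IT 1) \<omega>)))"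
            using e \<Gamma> by (intro ennreal_plus) auto
          also have "\<dots> \<le> ?max \<omega> + ?err \<omega>"
            using e\<Gamma> fin
            by (intro add_mono error_term_le[OF elim t s _ False]) (auto simp: M.emeasure_eq_measure)
          finally show ?thesis .
        qed
      qed
      also have "\<dots> = max_prob x t + (\<integral>\<^sup>+\<omega>. ?err \<omega> \<partial>M)"
        unfolding max_conditioning(1) by (rule nn_integral_add) measurable
      also have "\<dots> \<le> max_prob x t + ennreal e * first x t"
        by (intro add_left_mono error_expectation_le[OF dom e])
      finally show "expected x t \<le> max_prob x t + ennreal e * first x t" .
    qed
  qed
qed

section \<open>Main and delayed claims separately\<close>

definition expected_main :: "real \<Rightarrow> real \<Rightarrow> ennreal" where
  "expected_main x t = (\<integral>\<^sup>+\<omega>. (\<Sum>i. claim_term x t (IX (Suc i)) \<omega>) \<partial>M)"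

definition expected_delayed :: "real \<Rightarrow> real \<Rightarrow> ennreal" where
  "expected_delayed x t = (\<integral>\<^sup>+\<omega>. (\<Sum>i. \<Sum>j. claim_term x t (IY (Suc i) (Suc j)) \<omega>) \<partial>M)"

lemma expected_split: "expected x t = expected_main x t + expected_delayed x t"
  unfolding expected_def expected_main_def expected_delayed_def claim_sum_def
  by (intro nn_integral_add borel_measurable_suminf_order claim_term_W_measurable claims_Suc)

text \<open>Each active delayed claim costs a small multiple of the tail at x exp (r \<tau>_1), and
  the number c of active claims satisfies s c \<le> exp (s c). So the delayed part fits into the
  error term that \<open>dominated\<close> already controls; the factor s in the choice of x0 pays
  for the count.\<close>

theorem delayed_negligible:
  assumes e: "0 < e" and small: "\<forall>e>0. \<exists>x0. \<forall>y\<ge>x0. Gb y \<le> e * tbar y"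
  shows "\<forall>\<^sub>F x in at_top. \<forall>t\<le>T. expected_delayed x t \<le> ennreal e * first x t"
proof -
  obtain s \<Gamma> where dom: "dominated s \<Gamma>" using moment_bound by blast
  then have s: "0 < s" and \<Gamma>: "0 < \<Gamma>" by (auto simp: dominated_def)
  have e\<Gamma>: "0 < e / \<Gamma>" using e \<Gamma> by simp
  have "0 < e / \<Gamma> * s" using e \<Gamma> s by simp
  then obtain x0 where x0: "\<And>y. x0 \<le> y \<Longrightarrow> Gb y \<le> e / \<Gamma> * s * tbar y" using small by blast
  show ?thesis unfolding eventually_at_top_linorder
  proof (intro exI[of _ "max 0 x0"] allI impI)
    fix x t assume x: "max 0 x0 \<le> x" and t: "t \<le> T"
    let ?err = "\<lambda>\<omega>. ennreal (e / \<Gamma>) * (first_fn x t (Z (IT 1) \<omega>) * total_growth s \<omega>)"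
    have "expected_delayed x t \<le> (\<integral>\<^sup>+\<omega>. ?err \<omega> \<partial>M)"
      unfolding expected_delayed_def
    proof (rule nn_integral_mono_AE, use th_fin in eventually_elim)
      case (elim \<omega>)
      have fin: "finite (active t (W \<omega>))" by (rule finite_active[OF elim t])
      let ?y = "x * exp (r * Z (IT 1) \<omega>)"
      define f where "f k = (case k of IY i j \<Rightarrow> claim_term x t k \<omega> | _ \<Rightarrow> 0)" for k
      have "(\<Sum>i. \<Sum>j. claim_term x t (IY (Suc i) (Suc j)) \<omega>) = claim_sum f"
        by (simp add: claim_sum_def f_def)
      also have "\<dots> = (\<Sum>k\<in>active t (W \<omega>). f k)"
        by (rule claim_sum_finite[OF fin active_subset]) (auto simp: f_def claim_term_def split: ridx.split)
      also have "\<dots> \<le> (\<Sum>k\<in>active t (W \<omega>). ennreal (e / \<Gamma> * s * tbar ?y))"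
      proof (rule sum_mono)
        fix k assume k: "k \<in> active t (W \<omega>)"
        then have kc: "k \<in> claims" using active_subset by blast
        have Z1: "Z (IT 1) \<omega> \<le> due (W \<omega>) k" by (rule first_le_due[OF nonneg kc])
        have Z0: "0 \<le> Z (IT 1) \<omega>" by (intro nonneg T_valid) simp
        have "1 \<le> exp (r * due (W \<omega>) k)" using r Z0 Z1 by (simp add: mult_nonneg_nonneg)
        then have "x \<le> x * exp (r * due (W \<omega>) k)"
          using x mult_left_mono[of 1 "exp (r * due (W \<omega>) k)" x] by simp
        then have "Gb (x * exp (r * due (W \<omega>) k)) \<le> e / \<Gamma> * s * tbar (x * exp (r * due (W \<omega>) k))"
          using x by (intro x0) auto
        also have "\<dots> \<le> e / \<Gamma> * s * tbar ?y"
          using x r Z1 e \<Gamma> s by (intro mult_left_mono tbar_antimono) (auto intro: mult_left_mono)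
        finally show "f k \<le> ennreal (e / \<Gamma> * s * tbar ?y)"
          using k by (auto simp: f_def claim_term_def ennreal_leI split: ridx.split)
      qed
      also have "\<dots> = ennreal (real (card (active t (W \<omega>))) * (e / \<Gamma> * s * tbar ?y))"
        using e\<Gamma> s by (simp add: ennreal_of_nat_eq_real_of_nat ennreal_mult'' [symmetric] ennreal_mult'[symmetric])
      also have "\<dots> \<le> ?err \<omega>"
      proof (cases "active t (W \<omega>) = {}")
        case False
        let ?c = "real (card (active t (W \<omega>)))"
        have "s * ?c \<le> exp (s * ?c)" using exp_ge_add_one_self[of "s * ?c"] by linarith
        then have "e / \<Gamma> * (s * ?c) * tbar ?y \<le> e / \<Gamma> * exp (s * ?c) * tbar ?y"
          using e\<Gamma> by (intro mult_right_mono mult_left_mono) auto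
        then have "?c * (e / \<Gamma> * s * tbar ?y) \<le> e / \<Gamma> * exp (s * ?c) * tbar ?y" by (simp add: mult_ac)
        then have "ennreal (?c * (e / \<Gamma> * s * tbar ?y)) \<le> ennreal (e / \<Gamma> * exp (s * ?c) * tbar ?y)" by (rule ennreal_leI)
        also have "\<dots> \<le> ?err \<omega>" using e\<Gamma> by (intro error_term_le[OF elim t s _ False]) auto
        finally show ?thesis .
      qed simp
      finally show ?case .
    qed
    also have "\<dots> \<le> ennreal e * first x t" by (rule error_expectation_le[OF dom e])
    finally show "expected_delayed x t \<le> ennreal e * first x t" .
  qed
qed

lemma Gb_measurable [measurable]: "Gb \<in> borel_measurable borel"
proof -
  have "ptail (IY (Suc 0) (Suc 0)) \<in> borel_measurable borel" by (rule ptail_measurable) simp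
  then show ?thesis by (simp add: fun_eq_iff cong: measurable_cong)
qed

lemma arr_W_measurable [measurable]: "(\<lambda>\<omega>. arr (W \<omega>) i) \<in> borel_measurable M"
  unfolding arr_def by (intro borel_measurable_sum Z_measurable T_valid) auto

lemma arr_W_nonneg: "0 \<le> arr (W \<omega>) i"
  unfolding arr_def by (intro sum_nonneg nonneg T_valid) auto

lemma expected_main_eq:
  "expected_main x t = (\<Sum>i. \<integral>\<^sup>+\<omega>. indicator {0..t} (arr (W \<omega>) (Suc i)) * ennreal (tbar (x * exp (r * arr (W \<omega>) (Suc i)))) \<partial>M)"
proof -
  have "expected_main x t = (\<Sum>i. \<integral>\<^sup>+\<omega>. claim_term x t (IX (Suc i)) \<omega> \<partial>M)"
    unfolding expected_main_def by (intro nn_integral_suminf claim_term_W_measurable claims_Suc)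
  also have "\<dots> = (\<Sum>i. \<integral>\<^sup>+\<omega>. indicator {0..t} (arr (W \<omega>) (Suc i)) * ennreal (tbar (x * exp (r * arr (W \<omega>) (Suc i)))) \<partial>M)"
    using arr_W_nonneg
    by (intro suminf_cong nn_integral_cong) (auto simp: claim_term_def active_def indicator_def)
  finally show ?thesis .
qed

definition delayed_fn :: "real \<Rightarrow> real \<Rightarrow> real \<Rightarrow> real \<Rightarrow> ennreal" where
  "delayed_fn x t s y = indicator {0..t} s * (indicator {0..t - s} y * ennreal (Gb (x * exp (r * (s + y)))))"

lemma delayed_fn_measurable [measurable]: "(\<lambda>p. delayed_fn x t (fst p) (snd p)) \<in> borel_measurable (borel \<Otimes>\<^sub>M borel)"
proof -
  have "(\<lambda>p. (if 0 \<le> fst p \<and> fst p \<le> t \<and> 0 \<le> snd p \<and> snd p \<le> t - fst p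
      then ennreal (Gb (x * exp (r * (fst p + snd p)))) else 0)) \<in> borel_measurable (borel \<Otimes>\<^sub>M borel)"
    by measurable
  also have "(\<lambda>p. (if 0 \<le> fst p \<and> fst p \<le> t \<and> 0 \<le> snd p \<and> snd p \<le> t - fst p
      then ennreal (Gb (x * exp (r * (fst p + snd p)))) else 0)) = (\<lambda>p. delayed_fn x t (fst p) (snd p))"
    by (auto simp: delayed_fn_def fun_eq_iff indicator_def)
  finally show ?thesis .
qed

text \<open>Independence is used twice: the delay is split off from the offspring number and the
  gaps, then the offspring number from the gaps. The sum of P(M \<ge> j) over j \<ge> 1 that comes
  out is later recognised as E[M].\<close>

lemma expected_delayed_eq:
  assumes H: "\<And>i j. 1 \<le> i \<Longrightarrow> 1 \<le> j \<Longrightarrow> distr M borel (Z (ID i j)) = H"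
  shows "expected_delayed x t = (\<Sum>j. \<integral>\<^sup>+\<omega>. indicator {real (Suc j)..} (Z (IM 1) \<omega>) \<partial>M) *
    (\<Sum>i. \<integral>\<^sup>+\<omega>. \<integral>\<^sup>+y. delayed_fn x t (arr (W \<omega>) (Suc i)) y \<partial>H \<partial>M)"
proof -
  have summand: "(\<integral>\<^sup>+\<omega>. claim_term x t (IY i j) \<omega> \<partial>M) =
      (\<integral>\<^sup>+\<omega>. indicator {real j..} (Z (IM 1) \<omega>) \<partial>M) * (\<integral>\<^sup>+\<omega>. \<integral>\<^sup>+y. delayed_fn x t (arr (W \<omega>) i) y \<partial>H \<partial>M)"
    if i: "1 \<le> i" and j: "1 \<le> j" for i j
  proof -
    have valid: "IM i \<in> valid_idx" "ID i j \<in> valid_idx" "IT ` {1..i} \<subseteq> valid_idx"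
      using i j by (auto simp: valid_idx_def)
    note [measurable] = Z_measurable[OF valid(1)] Z_measurable[OF valid(2)]
    interpret H: prob_space H unfolding H[OF i j, symmetric] by (rule M.prob_space_distr) simp
    have sets_H [measurable_cong]: "sets H = sets borel" unfolding H[OF i j, symmetric] by simp
    have arr_comp: "(\<lambda>w. arr w i) \<in> borel_measurable (PiM J (\<lambda>_. borel :: real measure))" if "IT ` {1..i} \<subseteq> J" for J
      unfolding arr_def using that by (intro borel_measurable_sum measurable_component_singleton) auto
    have arr_restr: "arr (restrict (W \<omega>) J) i = arr (W \<omega>) i" if "IT ` {1..i} \<subseteq> J" for J \<omega>
      unfolding arr_def using that by (intro sum.cong) (auto simp: subset_eq)
    define \<psi> where "\<psi> s = (\<integral>\<^sup>+y. delayed_fn x t s y \<partial>H)" for s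
    have \<psi>_meas [measurable]: "\<psi> \<in> borel_measurable borel"
    proof -
      have "(\<lambda>(s, y). delayed_fn x t s y) \<in> borel_measurable (borel \<Otimes>\<^sub>M H)"
        using delayed_fn_measurable[of x t] by (simp add: case_prod_beta' cong: measurable_cong_sets sets_pair_measure_cong)
      then show ?thesis unfolding \<psi>_def[abs_def] by (rule H.borel_measurable_nn_integral)
    qed
    let ?B = "insert (IM i) (IT ` {1..i})"
    have ind1: "M.indep_var (PiM ?B (\<lambda>_. borel)) (\<lambda>\<omega>. restrict (W \<omega>) ?B) (PiM {ID i j} (\<lambda>_. borel)) (\<lambda>\<omega>. restrict (W \<omega>) {ID i j})"
      using valid by (intro M.indep_var_restrict[OF indep]) auto
    have ind2: "M.indep_var (PiM {IM i} (\<lambda>_. borel)) (\<lambda>\<omega>. restrict (W \<omega>) {IM i}) (PiM (IT ` {1..i}) (\<lambda>_. borel)) (\<lambda>\<omega>. restrict (W \<omega>) (IT ` {1..i}))"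
      using valid by (intro M.indep_var_restrict[OF indep]) auto
    define f where "f p = indicator {real j..} (fst p (IM i)) * delayed_fn x t (arr (fst p) i) (snd p (ID i j))"
      for p :: "(ridx \<Rightarrow> real) \<times> (ridx \<Rightarrow> real)"
    define g where "g p = indicator {real j..} (fst p (IM i)) * \<psi> (arr (snd p) i)"
      for p :: "(ridx \<Rightarrow> real) \<times> (ridx \<Rightarrow> real)"
    have f_meas: "f \<in> borel_measurable (PiM ?B (\<lambda>_. borel) \<Otimes>\<^sub>M PiM {ID i j} (\<lambda>_. borel))"
    proof -
      have [measurable]: "(\<lambda>w. arr w i) \<in> borel_measurable (PiM ?B (\<lambda>_. borel :: real measure))"
        "(\<lambda>w. w (IM i)) \<in> borel_measurable (PiM ?B (\<lambda>_. borel :: real measure))"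
        "(\<lambda>w. w (ID i j)) \<in> borel_measurable (PiM {ID i j} (\<lambda>_. borel :: real measure))"
        by (auto intro!: arr_comp measurable_component_singleton)
      have m: "(\<lambda>p. (arr (fst p) i, snd p (ID i j))) \<in> measurable (PiM ?B (\<lambda>_. borel) \<Otimes>\<^sub>M PiM {ID i j} (\<lambda>_. borel)) (borel \<Otimes>\<^sub>M borel)"
        by measurable
      have [measurable]: "(\<lambda>p. delayed_fn x t (arr (fst p) i) (snd p (ID i j))) \<in> borel_measurable (PiM ?B (\<lambda>_. borel) \<Otimes>\<^sub>M PiM {ID i j} (\<lambda>_. borel))"
        using measurable_compose[OF m delayed_fn_measurable[of x t]] by simp
      show ?thesis unfolding f_def[abs_def] by measurable
    qed
    have g_meas: "g \<in> borel_measurable (PiM {IM i} (\<lambda>_. borel) \<Otimes>\<^sub>M PiM (IT ` {1..i}) (\<lambda>_. borel))"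
    proof -
      have [measurable]: "(\<lambda>w. arr w i) \<in> borel_measurable (PiM (IT ` {1..i}) (\<lambda>_. borel :: real measure))"
        "(\<lambda>w. w (IM i)) \<in> borel_measurable (PiM {IM i} (\<lambda>_. borel :: real measure))"
        by (auto intro!: arr_comp measurable_component_singleton)
      show ?thesis unfolding g_def[abs_def] by measurable
    qed
    have nnD: "0 \<le> Z (ID i j) \<omega>" for \<omega> by (rule nonneg[OF valid(2)])
    have f_eq: "f (restrict (W \<omega>) ?B, restrict (W \<omega>') {ID i j}) =
        indicator {real j..} (Z (IM i) \<omega>) * delayed_fn x t (arr (W \<omega>) i) (Z (ID i j) \<omega>')" for \<omega> \<omega>'
      unfolding f_def by (simp add: arr_restr subset_insertI)
    have g_eq: "g (restrict (W \<omega>) {IM i}, restrict (W \<omega>') (IT ` {1..i})) =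
        indicator {real j..} (Z (IM i) \<omega>) * \<psi> (arr (W \<omega>') i)" for \<omega> \<omega>'
      unfolding g_def by (simp add: arr_restr)
    have "(\<integral>\<^sup>+\<omega>. claim_term x t (IY i j) \<omega> \<partial>M) = (\<integral>\<^sup>+\<omega>. f (restrict (W \<omega>) ?B, restrict (W \<omega>) {ID i j}) \<partial>M)"
    proof (intro nn_integral_cong)
      fix \<omega>
      show "claim_term x t (IY i j) \<omega> = f (restrict (W \<omega>) ?B, restrict (W \<omega>) {ID i j})"
        unfolding f_eq using arr_W_nonneg[of \<omega> i] nnD[of \<omega>] i j
        by (auto simp: claim_term_def delayed_fn_def active_def claims_def indicator_def)
    qed
    also have "\<dots> = (\<integral>\<^sup>+\<omega>. \<integral>\<^sup>+\<omega>'. f (restrict (W \<omega>) ?B, restrict (W \<omega>') {ID i j}) \<partial>M \<partial>M)"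
      by (rule M.indep_var_nn_Fubini[OF ind1 f_meas])
    also have "\<dots> = (\<integral>\<^sup>+\<omega>. g (restrict (W \<omega>) {IM i}, restrict (W \<omega>) (IT ` {1..i})) \<partial>M)"
    proof (intro nn_integral_cong)
      fix \<omega>
      have m [measurable]: "(\<lambda>y. delayed_fn x t (arr (W \<omega>) i) y) \<in> borel_measurable borel"
        using measurable_compose[OF _ delayed_fn_measurable, of "\<lambda>y. (arr (W \<omega>) i, y)" borel x t] by simp
      have "\<psi> (arr (W \<omega>) i) = (\<integral>\<^sup>+\<omega>'. delayed_fn x t (arr (W \<omega>) i) (Z (ID i j) \<omega>') \<partial>M)"
        unfolding \<psi>_def H[OF i j, symmetric] by (rule nn_integral_distr) simp_all
      then show "(\<integral>\<^sup>+\<omega>'. f (restrict (W \<omega>) ?B, restrict (W \<omega>') {ID i j}) \<partial>M)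
          = g (restrict (W \<omega>) {IM i}, restrict (W \<omega>) (IT ` {1..i}))"
        unfolding f_eq g_eq by (simp add: nn_integral_cmult)
    qed
    also have "\<dots> = (\<integral>\<^sup>+\<omega>. \<integral>\<^sup>+\<omega>'. g (restrict (W \<omega>) {IM i}, restrict (W \<omega>') (IT ` {1..i})) \<partial>M \<partial>M)"
      by (rule M.indep_var_nn_Fubini[OF ind2 g_meas])
    also have "\<dots> = (\<integral>\<^sup>+\<omega>. indicator {real j..} (Z (IM i) \<omega>) * (\<integral>\<^sup>+\<omega>. \<psi> (arr (W \<omega>) i) \<partial>M) \<partial>M)"
      unfolding g_eq by (intro nn_integral_cong) (simp add: nn_integral_cmult)
    also have "\<dots> = (\<integral>\<^sup>+\<omega>. indicator {real j..} (Z (IM i) \<omega>) \<partial>M) * (\<integral>\<^sup>+\<omega>. \<psi> (arr (W \<omega>) i) \<partial>M)"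
      by (rule nn_integral_multc) simp
    also have "(\<integral>\<^sup>+\<omega>. indicator {real j..} (Z (IM i) \<omega>) \<partial>M) = (\<integral>\<^sup>+\<omega>. indicator {real j..} (Z (IM 1) \<omega>) \<partial>M)"
      using i by (intro nn_integral_identical M_distr) simp_all
    finally show ?thesis by (simp add: \<psi>_def)
  qed
  have "expected_delayed x t = (\<Sum>i. \<Sum>j. \<integral>\<^sup>+\<omega>. claim_term x t (IY (Suc i) (Suc j)) \<omega> \<partial>M)"
    unfolding expected_delayed_def
    by (subst nn_integral_suminf)
      (auto intro!: suminf_cong nn_integral_suminf borel_measurable_suminf_order claim_term_W_measurable)
  also have "\<dots> = (\<Sum>i. \<Sum>j. (\<integral>\<^sup>+\<omega>. indicator {real (Suc j)..} (Z (IM 1) \<omega>) \<partial>M) * (\<integral>\<^sup>+\<omega>. \<integral>\<^sup>+y. delayed_fn x t (arr (W \<omega>) (Suc i)) y \<partial>H \<partial>M))"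
    by (intro suminf_cong summand) auto
  also have "\<dots> = (\<Sum>j. \<integral>\<^sup>+\<omega>. indicator {real (Suc j)..} (Z (IM 1) \<omega>) \<partial>M) *
    (\<Sum>i. \<integral>\<^sup>+\<omega>. \<integral>\<^sup>+y. delayed_fn x t (arr (W \<omega>) (Suc i)) y \<partial>H \<partial>M)"
    by simp
  finally show ?thesis .
qed

section \<open>From additive errors to asymptotic ratios\<close>

lemma first_le_1: "first x t \<le> 1"
proof -
  have "first x t \<le> (\<integral>\<^sup>+\<omega>. 1 \<partial>M)" unfolding first_def first_fn_def
    by (intro nn_integral_mono) (auto simp: indicator_def)
  then show ?thesis by (simp add: M.emeasure_space_1)
qed

lemma first_le_main: "first x t \<le> expected_main x t"
proof -
  have "first x t = (\<integral>\<^sup>+\<omega>. indicator {0..t} (arr (W \<omega>) (Suc 0)) * ennreal (tbar (x * exp (r * arr (W \<omega>) (Suc 0)))) \<partial>M)"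
    unfolding first_def first_fn_def using nonneg[OF T_valid[of 1]]
    by (intro nn_integral_cong) (auto simp: arr_def indicator_def)
  also have "\<dots> \<le> expected_main x t" unfolding expected_main_eq
    using sum_le_suminf[of "\<lambda>i. \<integral>\<^sup>+\<omega>. indicator {0..t} (arr (W \<omega>) (Suc i)) * ennreal (tbar (x * exp (r * arr (W \<omega>) (Suc i)))) \<partial>M" "{0}"]
    by simp
  finally show ?thesis .
qed

text \<open>\<open>tbar\<close> is positive everywhere, so the integral can vanish only if \<tau>_1
  \<le> t is a null event.\<close>

lemma first_pos:
  assumes "0 < \<P>(\<omega> in M. Z (IT 1) \<omega> \<le> t)"
  shows "0 < first x t"
proof (rule ccontr)
  assume "\<not> 0 < first x t"
  then have "(\<integral>\<^sup>+\<omega>. first_fn x t (Z (IT 1) \<omega>) \<partial>M) = 0" by (simp add: first_def)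
  then have "AE \<omega> in M. first_fn x t (Z (IT 1) \<omega>) = 0" by (subst (asm) nn_integral_0_iff_AE) auto
  then have "AE \<omega> in M. \<not> Z (IT 1) \<omega> \<le> t"
  proof eventually_elim
    case (elim \<omega>)
    then have "indicator {..t} (Z (IT 1) \<omega>) * tbar (x * exp (r * Z (IT 1) \<omega>)) \<le> 0"
      by (simp add: first_fn_def ennreal_eq_0_iff)
    then show ?case using tbar_pos[of "x * exp (r * Z (IT 1) \<omega>)"] by (auto simp: indicator_def split: if_splits)
  qed
  then have "\<P>(\<omega> in M. Z (IT 1) \<omega> \<le> t) = 0"
    by (subst M.prob_eq_0) auto
  then show False using assms by simp
qed

text \<open>p stands for P(D_r(t) in xA), of which only the position between the two real-valued
  events matters. Finiteness of \<open>expected\<close> is a by-product: the lower estimate bounds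
  it by p plus e times \<open>first\<close>, and \<open>first\<close> is at most 1.\<close>

lemma total_two_sided:
  assumes e: "0 < e"
  shows "\<forall>\<^sub>F x in at_top. \<forall>t\<le>T. \<forall>p\<ge>0. max_prob x t \<le> ennreal p \<longrightarrow> ennreal p \<le> sum_prob x t \<longrightarrow>
    expected x t < \<infinity> \<and> first x t < \<infinity> \<and> \<bar>p - enn2real (expected x t)\<bar> \<le> e * enn2real (first x t)"
  using sum_prob_upper[OF e] max_prob_lower[OF e]
proof eventually_elim
  case prems: (elim x)
  show ?case
  proof (intro allI impI, goal_cases)
    case hyp: (1 t p)
    then have t: "t \<le> T" and p: "0 \<le> p" and lo: "max_prob x t \<le> ennreal p" and up: "ennreal p \<le> sum_prob x t"
      by auto
    have first: "first x t < \<infinity>" using first_le_1[of x t] by (auto simp: less_top[symmetric] top_unique)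
    then obtain f where f: "first x t = ennreal f" "0 \<le> f" by (cases "first x t") auto
    have U: "ennreal p \<le> expected x t + ennreal e * first x t" using prems(1) t up by (auto intro: order_trans)
    have L: "expected x t \<le> ennreal p + ennreal e * first x t"
    proof -
      have "expected x t \<le> max_prob x t + ennreal e * first x t" using prems(2) t by auto
      also have "\<dots> \<le> ennreal p + ennreal e * first x t" using lo by (intro add_right_mono)
      finally show ?thesis .
    qed
    have L': "expected x t \<le> ennreal (p + e * f)"
      using L e p f by (simp add: ennreal_mult'')
    then have fin: "expected x t < \<infinity>" using ennreal_less_top le_less_trans by (metis infinity_ennreal_def)
    then obtain E where E: "expected x t = ennreal E" "0 \<le> E" by (cases "expected x t") auto
    have "E \<le> p + e * f" using L' E e p f by (simp add: ennreal_le_iff del: ennreal_plus)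
    moreover have "p \<le> E + e * f" using U E e p f by (simp add: ennreal_mult''[symmetric] ennreal_plus[symmetric] ennreal_le_iff del: ennreal_plus)
    ultimately show "expected x t < \<infinity> \<and> first x t < \<infinity> \<and> \<bar>p - enn2real (expected x t)\<bar> \<le> e * enn2real (first x t)"
      using fin first E f by (auto simp: abs_le_iff)
  qed
qed

lemma ratio_total:
  assumes e: "0 < e"
  shows "\<forall>\<^sub>F x in at_top. \<forall>t\<le>T. 0 < \<P>(\<omega> in M. Z (IT 1) \<omega> \<le> t) \<longrightarrow> (\<forall>p\<ge>0. max_prob x t \<le> ennreal p \<longrightarrow> ennreal p \<le> sum_prob x t \<longrightarrow>
    \<bar>p / (enn2real (expected_main x t) + enn2real (expected_delayed x t)) - 1\<bar> \<le> e)"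
  using total_two_sided[OF e]
proof eventually_elim
  case prems: (elim x)
  show ?case
  proof (intro allI impI, goal_cases)
    case hyp: (1 t p)
    note pos = hyp(2)
    have *: "expected x t < \<infinity>" "first x t < \<infinity>" "\<bar>p - enn2real (expected x t)\<bar> \<le> e * enn2real (first x t)"
      using prems hyp by auto
    let ?E = "enn2real (expected x t)" and ?f = "enn2real (first x t)"
    have f: "0 < ?f" using first_pos[OF pos] *(2) by (simp add: enn2real_positive_iff)
    have "first x t \<le> expected x t" using first_le_main unfolding expected_split by (rule order_trans) simp
    then have fE: "?f \<le> ?E" using * by (intro enn2real_mono) auto
    have sum: "enn2real (expected_main x t) + enn2real (expected_delayed x t) = ?E"
      unfolding expected_split using *(1) by (subst enn2real_plus) (auto simp: expected_split less_top[symmetric])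
    have "\<bar>p - ?E\<bar> \<le> e * ?E" using *(3) fE e mult_left_mono[of ?f ?E e] by linarith
    moreover have "p / ?E - 1 = (p - ?E) / ?E" using f fE by (simp add: field_simps)
    ultimately have "\<bar>p / ?E - 1\<bar> \<le> e" using f fE by (simp add: abs_divide pos_divide_le_eq)
    then show "\<bar>p / (enn2real (expected_main x t) + enn2real (expected_delayed x t)) - 1\<bar> \<le> e" unfolding sum .
  qed
qed

lemma ratio_main:
  assumes e: "0 < e" and small: "\<forall>e>0. \<exists>x0. \<forall>y\<ge>x0. Gb y \<le> e * tbar y"
  shows "\<forall>\<^sub>F x in at_top. \<forall>t\<le>T. 0 < \<P>(\<omega> in M. Z (IT 1) \<omega> \<le> t) \<longrightarrow> (\<forall>p\<ge>0. max_prob x t \<le> ennreal p \<longrightarrow> ennreal p \<le> sum_prob x t \<longrightarrow>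
    \<bar>p / enn2real (expected_main x t) - 1\<bar> \<le> e)"
proof -
  \<comment> \<open>One half for the approximation by \<open>expected\<close>, the other for the
    delayed part contained in it.\<close>
  have e2: "0 < e / 2" using e by simp
  show ?thesis using total_two_sided[OF e2] delayed_negligible[OF e2 small]
  proof eventually_elim
    case prems: (elim x)
    show ?case
    proof (intro allI impI, goal_cases)
      case hyp: (1 t p)
      note pos = hyp(2)
      have *: "expected x t < \<infinity>" "first x t < \<infinity>" "\<bar>p - enn2real (expected x t)\<bar> \<le> e / 2 * enn2real (first x t)"
        using prems hyp by auto
      let ?E = "enn2real (expected_main x t)" and ?D = "enn2real (expected_delayed x t)" and ?f = "enn2real (first x t)"
      have f: "0 < ?f" using first_pos[OF pos] *(2) by (simp add: enn2real_positive_iff)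
      have fin: "expected_main x t < \<infinity>" "expected_delayed x t < \<infinity>"
        using *(1) unfolding expected_split by auto
      have fE: "?f \<le> ?E" using first_le_main fin by (intro enn2real_mono) auto
      have sum: "enn2real (expected x t) = ?E + ?D"
        unfolding expected_split using fin by (intro enn2real_plus) auto
      have "?D \<le> enn2real (ennreal (e / 2) * first x t)"
        using prems hyp *(2) by (intro enn2real_mono) (auto simp: ennreal_mult_less_top)
      then have D: "?D \<le> e / 2 * ?f" using e by (simp add: enn2real_mult)
      have "\<bar>p - ?E\<bar> \<le> e * ?f" using *(3) D enn2real_nonneg[of "expected_delayed x t"] unfolding sum abs_le_iff by linarith
      also have "\<dots> \<le> e * ?E" using fE e by (intro mult_left_mono) auto
      finally have "\<bar>p - ?E\<bar> \<le> e * ?E" .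
      moreover have "p / ?E - 1 = (p - ?E) / ?E" using f fE by (simp add: field_simps)
      ultimately show "\<bar>p / ?E - 1\<bar> \<le> e" using f fE by (simp add: abs_divide pos_divide_le_eq)
    qed
  qed
qed

end

section \<open>The risk model\<close>

text \<open>\<open>measure_of\<close> keeps the given set function only if it is a measure. Here it
  agrees on Borel sets with R, the image of the product of counting measure and M under (i,
  \<omega>) -> \<tau>_(i+1)(\<omega>), and integrals against R are series of expectations.\<close>

lemma renewal_measure_nn_integral:
  assumes M: "prob_space M" and [measurable]: "\<And>i. tau th i \<in> borel_measurable M"
  shows "sets (renewal_measure M th) = sets borel"
    and "f \<in> borel_measurable borel \<Longrightarrow>
      (\<integral>\<^sup>+s. f s \<partial>renewal_measure M th) = (\<Sum>i. \<integral>\<^sup>+\<omega>. f (tau th (Suc i) \<omega>) \<partial>M)"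
proof -
  interpret M: prob_space M by fact
  interpret pair_sigma_finite "count_space (UNIV :: nat set)" M
    by (intro pair_sigma_finite.intro sigma_finite_measure_count_space M.sigma_finite_measure)
  have meas [measurable]: "(\<lambda>p. tau th (Suc (fst p)) (snd p)) \<in> borel_measurable (count_space UNIV \<Otimes>\<^sub>M M)"
    by (rule measurable_compose_countable[where f="\<lambda>i p. tau th (Suc i) (snd p)"]) measurable
  define R where "R = distr (count_space UNIV \<Otimes>\<^sub>M M) borel (\<lambda>p. tau th (Suc (fst p)) (snd p))"
  have int: "(\<integral>\<^sup>+s. f s \<partial>R) = (\<Sum>i. \<integral>\<^sup>+\<omega>. f (tau th (Suc i) \<omega>) \<partial>M)" if [measurable]: "f \<in> borel_measurable borel" for f
  proof -
    have "(\<integral>\<^sup>+s. f s \<partial>R) = (\<integral>\<^sup>+p. f (tau th (Suc (fst p)) (snd p)) \<partial>(count_space UNIV \<Otimes>\<^sub>M M))"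
      unfolding R_def by (rule nn_integral_distr) measurable
    also have "\<dots> = (\<integral>\<^sup>+i. \<integral>\<^sup>+\<omega>. f (tau th (Suc (fst (i, \<omega>))) (snd (i, \<omega>))) \<partial>M \<partial>count_space UNIV)"
      by (rule M.nn_integral_fst[symmetric]) measurable
    finally show ?thesis by (simp add: nn_integral_count_space_nat)
  qed
  have em: "emeasure R B = (\<Sum>i. emeasure M {\<omega>\<in>space M. tau th (Suc i) \<omega> \<in> B})" if B [measurable]: "B \<in> sets borel" for B
  proof -
    have "emeasure R B = (\<integral>\<^sup>+s. indicator B s \<partial>R)" by (simp add: R_def)
    also have "\<dots> = (\<Sum>i. \<integral>\<^sup>+\<omega>. indicator B (tau th (Suc i) \<omega>) \<partial>M)" by (rule int) simp
    also have "\<dots> = (\<Sum>i. \<integral>\<^sup>+\<omega>. indicator {\<omega>\<in>space M. tau th (Suc i) \<omega> \<in> B} \<omega> \<partial>M)"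
      by (intro suminf_cong nn_integral_cong) (auto simp: indicator_def)
    also have "\<dots> = (\<Sum>i. emeasure M {\<omega>\<in>space M. tau th (Suc i) \<omega> \<in> B})"
      by (intro suminf_cong nn_integral_indicator) measurable
    finally show ?thesis .
  qed
  have "renewal_measure M th = measure_of UNIV (sets borel) (emeasure R)"
    unfolding renewal_measure_def using em
    by (intro measure_of_eq) (auto simp: sets.sigma_sets_eq[of "borel :: real measure", simplified])
  also have "\<dots> = R" using measure_of_of_measure[of R] by (simp add: R_def)
  finally have eq: "renewal_measure M th = R" .
  show "sets (renewal_measure M th) = sets borel" by (simp add: eq R_def)
  show "f \<in> borel_measurable borel \<Longrightarrow>
      (\<integral>\<^sup>+s. f s \<partial>renewal_measure M th) = (\<Sum>i. \<integral>\<^sup>+\<omega>. f (tau th (Suc i) \<omega>) \<partial>M)"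
    unfolding eq by (rule int)
qed

section \<open>The counting process\<close>

lemma tau_mono: "(\<And>i. 1 \<le> i \<Longrightarrow> 0 \<le> th i \<omega>) \<Longrightarrow> i \<le> j \<Longrightarrow> tau th i \<omega> \<le> tau th j \<omega>"
  unfolding tau_def by (intro sum_mono2) auto

text \<open>Arrival times do not decrease, so the arrivals by t form an initial segment of the
  indices, possibly empty or infinite.\<close>

lemma arrivals_cases:
  assumes "\<And>i. 1 \<le> i \<Longrightarrow> 0 \<le> th i \<omega>"
  shows "(\<exists>n. {i. i \<ge> 1 \<and> tau th i \<omega> \<le> t} = {1..n}) \<or> {i. i \<ge> 1 \<and> tau th i \<omega> \<le> t} = {1..}"
proof (cases "finite {i. i \<ge> 1 \<and> tau th i \<omega> \<le> t}")
  case True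
  let ?S = "{i. i \<ge> 1 \<and> tau th i \<omega> \<le> t}"
  have down: "i \<in> ?S" if "1 \<le> i" "i \<le> j" "j \<in> ?S" for i j
    using that tau_mono[of th \<omega> i j, OF assms] by auto
  show ?thesis
  proof (cases "?S = {}")
    case True
    then have "?S = {1..0}" by simp
    then show ?thesis by blast
  next
    case False
    then have "Max ?S \<in> ?S" using True by (intro Max_in) auto
    define m where "m = Max ?S"
    have m: "m \<in> ?S" "\<And>i. i \<in> ?S \<Longrightarrow> i \<le> m" using \<open>Max ?S \<in> ?S\<close> True by (simp_all add: m_def)
    have "?S = {1..m}"
    proof (intro equalityI subsetI)
      fix i assume "i \<in> {1..m}"
      then show "i \<in> ?S" using m(1) by (intro down[of i m]) simp_all
    qed (use m(2) in simp)
    then show ?thesis by blast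
  qed
next
  case False
  let ?S = "{i. i \<ge> 1 \<and> tau th i \<omega> \<le> t}"
  have "i \<in> ?S" if "1 \<le> i" for i
  proof -
    obtain j where "j \<in> ?S" "i \<le> j" using False by (metis (no_types, lifting) finite_nat_set_iff_bounded_le linorder_le_cases)
    then show ?thesis using that tau_mono[of th \<omega> i j, OF assms] by auto
  qed
  then show ?thesis by auto
qed

lemma Sup_atLeast1AtMost: "Sup {1..n} = (n::nat)"
proof (cases n)
  case (Suc m)
  then show ?thesis by (intro cSup_eq_maximum) auto
qed simp

lemma Ncount_measurable:
  assumes "\<And>i \<omega>. 1 \<le> i \<Longrightarrow> 0 \<le> th i \<omega>" and [measurable]: "\<And>i. tau th i \<in> borel_measurable M"
  shows "Ncount th t \<in> measurable M (count_space UNIV)"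
proof -
  have meas: "{\<omega>\<in>space M. \<forall>i. (1 \<le> i \<and> tau th i \<omega> \<le> t) = (i \<in> B)} \<in> sets M" for B by measurable
  have "Ncount th t -` {n} \<inter> space M \<in> sets M" for n
  proof -
    \<comment> \<open>With infinitely many arrivals by t the supremum is the fixed default value
      \<open>Sup {1::nat..}\<close>, which might coincide with n; hence the second event in the
      union.\<close>
    have "Ncount th t -` {n} \<inter> space M = {\<omega>\<in>space M. \<forall>i. (1 \<le> i \<and> tau th i \<omega> \<le> t) = (i \<in> {1..n})}
        \<union> (if Sup {1::nat..} = n then {\<omega>\<in>space M. \<forall>i. (1 \<le> i \<and> tau th i \<omega> \<le> t) = (i \<in> {1..})} else {})"
      (is "?L = ?R")
    proof (rule set_eqI)
      fix \<omega>
      let ?S = "{i. i \<ge> 1 \<and> tau th i \<omega> \<le> t}"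
      have S: "(\<forall>i. (1 \<le> i \<and> tau th i \<omega> \<le> t) = (i \<in> B)) \<longleftrightarrow> ?S = B" for B by blast
      have inj: "{1..m} = {1..n} \<longleftrightarrow> m = n" for m n :: nat using Sup_atLeast1AtMost by metis
      have "{1..m} \<noteq> {1..}" for m :: nat using finite_atLeastAtMost[of 1 m] infinite_Ici[of "1::nat"] by metis
      note neq = this this[symmetric]
      have R: "\<omega> \<in> ?R \<longleftrightarrow> \<omega> \<in> space M \<and> (?S = {1..n} \<or> Sup {1::nat..} = n \<and> ?S = {1..})"
        by (auto simp: S simp del: atLeastAtMost_iff atLeast_iff One_nat_def)
      have L: "\<omega> \<in> ?L \<longleftrightarrow> \<omega> \<in> space M \<and> Sup ?S = n" by (auto simp: Ncount_def)
      consider m where "?S = {1..m}" | "?S = {1..}" using arrivals_cases[of th \<omega> t, OF assms(1)] by blast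
      then show "\<omega> \<in> ?L \<longleftrightarrow> \<omega> \<in> ?R"
      proof cases
        case 1
        show ?thesis unfolding L R 1 inj Sup_atLeast1AtMost using neq by simp
      next
        case 2
        show ?thesis unfolding L R 2 using neq by simp
      qed
    qed
    then show ?thesis
      by (cases "Sup {1::nat..} = n") (simp_all only: simp_thms if_True if_False Un_empty_right sets.Un meas)
  qed
  then show ?thesis by (subst measurable_count_space_eq2_countable) auto
qed

text \<open>Holds also for an infinite integral, when both sides are 0; so the integrals of the
  theorem can be computed in \<open>ennreal\<close>.\<close>

lemma enn2real_LINT:
  assumes "f \<in> borel_measurable N" "\<And>s. 0 \<le> f s" "S \<in> sets N"
  shows "(LINT s:S|N. f s) = enn2real (\<integral>\<^sup>+s. indicator S s * ennreal (f s) \<partial>N)"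
proof -
  have "(LINT s:S|N. f s) = enn2real (\<integral>\<^sup>+s. ennreal (indicator S s *\<^sub>R f s) \<partial>N)"
    unfolding set_lebesgue_integral_def using assms
    by (intro integral_eq_nn_integral) auto
  also have "(\<integral>\<^sup>+s. ennreal (indicator S s *\<^sub>R f s) \<partial>N) = (\<integral>\<^sup>+s. indicator S s * ennreal (f s) \<partial>N)"
    by (intro nn_integral_cong) (auto simp: indicator_def)
  finally show ?thesis .
qed

section \<open>Reduction of the vector-valued model to gauges\<close>

locale risk_model = prob_space M + increasing_set A
  for M :: "'w measure" and A :: "(real^'d) set" +
  fixes X :: "nat \<Rightarrow> 'w \<Rightarrow> real^'d" and Y :: "nat \<Rightarrow> nat \<Rightarrow> 'w \<Rightarrow> real^'d"
    and Mc :: "nat \<Rightarrow> 'w \<Rightarrow> nat" and Dl :: "nat \<Rightarrow> nat \<Rightarrow> 'w \<Rightarrow> real"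
    and th :: "nat \<Rightarrow> 'w \<Rightarrow> real"
    and F G :: "(real^'d) measure" and K :: "nat measure" and H :: "real measure"
    and r T :: real
  assumes mX: "\<And>i. i \<ge> 1 \<Longrightarrow> X i \<in> borel_measurable M"
    and mY: "\<And>i j. i \<ge> 1 \<Longrightarrow> j \<ge> 1 \<Longrightarrow> Y i j \<in> borel_measurable M"
    and mM: "\<And>i. i \<ge> 1 \<Longrightarrow> Mc i \<in> measurable M (count_space UNIV)"
    and mD: "\<And>i j. i \<ge> 1 \<Longrightarrow> j \<ge> 1 \<Longrightarrow> Dl i j \<in> borel_measurable M"
    and mth: "\<And>i. i \<ge> 1 \<Longrightarrow> th i \<in> borel_measurable M"
    and Xnn: "\<And>i \<omega>. i \<ge> 1 \<Longrightarrow> X i \<omega> \<in> nonneg_orthant"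
    and Ynn: "\<And>i j \<omega>. i \<ge> 1 \<Longrightarrow> j \<ge> 1 \<Longrightarrow> Y i j \<omega> \<in> nonneg_orthant"
    and Dnn: "\<And>i j \<omega>. i \<ge> 1 \<Longrightarrow> j \<ge> 1 \<Longrightarrow> Dl i j \<omega> \<ge> 0"
    and thnn: "\<And>i \<omega>. i \<ge> 1 \<Longrightarrow> th i \<omega> \<ge> 0"
    and th1pos: "AE \<omega> in M. th 1 \<omega> > 0"
    and indep: "model_indep M X Y Mc Dl th"
    and distX: "\<And>i. i \<ge> 1 \<Longrightarrow> distr M borel (X i) = F"
    and distY: "\<And>i j. i \<ge> 1 \<Longrightarrow> j \<ge> 1 \<Longrightarrow> distr M borel (Y i j) = G"
    and distM: "\<And>i. i \<ge> 1 \<Longrightarrow> distr M (count_space UNIV) (Mc i) = K"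
    and distD: "\<And>i j. i \<ge> 1 \<Longrightarrow> j \<ge> 1 \<Longrightarrow> distr M borel (Dl i j) = H"
    and distth: "\<And>i. i \<ge> 1 \<Longrightarrow> distr M borel (th i) = distr M borel (th 1)"
    and lam_fin: "\<And>t. summable (\<lambda>i. \<P>(\<omega> in M. tau th (Suc i) \<omega> \<le> t))"
    and r: "r \<ge> 0"
    and expmom: "\<exists>\<delta>>0. integrable K (\<lambda>m. exp (\<delta> * real m))"
begin

text \<open>One real family for all five kinds of variables, with claims represented by their
  gauges, so that a single independence statement covers the model.\<close>

fun Zr :: "ridx \<Rightarrow> 'w \<Rightarrow> real" where
  "Zr (IX i) \<omega> = Z_A A (X i \<omega>)"
| "Zr (IY i j) \<omega> = Z_A A (Y i j \<omega>)"
| "Zr (IM i) \<omega> = real (Mc i \<omega>)"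
| "Zr (ID i j) \<omega> = Dl i j \<omega>"
| "Zr (IT i) \<omega> = th i \<omega>"

abbreviation "Wr \<omega> \<equiv> \<lambda>k. Zr k \<omega>"

lemma Zr_eta: "Zr (IX i) = (\<lambda>\<omega>. Z_A A (X i \<omega>))" "Zr (IY i j) = (\<lambda>\<omega>. Z_A A (Y i j \<omega>))"
  "Zr (IM i) = (\<lambda>\<omega>. real (Mc i \<omega>))" "Zr (ID i j) = Dl i j" "Zr (IT i) = th i"
  by (simp_all add: fun_eq_iff)

lemma valid_cases:
  assumes "k \<in> valid_idx"
  obtains i where "k = IX i" "1 \<le> i" | i j where "k = IY i j" "1 \<le> i" "1 \<le> j"
  | i where "k = IM i" "1 \<le> i" | i j where "k = ID i j" "1 \<le> i" "1 \<le> j" | i where "k = IT i" "1 \<le> i"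
  using assms unfolding valid_idx_def by blast

lemma Zr_measurable: "k \<in> valid_idx \<Longrightarrow> Zr k \<in> borel_measurable M"
  by (erule valid_cases)
    (auto simp: Zr_eta mX mY mD mth intro!: measurable_compose[OF _ Z_A_measurable] measurable_compose[OF mM])

lemma Zr_nonneg: "k \<in> valid_idx \<Longrightarrow> 0 \<le> Zr k \<omega>"
  by (erule valid_cases) (auto simp: Z_A_nonneg Dnn thnn)

text \<open>A function of f generates no events beyond those of f; this passes independence from
  vectors to gauges and from offspring numbers to their real versions.\<close>

lemma gen_sets_compose:
  assumes "h \<in> measurable N N'" "f \<in> measurable M N"
  shows "{(\<lambda>\<omega>. h (f \<omega>)) -` B \<inter> space M | B. B \<in> sets N'} \<subseteq> gen_sets M N f"
proof safe
  fix B assume "B \<in> sets N'"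
  then have "h -` B \<inter> space N \<in> sets N" using assms(1) by (rule measurable_sets[rotated])
  moreover have "(\<lambda>\<omega>. h (f \<omega>)) -` B \<inter> space M = f -` (h -` B \<inter> space N) \<inter> space M"
    using measurable_space[OF assms(2)] by auto
  ultimately show "(\<lambda>\<omega>. h (f \<omega>)) -` B \<inter> space M \<in> gen_sets M N f" unfolding gen_sets_def by blast
qed

lemma Zr_indep: "indep_vars (\<lambda>_. borel) Zr valid_idx"
  unfolding indep_vars_def2
proof (intro conjI ballI Zr_measurable)
  show "indep_sets (\<lambda>k. {Zr k -` B \<inter> space M | B. B \<in> sets borel}) valid_idx"
  proof (rule indep_sets_mono_sets[OF indep[unfolded model_indep_def]])
    fix k assume "k \<in> valid_idx"
    then show "{Zr k -` B \<inter> space M | B. B \<in> sets borel} \<subseteq> (case k of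
         IX i \<Rightarrow> gen_sets M borel (X i)
       | IY i j \<Rightarrow> gen_sets M borel (Y i j)
       | IM i \<Rightarrow> gen_sets M (count_space UNIV) (Mc i)
       | ID i j \<Rightarrow> gen_sets M borel (Dl i j)
       | IT i \<Rightarrow> gen_sets M borel (th i))"
    proof (cases rule: valid_cases)
      case (1 i)
      then show ?thesis using gen_sets_compose[OF Z_A_measurable mX[of i]] by (simp add: Zr_eta)
    next
      case (2 i j)
      then show ?thesis using gen_sets_compose[OF Z_A_measurable mY[of i j]] by (simp add: Zr_eta)
    next
      case (3 i)
      then show ?thesis using gen_sets_compose[OF _ mM[of i], of real borel] by (simp add: Zr_eta)
    next
      case (4 i j)
      then show ?thesis by (auto simp: Zr_eta gen_sets_def)
    next
      case (5 i)
      then show ?thesis by (auto simp: Zr_eta gen_sets_def)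
    qed
  qed
qed

lemma arr_Wr [simp]: "arr (Wr \<omega>) i = tau th i \<omega>"
  by (simp add: arr_def tau_def)

lemma tau_measurable [measurable]: "tau th i \<in> borel_measurable M"
  unfolding tau_def[abs_def] by (intro borel_measurable_sum mth) simp

text \<open>Borel-Cantelli: the probabilities P(\<tau>_i \<le> T) sum to the finite renewal function
  at T.\<close>

lemma finitely_many_arrivals: "AE \<omega> in M. finite {i. tau th i \<omega> \<le> T}"
proof -
  have "AE \<omega> in M. \<forall>\<^sub>F n in sequentially. \<omega> \<in> space M - {\<omega> \<in> space M. tau th (Suc n) \<omega> \<le> T}"
    by (rule borel_cantelli_AE1) (auto simp: lam_fin emeasure_eq_measure)
  then show ?thesis
  proof eventually_elim
    case (elim \<omega>)
    then obtain N where N: "\<And>n. N \<le> n \<Longrightarrow> \<not> tau th (Suc n) \<omega> \<le> T"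
      unfolding eventually_sequentially by auto
    have "{i. tau th i \<omega> \<le> T} \<subseteq> {..N}"
    proof
      fix i assume "i \<in> {i. tau th i \<omega> \<le> T}"
      moreover have "\<not> tau th i \<omega> \<le> T" if "N < i"
      proof -
        have "N \<le> i - 1" "Suc (i - 1) = i" using that by simp_all
        then show ?thesis using N[of "i - 1"] by metis
      qed
      ultimately show "i \<in> {..N}" by (simp add: not_less[symmetric]) blast
    qed
    then show ?case by (rule finite_subset) simp
  qed
qed

fun claim_vec :: "ridx \<Rightarrow> 'w \<Rightarrow> real^'d" where
  "claim_vec (IX i) \<omega> = X i \<omega>"
| "claim_vec (IY i j) \<omega> = Y i j \<omega>"
| "claim_vec _ \<omega> = 0"

abbreviation "D \<equiv> Dr X Y Mc Dl th r"
abbreviation "ren \<equiv> renewal_measure M th"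

text \<open>Finitely many arrivals exclude the default value of \<open>Ncount\<close>, so it counts
  the arrivals by t; dropping the zero terms of the double sum then leaves exactly the active
  indices.\<close>

lemma Dr_active:
  assumes fin: "finite {i. tau th i \<omega> \<le> T}" and t: "t \<le> T"
  shows "D t \<omega> = (\<Sum>k\<in>active t (Wr \<omega>). exp (- r * due (Wr \<omega>) k) *\<^sub>R claim_vec k \<omega>)"
    and "finite (active t (Wr \<omega>))"
proof -
  define N where "N = Ncount th t \<omega>"
  have "finite {i. i \<ge> 1 \<and> tau th i \<omega> \<le> t}" by (rule finite_subset[OF _ fin]) (use t in auto)
  then have "{i. i \<ge> 1 \<and> tau th i \<omega> \<le> t} \<noteq> {1..}" using infinite_Ici[of "1::nat"] by metis
  then obtain n where n: "{i. i \<ge> 1 \<and> tau th i \<omega> \<le> t} = {1..n}"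
    using arrivals_cases[of th \<omega> t, OF thnn] by blast
  have "N = n" unfolding N_def Ncount_def n by (rule Sup_atLeast1AtMost)
  with n have N: "1 \<le> i \<and> tau th i \<omega> \<le> t \<longleftrightarrow> i \<in> {1..N}" for i by blast
  let ?f = "\<lambda>k. exp (- r * due (Wr \<omega>) k) *\<^sub>R claim_vec k \<omega>"
  let ?P = "Sigma {1..N} (\<lambda>i. {j\<in>{1..Mc i \<omega>}. tau th i \<omega> + Dl i j \<omega> \<le> t})"
  let ?Y = "(\<lambda>(i, j). IY i j) ` ?P"
  have act: "active t (Wr \<omega>) = IX ` {1..N} \<union> ?Y"
  proof (intro equalityI subsetI)
    fix k assume k: "k \<in> active t (Wr \<omega>)"
    then have "k \<in> claims" using active_subset by blast
    then consider i where "k = IX i" "1 \<le> i" | i j where "k = IY i j" "1 \<le> i" "1 \<le> j" unfolding claims_def by blast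
    then show "k \<in> IX ` {1..N} \<union> ?Y"
    proof cases
      case (1 i)
      then show ?thesis using k N[of i] by (auto simp: active_def)
    next
      case (2 i j)
      then have "tau th i \<omega> \<le> t" using k Dnn[of i j \<omega>] by (auto simp: active_def)
      then have "(i, j) \<in> ?P" using k N[of i] 2 by (auto simp: active_def)
      then show ?thesis using 2 by force
    qed
  next
    fix k assume "k \<in> IX ` {1..N} \<union> ?Y"
    then consider i where "k = IX i" "i \<in> {1..N}" | i j where "k = IY i j" "(i, j) \<in> ?P" by auto
    then show "k \<in> active t (Wr \<omega>)"
    proof cases
      case (1 i)
      then show ?thesis using N[of i] by (auto simp: active_def claims_def)
    next
      case (2 i j)
      then show ?thesis using N[of i] by (auto simp: active_def claims_def)
    qed
  qed
  show fa: "finite (active t (Wr \<omega>))" unfolding act by auto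
  have "(\<Sum>k\<in>active t (Wr \<omega>). ?f k) = (\<Sum>k\<in>IX ` {1..N}. ?f k) + (\<Sum>k\<in>?Y. ?f k)"
    unfolding act by (rule sum.union_disjoint) auto
  also have "(\<Sum>k\<in>IX ` {1..N}. ?f k) = (\<Sum>i=1..N. exp (- r * tau th i \<omega>) *\<^sub>R X i \<omega>)"
    by (subst sum.reindex) (auto simp: inj_on_def)
  also have "(\<Sum>k\<in>?Y. ?f k) = (\<Sum>(i, j)\<in>?P. exp (- r * (tau th i \<omega> + Dl i j \<omega>)) *\<^sub>R Y i j \<omega>)"
    by (subst sum.reindex) (auto simp: inj_on_def intro!: sum.cong)
  also have "\<dots> = (\<Sum>i=1..N. \<Sum>j\<in>{j\<in>{1..Mc i \<omega>}. tau th i \<omega> + Dl i j \<omega> \<le> t}. exp (- r * (tau th i \<omega> + Dl i j \<omega>)) *\<^sub>R Y i j \<omega>)"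
    by (rule sum.Sigma[symmetric]) auto
  also have "\<dots> = (\<Sum>i=1..N. \<Sum>j=1..Mc i \<omega>.
        (if tau th i \<omega> + Dl i j \<omega> \<le> t then exp (- r * (tau th i \<omega> + Dl i j \<omega>)) *\<^sub>R Y i j \<omega> else 0))"
    by (intro sum.cong refl sum.inter_filter) auto
  finally show "D t \<omega> = (\<Sum>k\<in>active t (Wr \<omega>). ?f k)"
    unfolding Dr_def N_def[symmetric] by simp
qed

lemma claim_vec_nonneg: "k \<in> claims \<Longrightarrow> claim_vec k \<omega> \<in> nonneg_orthant"
  using Xnn Ynn by (auto simp: claims_def)

lemma Z_A_claim_vec: "k \<in> claims \<Longrightarrow> Z_A A (exp c *\<^sub>R claim_vec k \<omega>) = exp c * Zr k \<omega>"
  by (auto simp: claims_def Z_A_scale)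

lemma Dr_sandwich:
  assumes fin: "finite {i. tau th i \<omega> \<le> T}" and t: "t \<le> T" and x: "0 < x"
  shows "D t \<omega> \<in> scale_set x A \<Longrightarrow>
      x < (\<Sum>k\<in>active t (Wr \<omega>). exp (- r * due (Wr \<omega>) k) * Zr k \<omega>)"
    and "k \<in> active t (Wr \<omega>) \<Longrightarrow> x < exp (- r * due (Wr \<omega>) k) * Zr k \<omega> \<Longrightarrow>
      D t \<omega> \<in> scale_set x A"
proof -
  note Da = Dr_active[OF fin t]
  let ?f = "\<lambda>k. exp (- r * due (Wr \<omega>) k) *\<^sub>R claim_vec k \<omega>"
  have Zf: "Z_A A (?f k) = exp (- r * due (Wr \<omega>) k) * Zr k \<omega>" if "k \<in> active t (Wr \<omega>)" for k
    using that active_subset by (intro Z_A_claim_vec) blast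
  {
    assume "D t \<omega> \<in> scale_set x A"
    then have "x < Z_A A (\<Sum>k\<in>active t (Wr \<omega>). ?f k)" using x by (simp add: Z_A_gt_iff Da(1))
    also have "\<dots> \<le> (\<Sum>k\<in>active t (Wr \<omega>). Z_A A (?f k))" by (rule Z_A_sum[OF Da(2)])
    also have "\<dots> = (\<Sum>k\<in>active t (Wr \<omega>). exp (- r * due (Wr \<omega>) k) * Zr k \<omega>)" by (intro sum.cong refl Zf)
    finally show "x < (\<Sum>k\<in>active t (Wr \<omega>). exp (- r * due (Wr \<omega>) k) * Zr k \<omega>)" .
  next
    assume k: "k \<in> active t (Wr \<omega>)" "x < exp (- r * due (Wr \<omega>) k) * Zr k \<omega>"
    have nn: "?f k \<in> nonneg_orthant" if "k \<in> active t (Wr \<omega>)" for k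
      using claim_vec_nonneg[of k \<omega>] that active_subset[of t "Wr \<omega>"] by (auto simp: nonneg_orthant_def)
    have "x < Z_A A (?f k)" using k Zf by simp
    also have "\<dots> \<le> Z_A A (\<Sum>k\<in>active t (Wr \<omega>). ?f k)" by (rule Z_A_member_le_sum[OF Da(2) k(1) nn])
    finally show "D t \<omega> \<in> scale_set x A" using x by (simp add: Z_A_gt_iff Da(1))
  }
qed

text \<open>The random summation limits take countably many values, and for fixed limits the sums
  are measurable.\<close>

lemma Dr_measurable [measurable]: "D t \<in> borel_measurable M"
proof -
  have N: "Ncount th t \<in> measurable M (count_space UNIV)"
    by (rule Ncount_measurable[OF thnn tau_measurable])
  have inner: "(\<lambda>\<omega>. \<Sum>j=1..Mc i \<omega>. (if tau th i \<omega> + Dl i j \<omega> \<le> t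
         then exp (- r * (tau th i \<omega> + Dl i j \<omega>)) *\<^sub>R Y i j \<omega> else 0)) \<in> borel_measurable M" if i: "1 \<le> i" for i
  proof (rule measurable_compose_countable[OF _ mM[OF i], where f="\<lambda>m \<omega>. \<Sum>j=1..m. (if tau th i \<omega> + Dl i j \<omega> \<le> t
         then exp (- r * (tau th i \<omega> + Dl i j \<omega>)) *\<^sub>R Y i j \<omega> else 0)"])
    fix m
    show "(\<lambda>\<omega>. \<Sum>j=1..m. (if tau th i \<omega> + Dl i j \<omega> \<le> t
         then exp (- r * (tau th i \<omega> + Dl i j \<omega>)) *\<^sub>R Y i j \<omega> else 0)) \<in> borel_measurable M"
    proof (rule borel_measurable_sum)
      fix j assume "j \<in> {1..m}"
      then have [measurable]: "Dl i j \<in> borel_measurable M" "Y i j \<in> borel_measurable M" using i by (auto intro: mD mY)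
      show "(\<lambda>\<omega>. if tau th i \<omega> + Dl i j \<omega> \<le> t then exp (- r * (tau th i \<omega> + Dl i j \<omega>)) *\<^sub>R Y i j \<omega> else 0) \<in> borel_measurable M"
        by measurable
    qed
  qed
  show ?thesis unfolding Dr_def[abs_def]
  proof (rule measurable_compose_countable[OF _ N, where f="\<lambda>n \<omega>. (\<Sum>i=1..n. exp (- r * tau th i \<omega>) *\<^sub>R X i \<omega>) +
     (\<Sum>i=1..n. \<Sum>j=1..Mc i \<omega>. (if tau th i \<omega> + Dl i j \<omega> \<le> t
         then exp (- r * (tau th i \<omega> + Dl i j \<omega>)) *\<^sub>R Y i j \<omega> else 0))"])
    fix n
    have "(\<lambda>\<omega>. exp (- r * tau th i \<omega>) *\<^sub>R X i \<omega>) \<in> borel_measurable M" if "i \<in> {1..n}" for i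
    proof -
      have [measurable]: "X i \<in> borel_measurable M" using that by (intro mX) simp
      show ?thesis by measurable
    qed
    then show "(\<lambda>\<omega>. (\<Sum>i=1..n. exp (- r * tau th i \<omega>) *\<^sub>R X i \<omega>) +
     (\<Sum>i=1..n. \<Sum>j=1..Mc i \<omega>. (if tau th i \<omega> + Dl i j \<omega> \<le> t
         then exp (- r * (tau th i \<omega> + Dl i j \<omega>)) *\<^sub>R Y i j \<omega> else 0))) \<in> borel_measurable M"
      by (intro borel_measurable_add borel_measurable_sum inner) auto
  qed
qed

lemma F_basic: "prob_space F" "sets F = sets borel"
  using prob_space_distr[OF mX[of 1]] distX[of 1] sets_distr[of M borel "X 1"] by auto

lemma G_basic: "prob_space G" "sets G = sets borel"
  using prob_space_distr[OF mY[of 1 1]] distY[of 1 1] sets_distr[of M borel "Y 1 1"] by auto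

lemma dist_A_basic:
  assumes V: "prob_space V" and sV: "sets V = sets borel"
  shows "prob_space (dist_A V A)" "sets (dist_A V A) = sets borel" "measure (dist_A V A) {0..} = 1"
proof -
  interpret V: prob_space V by fact
  have m: "Z_A A \<in> borel_measurable V" using Z_A_measurable sV measurable_cong_sets by blast
  show "prob_space (dist_A V A)" unfolding dist_A_def by (rule V.prob_space_distr[OF m])
  show "sets (dist_A V A) = sets borel" by (simp add: dist_A_def)
  have "Z_A A -` {0..} \<inter> space V = space V" using Z_A_nonneg by auto
  then show "measure (dist_A V A) {0..} = 1"
    unfolding dist_A_def by (subst measure_distr[OF m]) (auto simp: V.prob_space)
qed

lemma subexp_distI:
  assumes "prob_space V" "sets V = sets borel" "subexp_A A V"
  shows "subexp_dist (dist_A V A)"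
  using dist_A_basic[OF assms(1,2)] assms(3)
  by (intro subexp_dist.intro subexp_dist_axioms.intro) (auto simp: subexp_A_def)

lemma tail_distr:
  assumes "f \<in> borel_measurable M"
  shows "\<P>(\<omega> in M. y < Z_A A (f \<omega>)) = measure (dist_A (distr M borel f) A) {y<..}"
proof -
  have "dist_A (distr M borel f) A = distr M borel (Z_A A \<circ> f)"
    unfolding dist_A_def using assms by (intro distr_distr) auto
  moreover have "measure (distr M borel (Z_A A \<circ> f)) {y<..} = measure M ((Z_A A \<circ> f) -` {y<..} \<inter> space M)"
    using assms by (intro measure_distr measurable_comp[of _ _ borel]) auto
  moreover have "(Z_A A \<circ> f) -` {y<..} \<inter> space M = {\<omega>\<in>space M. y < Z_A A (f \<omega>)}" by auto
  ultimately show ?thesis by simp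
qed

text \<open>Common entry point of both parts: subexponentiality is asked of F, whereas G enters
  through the domination \<open>le\<close> and the shift condition \<open>lt\<close>.\<close>

lemma claim_model_exists:
  assumes F: "subexp_A A F" and C: "1 \<le> C"
    and le: "\<And>y. measure (dist_A G A) {y<..} \<le> C * measure (dist_A F A) {y<..}"
    and lt: "\<And>h e. 0 \<le> h \<Longrightarrow> 0 < e \<Longrightarrow> \<exists>x0. \<forall>y\<ge>x0.
       measure (dist_A G A) {y - h<..} \<le> measure (dist_A G A) {y<..} + e * measure (dist_A F A) {y<..}"
  shows "\<exists>\<delta>. claim_model (dist_A F A) M Zr (\<lambda>y. measure (dist_A G A) {y<..}) C r T \<delta>"
proof -
  obtain \<delta> where \<delta>: "0 < \<delta>" "integrable K (\<lambda>m. exp (\<delta> * real m))" using expmom by blast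
  have "integrable (distr M (count_space UNIV) (Mc 1)) (\<lambda>m. exp (\<delta> * real m))" using \<delta> distM by simp
  then have mom: "integrable M (\<lambda>\<omega>. exp (\<delta> * Zr (IM 1) \<omega>))"
    using mM[of 1] by (subst (asm) integrable_distr_eq) auto
  have Mdist: "distr M borel (Zr (IM i)) = distr M borel (Zr (IM 1))" if "1 \<le> i" for i
  proof -
    have "distr M borel (Zr (IM i)) = distr K borel real" if "1 \<le> i" for i
      using distM[OF that] distr_distr[OF _ mM[OF that], of real borel] by (simp add: Zr_eta comp_def)
    then show ?thesis using that by simp
  qed
  show ?thesis
  proof (rule exI[of _ \<delta>], intro claim_model.intro claim_model_axioms.intro)
    show "subexp_dist (dist_A F A)" by (rule subexp_distI[OF F_basic F])
    show "prob_space M" by (rule prob_space_axioms)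
    show "indep_vars (\<lambda>_. borel) Zr valid_idx" by (rule Zr_indep)
    show "0 \<le> Zr k \<omega>" if "k \<in> valid_idx" for k \<omega> by (rule Zr_nonneg[OF that])
    show "\<P>(\<omega> in M. y < Zr (IX i) \<omega>) = measure (dist_A F A) {y<..}" if "1 \<le> i" for i y
      using tail_distr[OF mX[OF that]] distX[OF that] by simp
    show "\<P>(\<omega> in M. y < Zr (IY i j) \<omega>) = measure (dist_A G A) {y<..}" if "1 \<le> i" "1 \<le> j" for i j y
      using tail_distr[OF mY[OF that]] distY[OF that] by simp
    show "distr M borel (Zr (IT i)) = distr M borel (Zr (IT 1))" if "1 \<le> i" for i
      using distth[OF that] by (simp only: Zr_eta)
    show "AE \<omega> in M. 0 < Zr (IT 1) \<omega>" using th1pos by simp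
    show "AE \<omega> in M. finite {i. arr (Wr \<omega>) i \<le> T}" using finitely_many_arrivals by simp
  qed (fact C le lt r \<delta>(1) mom Mdist)+
qed

text \<open>The gauge sandwich holds wherever finitely many arrivals occur by T, that is almost
  surely, which is enough to compare probabilities.\<close>

lemma prob_Dr_bounds:
  assumes "claim_model (dist_A F A) M Zr Gb C r T \<delta>" and t: "t \<le> T" and x: "0 < x"
  shows "claim_model.claim_prob M Zr t (max_exceeds r x) \<le> ennreal (\<P>(\<omega> in M. D t \<omega> \<in> scale_set x A))"
    and "ennreal (\<P>(\<omega> in M. D t \<omega> \<in> scale_set x A)) \<le> claim_model.claim_prob M Zr t (sum_exceeds r x)"
proof -
  interpret C: claim_model "dist_A F A" M Zr Gb C r T \<delta> by fact
  have [measurable]: "scale_set x A \<in> sets borel" using open_scale_set[of x] x by simp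
  have Dm: "{\<omega> \<in> space M. D t \<omega> \<in> scale_set x A} \<in> sets M" by measurable
  have "C.max_prob x t \<le> emeasure M {\<omega> \<in> space M. D t \<omega> \<in> scale_set x A}"
    unfolding C.claim_prob_def
  proof (rule emeasure_mono_AE[OF _ Dm], use finitely_many_arrivals in eventually_elim)
    case (elim \<omega>)
    show ?case using Dr_sandwich(2)[OF elim t x] by blast
  qed
  then show "C.max_prob x t \<le> ennreal (\<P>(\<omega> in M. D t \<omega> \<in> scale_set x A))"
    by (simp add: emeasure_eq_measure)
  have "emeasure M {\<omega> \<in> space M. D t \<omega> \<in> scale_set x A} \<le> C.sum_prob x t"
    unfolding C.claim_prob_def
  proof (rule emeasure_mono_AE[OF _ C.sum_conditioning(3)], use finitely_many_arrivals in eventually_elim)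
    case (elim \<omega>)
    show ?case using Dr_sandwich(1)[OF elim t x] Dr_active(2)[OF elim t] by blast
  qed
  then show "ennreal (\<P>(\<omega> in M. D t \<omega> \<in> scale_set x A)) \<le> C.sum_prob x t"
    by (simp add: emeasure_eq_measure)
qed

section \<open>The limit expressions as expectations\<close>

lemma main_integral:
  assumes "claim_model (dist_A F A) M Zr Gb C r T \<delta>" and x: "0 < x"
  shows "(LINT s:{0..t}|ren. measure F (scale_set (x * exp (r * s)) A))
    = enn2real (claim_model.expected_main (dist_A F A) M Zr Gb r x t)"
proof -
  interpret C: claim_model "dist_A F A" M Zr Gb C r T \<delta> by fact
  have sR [measurable_cong]: "sets (ren) = sets borel"
    by (rule renewal_measure_nn_integral(1)[OF prob_space_axioms tau_measurable])
  have "(LINT s:{0..t}|ren. measure F (scale_set (x * exp (r * s)) A))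
     = (LINT s:{0..t}|ren. measure (dist_A F A) {x * exp (r * s)<..})"
    using x by (simp add: measure_dist_A[OF F_basic(2)])
  also have "\<dots> = enn2real (\<integral>\<^sup>+s. indicator {0..t} s * ennreal (measure (dist_A F A) {x * exp (r * s)<..}) \<partial>ren)"
    by (rule enn2real_LINT) (auto simp: sR)
  also have "(\<integral>\<^sup>+s. indicator {0..t} s * ennreal (measure (dist_A F A) {x * exp (r * s)<..}) \<partial>ren)
      = C.expected_main x t"
    unfolding C.expected_main_eq arr_Wr
    by (rule renewal_measure_nn_integral(2)[OF prob_space_axioms tau_measurable]) measurable
  finally show ?thesis .
qed

lemma delayed_integral:
  assumes "claim_model (dist_A F A) M Zr (\<lambda>y. measure (dist_A G A) {y<..}) C r T \<delta>" and x: "0 < x"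
  shows "(LINT m|K. real m) * (LINT s:{0..t}|ren.
       (LINT y:{0..t - s}|H. measure G (scale_set (x * exp (r * (s + y))) A)))
    = enn2real (claim_model.expected_delayed (dist_A F A) M Zr (\<lambda>y. measure (dist_A G A) {y<..}) r x t)"
proof -
  let ?Gb = "\<lambda>y. measure (dist_A G A) {y<..}"
  interpret C: claim_model "dist_A F A" M Zr ?Gb C r T \<delta> by fact
  note [measurable] = C.Gb_measurable
  interpret H: prob_space H using prob_space_distr[OF mD[of 1 1]] distD[of 1 1] by simp
  have sH [measurable_cong]: "sets H = sets borel" unfolding distD[of 1 1, OF order_refl order_refl, symmetric] by simp
  have sR [measurable_cong]: "sets (ren) = sets borel"
    by (rule renewal_measure_nn_integral(1)[OF prob_space_axioms tau_measurable])
  have distD': "distr M borel (Zr (ID i j)) = H" if "1 \<le> i" "1 \<le> j" for i j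
    using distD[OF that] by (simp add: Zr_eta)
  have mM1 [measurable]: "Mc 1 \<in> measurable M (count_space UNIV)" by (rule mM) simp
  have "(LINT m|K. real m) = (LINT \<omega>|M. real (Mc 1 \<omega>))"
    unfolding distM[of 1, OF order_refl, symmetric] by (rule integral_distr[OF mM1]) simp
  also have "\<dots> = enn2real (\<integral>\<^sup>+\<omega>. ennreal (real (Mc 1 \<omega>)) \<partial>M)"
    by (rule integral_eq_nn_integral[OF measurable_compose[OF mM1]]) simp_all
  \<comment> \<open>A natural number equals the number of j \<ge> 1 not exceeding it; this gives the
    series appearing in \<open>expected_delayed_eq\<close>.\<close>
  also have "(\<integral>\<^sup>+\<omega>. ennreal (real (Mc 1 \<omega>)) \<partial>M) = (\<integral>\<^sup>+\<omega>. (\<Sum>j. indicator {real (Suc j)..} (Zr (IM 1) \<omega>)) \<partial>M)"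
  proof (intro nn_integral_cong)
    fix \<omega>
    have "(\<Sum>j. indicator {real (Suc j)..} (Zr (IM 1) \<omega>)) = (\<Sum>j<Mc 1 \<omega>. indicator {real (Suc j)..} (Zr (IM 1) \<omega>) :: ennreal)"
      by (rule suminf_finite) (auto simp: indicator_def)
    also have "\<dots> = (\<Sum>j<Mc 1 \<omega>. 1)" by (intro sum.cong) (auto simp: indicator_def)
    finally show "ennreal (real (Mc 1 \<omega>)) = (\<Sum>j. indicator {real (Suc j)..} (Zr (IM 1) \<omega>))"
      by (simp add: ennreal_of_nat_eq_real_of_nat)
  qed
  also have "\<dots> = (\<Sum>j. \<integral>\<^sup>+\<omega>. indicator {real (Suc j)..} (Zr (IM 1) \<omega>) \<partial>M)"
    by (intro nn_integral_suminf) measurable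
  finally have EM: "(LINT m|K. real m) = enn2real (\<Sum>j. \<integral>\<^sup>+\<omega>. indicator {real (Suc j)..} (Zr (IM 1) \<omega>) \<partial>M)" .
  define \<psi> where "\<psi> s = (\<integral>\<^sup>+y. indicator {0..t - s} y * ennreal (?Gb (x * exp (r * (s + y)))) \<partial>H)" for s
  have \<psi>_meas [measurable]: "\<psi> \<in> borel_measurable borel"
  proof -
    have "(\<lambda>(s, y). (if 0 \<le> y \<and> y \<le> t - s then ennreal (?Gb (x * exp (r * (s + y)))) else 0)) \<in> borel_measurable (borel \<Otimes>\<^sub>M H)"
      by measurable
    from H.borel_measurable_nn_integral[OF this] show ?thesis
      unfolding \<psi>_def[abs_def] by (rule measurable_cong[THEN iffD1, rotated])
        (intro nn_integral_cong, auto simp: indicator_def)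
  qed
  \<comment> \<open>The inner integral is finite, so \<open>enn2real\<close> inside the outer
    integral loses nothing.\<close>
  have \<psi>1: "\<psi> s \<le> 1" for s
  proof -
    interpret GA: prob_space "dist_A G A" by (rule dist_A_basic(1)[OF G_basic])
    have "\<psi> s \<le> (\<integral>\<^sup>+y. 1 \<partial>H)" unfolding \<psi>_def
      by (intro nn_integral_mono) (auto simp: indicator_def)
    then show ?thesis by (simp add: H.emeasure_space_1)
  qed
  have inner: "(LINT y:{0..t - s}|H. measure G (scale_set (x * exp (r * (s + y))) A)) = enn2real (\<psi> s)" for s
  proof -
    have "(LINT y:{0..t - s}|H. measure G (scale_set (x * exp (r * (s + y))) A))
       = (LINT y:{0..t - s}|H. ?Gb (x * exp (r * (s + y))))"
      using x by (simp add: measure_dist_A[OF G_basic(2)])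
    also have "\<dots> = enn2real (\<psi> s)" unfolding \<psi>_def by (rule enn2real_LINT) (auto simp: sH)
    finally show ?thesis .
  qed
  have "(LINT s:{0..t}|ren. enn2real (\<psi> s))
      = enn2real (\<integral>\<^sup>+s. indicator {0..t} s * ennreal (enn2real (\<psi> s)) \<partial>ren)"
    by (rule enn2real_LINT) (auto simp: sR)
  also have "(\<integral>\<^sup>+s. indicator {0..t} s * ennreal (enn2real (\<psi> s)) \<partial>ren)
      = (\<integral>\<^sup>+s. indicator {0..t} s * \<psi> s \<partial>ren)"
    using le_less_trans[OF \<psi>1 ennreal_one_less_top] by simp
  also have "\<dots> = (\<Sum>i. \<integral>\<^sup>+\<omega>. indicator {0..t} (tau th (Suc i) \<omega>) * \<psi> (tau th (Suc i) \<omega>) \<partial>M)"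
    by (rule renewal_measure_nn_integral(2)[OF prob_space_axioms tau_measurable]) measurable
  also have "\<dots> = (\<Sum>i. \<integral>\<^sup>+\<omega>. \<integral>\<^sup>+y. C.delayed_fn x t (arr (Wr \<omega>) (Suc i)) y \<partial>H \<partial>M)"
    unfolding arr_Wr C.delayed_fn_def \<psi>_def
    by (intro suminf_cong nn_integral_cong nn_integral_cmult[symmetric]) measurable
  finally have outer: "(LINT s:{0..t}|ren. enn2real (\<psi> s))
      = enn2real (\<Sum>i. \<integral>\<^sup>+\<omega>. \<integral>\<^sup>+y. C.delayed_fn x t (arr (Wr \<omega>) (Suc i)) y \<partial>H \<partial>M)" .
  have "C.expected_delayed x t = (\<Sum>j. \<integral>\<^sup>+\<omega>. indicator {real (Suc j)..} (Zr (IM 1) \<omega>) \<partial>M) *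
      (\<Sum>i. \<integral>\<^sup>+\<omega>. \<integral>\<^sup>+y. C.delayed_fn x t (arr (Wr \<omega>) (Suc i)) y \<partial>H \<partial>M)"
    by (rule C.expected_delayed_eq) (rule distD')
  \<comment> \<open>\<open>enn2real\<close> is multiplicative on all of \<open>ennreal\<close>,
    infinite factors included.\<close>
  then show ?thesis by (simp only: inner EM outer enn2real_mult)
qed

text \<open>Every \<tau>_i is at least \<tau>_1 = \<theta>_1, so \<lambda>(t) would vanish together
  with P(\<tau>_1 \<le> t).\<close>

lemma first_arrival_pos:
  assumes "0 < renewal_fun M th t"
  shows "0 < \<P>(\<omega> in M. Zr (IT 1) \<omega> \<le> t)"
proof (rule ccontr)
  assume "\<not> ?thesis"
  then have 0: "\<P>(\<omega> in M. th 1 \<omega> \<le> t) = 0"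
    by (simp add: zero_less_measure_iff)
  have [measurable]: "th 1 \<in> borel_measurable M" by (rule mth) simp
  have ev: "{\<omega>\<in>space M. th 1 \<omega> \<le> t} \<in> events" by measurable
  have "\<P>(\<omega> in M. tau th (Suc i) \<omega> \<le> t) = 0" for i
  proof -
    have "tau th 1 \<omega> \<le> tau th (Suc i) \<omega>" for \<omega> by (rule tau_mono[of th \<omega> 1 "Suc i", OF thnn]) simp_all
    then have "th 1 \<omega> \<le> tau th (Suc i) \<omega>" for \<omega> by (simp add: tau_def)
    then have "\<P>(\<omega> in M. tau th (Suc i) \<omega> \<le> t) \<le> \<P>(\<omega> in M. th 1 \<omega> \<le> t)"
      by (intro finite_measure_mono[OF _ ev]) (auto intro: order_trans)
    then show ?thesis using 0 measure_nonneg[of M] by (simp add: antisym)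
  qed
  then show False using assms by (simp add: renewal_fun_def)
qed

section \<open>The two asymptotic relations\<close>

lemma tail_domination:
  assumes F: "subexp_A A F" and O: "(\<lambda>x. measure G (scale_set x A)) \<in> O(\<lambda>x. measure F (scale_set x A))"
  shows "\<exists>C\<ge>1. \<forall>y. measure (dist_A G A) {y<..} \<le> C * measure (dist_A F A) {y<..}"
proof -
  interpret V: subexp_dist "dist_A F A" by (rule subexp_distI[OF F_basic F])
  interpret GA: prob_space "dist_A G A" by (rule dist_A_basic(1)[OF G_basic])
  obtain c where c: "0 < c" "\<forall>\<^sub>F x in at_top. norm (measure G (scale_set x A)) \<le> c * norm (measure F (scale_set x A))"
    using O by (auto elim: landau_o.bigE)
  then obtain x0 where x0: "\<And>x. x0 \<le> x \<Longrightarrow> measure G (scale_set x A) \<le> c * measure F (scale_set x A)"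
    by (auto simp: eventually_at_top_linorder)
  \<comment> \<open>Keeps the level positive, as \<open>measure_dist_A\<close> requires; below x1
    the bound 1 \<le> tbar y / tbar x1 takes over.\<close>
  define x1 where "x1 = max x0 1"
  define C where "C = Max {1, c, 1 / V.tbar x1}"
  have C: "1 \<le> C" "c \<le> C" "1 / V.tbar x1 \<le> C" by (auto simp: C_def)
  have "measure (dist_A G A) {y<..} \<le> C * V.tbar y" for y
  proof (cases "x1 \<le> y")
    case True
    then have "measure (dist_A G A) {y<..} \<le> c * V.tbar y"
      using x0[of y] by (simp add: x1_def measure_dist_A F_basic G_basic)
    also have "\<dots> \<le> C * V.tbar y" using C by (intro mult_right_mono) auto
    finally show ?thesis .
  next
    case False
    have "measure (dist_A G A) {y<..} \<le> 1" by simp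
    also have "1 \<le> 1 / V.tbar x1 * V.tbar y"
      using False V.tbar_antimono[of y x1] V.tbar_pos[of x1] by (simp add: field_simps)
    also have "\<dots> \<le> C * V.tbar y" using C by (intro mult_right_mono) auto
    finally show ?thesis .
  qed
  then show ?thesis using C(1) by blast
qed

lemma asymp_total:
  assumes F: "subexp_A A F" and G: "subexp_A A G"
    and O: "(\<lambda>x. measure G (scale_set x A)) \<in> O(\<lambda>x. measure F (scale_set x A))"
  shows "asymp_unif
       (\<lambda>x t. \<P>(\<omega> in M. D t \<omega> \<in> scale_set x A))
       (\<lambda>x t. (LINT s:{0..t}|ren. measure F (scale_set (x * exp (r * s)) A))
            + (LINT m|K. real m) *
              (LINT s:{0..t}|ren.
                 (LINT y:{0..t - s}|H. measure G (scale_set (x * exp (r * (s + y))) A))))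
       ({0..T} \<inter> {t. renewal_fun M th t > 0})"
  unfolding asymp_unif_def
proof (intro allI impI, goal_cases)
  case (1 e)
  then have e: "0 < e" .
  let ?Gb = "\<lambda>y. measure (dist_A G A) {y<..}"
  interpret U: subexp_dist "dist_A G A" by (rule subexp_distI[OF G_basic G])
  obtain C where C: "1 \<le> C" "\<And>y. ?Gb y \<le> C * measure (dist_A F A) {y<..}"
    using tail_domination[OF F O] by blast
  have "\<exists>x0. \<forall>y\<ge>x0. ?Gb (y - h) \<le> ?Gb y + e * measure (dist_A F A) {y<..}" if "0 \<le> h" "0 < e" for h e
  proof -
    \<comment> \<open>The long tail of G gives an error relative to \<open>?Gb\<close>; its
      domination by C times the tail of F converts this into e times the tail of F.\<close>
    have "0 < e / C" using that C(1) by simp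
    from U.long_tailed[OF that(1) this] obtain x0 where x0: "\<And>y. x0 \<le> y \<Longrightarrow> ?Gb (y - h) \<le> (1 + e / C) * ?Gb y"
      by (auto simp: eventually_at_top_linorder)
    have "?Gb (y - h) \<le> ?Gb y + e * measure (dist_A F A) {y<..}" if "x0 \<le> y" for y
    proof -
      have "e / C * ?Gb y \<le> e / C * (C * measure (dist_A F A) {y<..})"
        using C \<open>0 < e / C\<close> by (intro mult_left_mono) auto
      also have "\<dots> = e * measure (dist_A F A) {y<..}" using C(1) by simp
      finally show ?thesis using x0[OF that] by (simp add: distrib_right)
    qed
    then show ?thesis by blast
  qed
  then obtain \<delta> where cm: "claim_model (dist_A F A) M Zr ?Gb C r T \<delta>"
    using claim_model_exists[OF F C] by blast
  interpret C: claim_model "dist_A F A" M Zr ?Gb C r T \<delta> by (rule cm)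
  show ?case using C.ratio_total[OF e] eventually_gt_at_top[of 0]
  proof eventually_elim
    case prems: (elim x)
    show ?case
    proof (intro ballI, goal_cases)
      case hyp: (1 t)
      with prems have x: "0 < x" and t: "t \<le> T" and lam: "0 < renewal_fun M th t" by auto
      show ?case
        unfolding main_integral[OF cm x] delayed_integral[OF cm x]
        by (rule prems(1)[rule_format, OF t first_arrival_pos[OF lam] measure_nonneg prob_Dr_bounds[OF cm t x]])
    qed
  qed
qed

lemma asymp_main:
  assumes F: "subexp_A A F"
    and o: "(\<lambda>x. measure G (scale_set x A)) \<in> o(\<lambda>x. measure F (scale_set x A))"
  shows "asymp_unif
       (\<lambda>x t. \<P>(\<omega> in M. D t \<omega> \<in> scale_set x A))
       (\<lambda>x t. LINT s:{0..t}|ren. measure F (scale_set (x * exp (r * s)) A))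
       ({0..T} \<inter> {t. renewal_fun M th t > 0})"
  unfolding asymp_unif_def
proof (intro allI impI, goal_cases)
  case (1 e)
  then have e: "0 < e" .
  let ?Gb = "\<lambda>y. measure (dist_A G A) {y<..}"
  interpret V: subexp_dist "dist_A F A" by (rule subexp_distI[OF F_basic F])
  obtain C where C: "1 \<le> C" "\<And>y. ?Gb y \<le> C * V.tbar y"
    using tail_domination[OF F landau_o.small_imp_big[OF o]] by blast
  have small: "\<forall>e>0. \<exists>x0. \<forall>y\<ge>x0. ?Gb y \<le> e * V.tbar y"
  proof (intro allI impI)
    fix e :: real assume "0 < e"
    have "\<forall>\<^sub>F x in at_top. norm (measure G (scale_set x A)) \<le> e * norm (measure F (scale_set x A))"
      using o \<open>0 < e\<close> by (rule landau_o.smallD)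
    then obtain x0 where x0: "\<And>x. x0 \<le> x \<Longrightarrow> measure G (scale_set x A) \<le> e * measure F (scale_set x A)"
      by (auto simp: eventually_at_top_linorder)
    have "?Gb y \<le> e * V.tbar y" if "max x0 1 \<le> y" for y
      using x0[of y] that by (simp add: measure_dist_A F_basic G_basic)
    then show "\<exists>x0. \<forall>y\<ge>x0. ?Gb y \<le> e * V.tbar y" by blast
  qed
  \<comment> \<open>The long tail of F stands in for that of G: \<open>?Gb (y - h)\<close> is at
    most e / 2 times the tail of F at y - h, hence at most e times the tail of F at y.\<close>
  have "\<exists>x0. \<forall>y\<ge>x0. ?Gb (y - h) \<le> ?Gb y + e * V.tbar y" if "0 \<le> h" "0 < e" for h e
  proof -
    obtain x1 where x1: "\<And>y. x1 \<le> y \<Longrightarrow> ?Gb y \<le> e / 2 * V.tbar y"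
      using small[rule_format, OF half_gt_zero[OF \<open>0 < e\<close>]] by blast
    obtain x2 where x2: "\<And>y. x2 \<le> y \<Longrightarrow> V.tbar (y - h) \<le> (1 + 1) * V.tbar y"
      using V.long_tailed[OF \<open>0 \<le> h\<close>, of 1] by (auto simp: eventually_at_top_linorder)
    have "?Gb (y - h) \<le> ?Gb y + e * V.tbar y" if y: "max (x1 + h) x2 \<le> y" for y
    proof -
      have "?Gb (y - h) \<le> e / 2 * V.tbar (y - h)" using y by (intro x1) auto
      also have "\<dots> \<le> e / 2 * ((1 + 1) * V.tbar y)" using y \<open>0 < e\<close> by (intro mult_left_mono x2) auto
      also have "\<dots> = e * V.tbar y" by simp
      finally show ?thesis using measure_nonneg[of "dist_A G A" "{y<..}"] by linarith
    qed
    then show ?thesis by blast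
  qed
  then obtain \<delta> where cm: "claim_model (dist_A F A) M Zr ?Gb C r T \<delta>"
    using claim_model_exists[OF F C] by blast
  interpret C: claim_model "dist_A F A" M Zr ?Gb C r T \<delta> by (rule cm)
  show ?case using C.ratio_main[OF e small] eventually_gt_at_top[of 0]
  proof eventually_elim
    case prems: (elim x)
    show ?case
    proof (intro ballI, goal_cases)
      case hyp: (1 t)
      with prems have x: "0 < x" and t: "t \<le> T" and lam: "0 < renewal_fun M th t" by auto
      show ?case
        unfolding main_integral[OF cm x]
        by (rule prems(1)[rule_format, OF t first_arrival_pos[OF lam] measure_nonneg prob_Dr_bounds[OF cm t x]])
    qed
  qed
qed

end

theorem theorem3p1:
  fixes M :: "'w measure"
    and X :: "nat \<Rightarrow> 'w \<Rightarrow> real^'d" and Y :: "nat \<Rightarrow> nat \<Rightarrow> 'w \<Rightarrow> real^'d"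
    and Mc :: "nat \<Rightarrow> 'w \<Rightarrow> nat" and Dl :: "nat \<Rightarrow> nat \<Rightarrow> 'w \<Rightarrow> real"
    and th :: "nat \<Rightarrow> 'w \<Rightarrow> real"
    and F G :: "(real^'d) measure" and K :: "nat measure" and H :: "real measure"
    and A :: "(real^'d) set" and r T :: real
  assumes P: "prob_space M"
    (* measurability *)
    and mX: "\<And>i. i \<ge> 1 \<Longrightarrow> X i \<in> borel_measurable M"
    and mY: "\<And>i j. i \<ge> 1 \<Longrightarrow> j \<ge> 1 \<Longrightarrow> Y i j \<in> borel_measurable M"
    and mM: "\<And>i. i \<ge> 1 \<Longrightarrow> Mc i \<in> measurable M (count_space UNIV)"
    and mD: "\<And>i j. i \<ge> 1 \<Longrightarrow> j \<ge> 1 \<Longrightarrow> Dl i j \<in> borel_measurable M"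
    and mth: "\<And>i. i \<ge> 1 \<Longrightarrow> th i \<in> borel_measurable M"
    (* ranges *)
    and Xnn: "\<And>i \<omega>. i \<ge> 1 \<Longrightarrow> X i \<omega> \<in> nonneg_orthant"
    and Ynn: "\<And>i j \<omega>. i \<ge> 1 \<Longrightarrow> j \<ge> 1 \<Longrightarrow> Y i j \<omega> \<in> nonneg_orthant"
    and Dnn: "\<And>i j \<omega>. i \<ge> 1 \<Longrightarrow> j \<ge> 1 \<Longrightarrow> Dl i j \<omega> \<ge> 0"
    and thnn: "\<And>i \<omega>. i \<ge> 1 \<Longrightarrow> th i \<omega> \<ge> 0"
    and th1pos: "AE \<omega> in M. th 1 \<omega> > 0"
    (* Assumption 1 + 2: mutual independence *)
    and indep: "model_indep M X Y Mc Dl th"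
    (* Assumption 2: identical distributions *)
    and distX: "\<And>i. i \<ge> 1 \<Longrightarrow> distr M borel (X i) = F"
    and distY: "\<And>i j. i \<ge> 1 \<Longrightarrow> j \<ge> 1 \<Longrightarrow> distr M borel (Y i j) = G"
    and distM: "\<And>i. i \<ge> 1 \<Longrightarrow> distr M (count_space UNIV) (Mc i) = K"
    and distD: "\<And>i j. i \<ge> 1 \<Longrightarrow> j \<ge> 1 \<Longrightarrow> distr M borel (Dl i j) = H"
    and distth: "\<And>i. i \<ge> 1 \<Longrightarrow> distr M borel (th i) = distr M borel (th 1)"
    (* main claims not identically zero *)
    and Xnz: "measure F {0} < 1"
    (* finite renewal function *)
    and lam_fin: "\<And>t. summable (\<lambda>i. measure M {\<omega> \<in> space M. tau th (Suc i) \<omega> \<le> t})"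
    (* hypotheses of the theorem *)
    and AR: "A \<in> class_R"
    and r: "r \<ge> 0"
    and expmom: "\<exists>\<delta>>0. integrable K (\<lambda>m. exp (\<delta> * real m))"
    and TL: "renewal_fun M th T > 0"
  shows
   "(subexp_A A F \<and> subexp_A A G \<and>
       (\<lambda>x. measure G (scale_set x A)) \<in> \<Theta>(\<lambda>x. measure F (scale_set x A)) \<longrightarrow>
     asymp_unif
       (\<lambda>x t. measure M {\<omega> \<in> space M. Dr X Y Mc Dl th r t \<omega> \<in> scale_set x A})
       (\<lambda>x t. (LINT s:{0..t}|renewal_measure M th. measure F (scale_set (x * exp (r * s)) A))
            + (LINT m|K. real m) *
              (LINT s:{0..t}|renewal_measure M th.
                 (LINT y:{0..t - s}|H. measure G (scale_set (x * exp (r * (s + y))) A))))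
       ({0..T} \<inter> {t. renewal_fun M th t > 0}))
  \<and>
   (subexp_A A F \<and>
       (\<lambda>x. measure G (scale_set x A)) \<in> o(\<lambda>x. measure F (scale_set x A)) \<longrightarrow>
     asymp_unif
       (\<lambda>x t. measure M {\<omega> \<in> space M. Dr X Y Mc Dl th r t \<omega> \<in> scale_set x A})
       (\<lambda>x t. LINT s:{0..t}|renewal_measure M th. measure F (scale_set (x * exp (r * s)) A))
       ({0..T} \<inter> {t. renewal_fun M th t > 0}))"
proof -
  interpret risk_model M A X Y Mc Dl th F G K H r T
    by (intro risk_model.intro risk_model_axioms.intro increasing_set.intro) (fact P AR mX mY mM mD mth Xnn Ynn Dnn
      thnn th1pos indep distX distY distM distD distth lam_fin r expmom)+
  show ?thesis
    using asymp_total asymp_main bigthetaD1 by blast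
qed

end
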